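(* Let $d\in\mathbb N$, $\alpha>1/2$, let $\boldsymbol\gamma=\{\gamma_{\mathfrak u}\}_{\mathfrak u\subset\mathbb N}$ be positive weights, let $\tau\in(0,1)$ and let $n\ge2$ be an integer. For each $s=1,\dots,d$ and then each prime $p\in\mathcal P_n$ in increasing order, with the previously chosen components $\boldsymbol z'_\star=(z_1^\star,\dots,z_{s-1}^\star)$ and elements $z_{s,\star}^{(q)}$ for $q\in\mathcal P_n$, $q<p$, held fixed, choose $z_{s,\star}^{(p)}$ from the set $\widetilde G^{(p)}_{s,\tau,\boldsymbol z'_\star}$ to minimise $T_s^{(p)}\big(z_s^{(p)};\{z_{s,\star}^{(q)}\}_{q\in\mathcal P_n,\,q<p}\big)$ over $z_s^{(p)}$ in that set; once this is done for all $p\in\mathcal P_n$, let $z_s^\star\in\mathbb Z_N$, $N=\prod_{p\in\mathcal P_n}p$, be the unique element with $z_s^\star\equiv_p z_{s,\star}^{(p)}$ for all $p\in\mathcal P_n$. Then the randomised error, for integration of functions from the space $\mathcal H_{d,\alpha,\boldsymbol\gamma}$, of the randomised lattice algorithm $Q^{\mathrm{ran\text{-}pr}}_{d,n,\boldsymbol z^\star}$ with the so constructed generating vector $\boldsymbol z^\star=(z_1^\star,\dots,z_d^\star)$ satisfies $$ e^{\mathrm{ran}}_{d,\alpha,\boldsymbol\gamma}\big(Q^{\mathrm{ran\text{-}pr}}_{d,n,\boldsymbol z^\star}\big)\le\frac{(C_{\tau,\lambda}\ln n)^{1/2}}{n^{\lambda+1/2}}\big[\mu_{d,\alpha,\boldsymbol\gamma}(\lambda)\big]^\lambda\qquad\text{for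 all }\lambda\in[1/2,\alpha), $$ where $C_{\tau,\lambda}>0$ is a constant depending only on $\tau$ and $\lambda$, which goes to infinity for $\tau\to0$ or for $\tau\to1$. The quantity $\mu_{d,\alpha,\boldsymbol\gamma}(\lambda)$ goes to infinity for $\lambda\to\alpha$. The upper bound is independent of the dimension (i.e., it can be bounded by a quantity not depending on $d$) if the weights are such that $$\sum_{\emptyset\ne\mathfrak u\subset\mathbb N}\gamma_{\mathfrak u}^{1/\lambda}(2\zeta(\alpha/\lambda))^{|\mathfrak u|}<\infty,$$ the sum being over finite subsets.
   Context: Conventions: $\mathbb N=\{1,2,\dots\}$; $\mathbb Z_m$ is identified with $\{0,\dots,m-1\}$; $\equiv_m$ means congruent modulo $m$; $\zeta$ is the Riemann zeta function; $\mathrm{supp}(\boldsymbol h)=\{j: h_j\ne0\}$. Weights: $\boldsymbol\gamma=\{\gamma_{\mathfrak u}\}$ is a collection of positive finite numbers indexed by the finite subsets $\mathfrak u\subset\mathbb N$. Weighted Korobov space: for $\alpha>1/2$ put $r_{\alpha,\boldsymbol\gamma}(\boldsymbol h)=\gamma_{\mathrm{supp}(\boldsymbol h)}^{-1}\prod_{j\in\mathrm{supp}(\boldsymbol h)}|h_j|^\alpha$ (for $\boldsymbol h\in\mathbb Z^s$, any $s$) and $\widehat f(\boldsymbol h)=\int_{[0,1]^d}f(\boldsymbol x)e^{-2\pi \mathrm i\,\boldsymbol h\cdot\boldsymbol x}\,d\boldsymbol x$. Then $\mathcal H_{d,\alpha,\boldsymbol\gamma}=\{f\in L_2([0,1]^d):\|f\|_{d,\alpha,\boldsymbol\gamma}<\infty\}$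 with $\|f\|_{d,\alpha,\boldsymbol\gamma}=\big(\sum_{\boldsymbol h\in\mathbb Z^d}r_{\alpha,\boldsymbol\gamma}^2(\boldsymbol h)|\widehat f(\boldsymbol h)|^2\big)^{1/2}$; elements have absolutely convergent Fourier series and are identified with their continuous one-periodic representatives. For $\lambda\in[1/2,\alpha)$: $\mu_{d,\alpha,\boldsymbol\gamma}(\lambda)=\sum_{\boldsymbol h\in\mathbb Z^d\setminus\{\boldsymbol 0\}}r_{\alpha,\boldsymbol\gamma}^{-1/\lambda}(\boldsymbol h)=\sum_{\emptyset\ne\mathfrak u\subseteq\{1,\dots,d\}}\gamma_{\mathfrak u}^{1/\lambda}(2\zeta(\alpha/\lambda))^{|\mathfrak u|}$. Integral and lattice rule: $I_d(f)=\int_{[0,1]^d}f(\boldsymbol x)\,d\boldsymbol x$ and, for $\boldsymbol z\in\mathbb Z^d$, $m\in\mathbb N$, $Q_{d,m,\boldsymbol z}(f)=\frac1m\sum_{k=0}^{m-1}f\big(\frac{k\boldsymbol z\bmod m}{m}\big)$. $\mathcal P_n$ is the set of primes $p$ with $n/2<p\le n$. The randomised algorithm $Q^{\mathrm{ran\text{-}pr}}_{d,n,\boldsymbol z}$ (fixed $\boldsymbol z$) draws $p$ uniformly at random from $\mathcal P_n$ and returns $Q_{d,p,\boldsymbol z}(f)$. The randomised error of a randomised algorithm $A$ is $e^{\mathrm{ran}}_{d,\alpha,\boldsymbol\gamma}(A)=\sup_{\|f\|_{d,\alpha,\boldsymbol\gamma}\le1}\mathbb E[|A(f)-I_d(f)|]$.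 Search criteria: fix $s\ge1$ and $\boldsymbol z'\in\mathbb Z^{s-1}$ (empty if $s=1$). Write $\boldsymbol h=(\boldsymbol h',h_s)\in\mathbb Z^s$ with $\boldsymbol h'\in\mathbb Z^{s-1}$. For a prime $p$ and $z_s\in\mathbb Z_p$, with $\boldsymbol z=(\boldsymbol z',z_s)$, $$\theta_s^{(p)}(z_s)=\sum_{\substack{\boldsymbol h\in\mathbb Z^s,\ h_s\ne0\\ \boldsymbol h\cdot\boldsymbol z\equiv_p0}}r_{\alpha,\boldsymbol\gamma}^{-2}(\boldsymbol h),$$ $$\widetilde G^{(p)}_{s,\tau,\boldsymbol z'}=\Big\{z_s\in\mathbb Z_p:\ \theta_s^{(p)}(z_s)\le\inf_{\lambda\in[1/2,\alpha)}\Big(\frac{2}{(1-\tau)p}\sum_{\boldsymbol h\in\mathbb Z^s,\,h_s\ne0}r_{\alpha,\boldsymbol\gamma}^{-1/\lambda}(\boldsymbol h)\Big)^{2\lambda}\Big\}.$$ For $p\in\mathcal P_n$, $z_s^{(p)}\in\mathbb Z_p$ and given $z_s^{(q)}\in\mathbb Z_q$ for $q\in\mathcal P_n$ with $q<p$, $$T_s^{(p)}\big(z_s^{(p)};\{z_s^{(q)}\}_{q\in\mathcal P_n,q<p}\big)=\theta_s^{(p)}(z_s^{(p)})+2\sum_{\substack{q\in\mathcal P_n\\ q<p}}\ \sum_{\substack{\boldsymbol h\in\mathbb Z^s,\ h_s\ne0,\ h_s\not\equiv_p0\\ \boldsymbol h\cdot\boldsymbol z\equiv_p0,\ \boldsymbol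 h\cdot\boldsymbol z\equiv_q0}}r_{\alpha,\boldsymbol\gamma}^{-2}(\boldsymbol h)+2\sum_{\substack{q\in\mathcal P_n\\ q>p}}\ \sum_{\substack{\boldsymbol h\in\mathbb Z^s,\ h_s\ne0,\ h_s\equiv_q0\\ \boldsymbol h\cdot\boldsymbol z\equiv_p0,\ \boldsymbol h'\cdot\boldsymbol z'\equiv_q0}}r_{\alpha,\boldsymbol\gamma}^{-2}(\boldsymbol h),$$ where $\boldsymbol h\cdot\boldsymbol z\equiv_p0$ means $\boldsymbol h'\cdot\boldsymbol z'+h_sz_s^{(p)}\equiv_p0$, and $\boldsymbol h\cdot\boldsymbol z\equiv_q0$ (for $q<p$) means $\boldsymbol h'\cdot\boldsymbol z'+h_sz_s^{(q)}\equiv_q0$. In the construction, $\boldsymbol z'=\boldsymbol z'_\star$. *)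

theory Defs
  imports "HOL-Probability.Probability" "HOL-Number_Theory.Cong"
begin

text \<open>
  The dimension varies inside the statement, so it is a natural number and not a type.  A vector is
  a function on \<open>nat\<close> whose components are those with index in \<open>{1..d}\<close>.  Integer vectors are
  extended by \<open>0\<close>, so that the support is the same in every dimension; real vectors follow the
  \<open>undefined\<close> convention of \<open>PiE\<close> and \<open>PiM\<close>.
\<close>

section \<open>Weighted Korobov spaces\<close>

definition int_vecs :: "nat \<Rightarrow> (nat \<Rightarrow> int) set" where
  "int_vecs d = {h. \<forall>j. j \<notin> {1..d} \<longrightarrow> h j = 0}"

definition real_vecs :: "nat \<Rightarrow> (nat \<Rightarrow> real) set" where
  "real_vecs d = (\<Pi>\<^sub>E j\<in>{1..d}. UNIV)"

definition supp :: "(nat \<Rightarrow> int) \<Rightarrow> nat set" where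
  "supp h = {j. h j \<noteq> 0}"

definition index_sets :: "nat set set" where
  "index_sets = {u. finite u \<and> u \<subseteq> {1..}}"

definition positive_weights :: "(nat set \<Rightarrow> real) \<Rightarrow> bool" where
  "positive_weights \<gamma> \<longleftrightarrow> (\<forall>u\<in>index_sets. \<gamma> u > 0)"

definition r_weight :: "real \<Rightarrow> (nat set \<Rightarrow> real) \<Rightarrow> (nat \<Rightarrow> int) \<Rightarrow> real" where
  "r_weight \<alpha> \<gamma> h = inverse (\<gamma> (supp h)) * (\<Prod>j\<in>supp h. \<bar>real_of_int (h j)\<bar> powr \<alpha>)"

definition unit_cube :: "nat \<Rightarrow> (nat \<Rightarrow> real) measure" where
  "unit_cube d = (\<Pi>\<^sub>M j\<in>{1..d}. restrict_space lborel {0..1})"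

definition square_integrable :: "nat \<Rightarrow> ((nat \<Rightarrow> real) \<Rightarrow> complex) \<Rightarrow> bool" where
  "square_integrable d f \<longleftrightarrow>
     f \<in> borel_measurable (unit_cube d) \<and> integrable (unit_cube d) (\<lambda>x. (cmod (f x))\<^sup>2)"

definition fourier_coeff :: "nat \<Rightarrow> ((nat \<Rightarrow> real) \<Rightarrow> complex) \<Rightarrow> (nat \<Rightarrow> int) \<Rightarrow> complex" where
  "fourier_coeff d f h =
     (\<integral>x. f x * exp (- 2 * of_real pi * \<i> * of_real (\<Sum>j=1..d. real_of_int (h j) * x j)) \<partial>unit_cube d)"

text \<open>
  Each element of the space is represented by its continuous one-periodic representative on
  \<open>real_vecs d\<close>, so point evaluation is meaningful.  The topology is the product topology on
  \<open>nat \<Rightarrow> real\<close>, which induces the usual one on \<open>real_vecs d\<close>.  Finiteness of the norm is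
  summability of the series in \<open>korobov_norm\<close>.
\<close>

definition one_periodic :: "nat \<Rightarrow> ((nat \<Rightarrow> real) \<Rightarrow> complex) \<Rightarrow> bool" where
  "one_periodic d f \<longleftrightarrow> (\<forall>x\<in>real_vecs d. \<forall>j\<in>{1..d}. f (x(j := x j + 1)) = f x)"

definition korobov_space ::
    "nat \<Rightarrow> real \<Rightarrow> (nat set \<Rightarrow> real) \<Rightarrow> ((nat \<Rightarrow> real) \<Rightarrow> complex) set" where
  "korobov_space d \<alpha> \<gamma> =
     {f. square_integrable d f \<and> continuous_on (real_vecs d) f \<and> one_periodic d f \<and>
         (\<lambda>h. (r_weight \<alpha> \<gamma> h)\<^sup>2 * (cmod (fourier_coeff d f h))\<^sup>2) summable_on int_vecs d}"

definition korobov_norm ::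
    "nat \<Rightarrow> real \<Rightarrow> (nat set \<Rightarrow> real) \<Rightarrow> ((nat \<Rightarrow> real) \<Rightarrow> complex) \<Rightarrow> real" where
  "korobov_norm d \<alpha> \<gamma> f =
     sqrt (\<Sum>\<^sub>\<infinity>h\<in>int_vecs d. (r_weight \<alpha> \<gamma> h)\<^sup>2 * (cmod (fourier_coeff d f h))\<^sup>2)"

definition mu :: "nat \<Rightarrow> real \<Rightarrow> (nat set \<Rightarrow> real) \<Rightarrow> real \<Rightarrow> real" where
  "mu d \<alpha> \<gamma> lam = (\<Sum>\<^sub>\<infinity>h\<in>int_vecs d - {\<lambda>_. 0}. r_weight \<alpha> \<gamma> h powr (- (1 / lam)))"

text \<open>The Riemann zeta function on the half-line \<open>x > 1\<close>, where the series converges.\<close>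

definition zeta :: "real \<Rightarrow> real" where
  "zeta x = (\<Sum>k. 1 / real (Suc k) powr x)"


section \<open>Lattice rules and the randomised error\<close>

definition integral_cube :: "nat \<Rightarrow> ((nat \<Rightarrow> real) \<Rightarrow> complex) \<Rightarrow> complex" where
  "integral_cube d f = (\<integral>x. f x \<partial>unit_cube d)"

definition lattice_rule ::
    "nat \<Rightarrow> nat \<Rightarrow> (nat \<Rightarrow> int) \<Rightarrow> ((nat \<Rightarrow> real) \<Rightarrow> complex) \<Rightarrow> complex" where
  "lattice_rule d m z f =
     (1 / of_nat m) *
       (\<Sum>k<m. f (\<lambda>j\<in>{1..d}. real_of_int ((int k * z j) mod int m) / real m))"

definition primes_in :: "nat \<Rightarrow> nat set" where
  "primes_in n = {p. prime p \<and> real n / 2 < real p \<and> p \<le> n}"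

text \<open>A randomised algorithm assigns to each integrand the distribution of its output.\<close>

definition randomised_lattice ::
    "nat \<Rightarrow> nat \<Rightarrow> (nat \<Rightarrow> int) \<Rightarrow> ((nat \<Rightarrow> real) \<Rightarrow> complex) \<Rightarrow> complex pmf" where
  "randomised_lattice d n z f =
     map_pmf (\<lambda>p. lattice_rule d p z f) (pmf_of_set (primes_in n))"

text \<open>Taking values in \<open>ennreal\<close>, the supremum is meaningful whether or not it is finite.\<close>

definition ran_error ::
    "nat \<Rightarrow> real \<Rightarrow> (nat set \<Rightarrow> real) \<Rightarrow> (((nat \<Rightarrow> real) \<Rightarrow> complex) \<Rightarrow> complex pmf) \<Rightarrow> ennreal" where
  "ran_error d \<alpha> \<gamma> A =
     (SUP f\<in>{f \<in> korobov_space d \<alpha> \<gamma>. korobov_norm d \<alpha> \<gamma> f \<le> 1}.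
        \<integral>\<^sup>+ y. ennreal (cmod (y - integral_cube d f)) \<partial>measure_pmf (A f))"


section \<open>The component-by-component construction\<close>

text \<open>
  Below, \<open>z\<close> is only read at the indices \<open>1, \<dots>, s - 1\<close>, where it holds the components already
  chosen; \<open>z(s := y)\<close> is the vector of length \<open>s\<close> with last component \<open>y\<close>.
\<close>

definition inner_int :: "nat \<Rightarrow> (nat \<Rightarrow> int) \<Rightarrow> (nat \<Rightarrow> int) \<Rightarrow> int" where
  "inner_int s h z = (\<Sum>j=1..s. h j * z j)"

definition theta ::
    "real \<Rightarrow> (nat set \<Rightarrow> real) \<Rightarrow> nat \<Rightarrow> (nat \<Rightarrow> int) \<Rightarrow> nat \<Rightarrow> int \<Rightarrow> real" where
  "theta \<alpha> \<gamma> s z p y =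
     (\<Sum>\<^sub>\<infinity>h\<in>{h \<in> int_vecs s. h s \<noteq> 0 \<and> [inner_int s h (z(s := y)) = 0] (mod int p)}.
        r_weight \<alpha> \<gamma> h powr (- 2))"

definition good_set ::
    "real \<Rightarrow> (nat set \<Rightarrow> real) \<Rightarrow> real \<Rightarrow> nat \<Rightarrow> (nat \<Rightarrow> int) \<Rightarrow> nat \<Rightarrow> int set" where
  "good_set \<alpha> \<gamma> \<tau> s z p =
     {y \<in> {0..<int p}.
        theta \<alpha> \<gamma> s z p y \<le>
          (INF lam\<in>{1/2..<\<alpha>}.
             (2 / ((1 - \<tau>) * real p) *
               (\<Sum>\<^sub>\<infinity>h\<in>{h \<in> int_vecs s. h s \<noteq> 0}. r_weight \<alpha> \<gamma> h powr (- (1 / lam))))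
             powr (2 * lam))}"

text \<open>The function \<open>zs\<close> provides the values \<open>zs q\<close> already chosen for \<open>q < p\<close>.\<close>

definition T_criterion ::
    "real \<Rightarrow> (nat set \<Rightarrow> real) \<Rightarrow> nat \<Rightarrow> nat \<Rightarrow> (nat \<Rightarrow> int) \<Rightarrow> nat \<Rightarrow> (nat \<Rightarrow> int) \<Rightarrow> int \<Rightarrow> real" where
  "T_criterion \<alpha> \<gamma> n s z p zs y =
     theta \<alpha> \<gamma> s z p y
     + 2 * (\<Sum>q\<in>{q \<in> primes_in n. q < p}.
         \<Sum>\<^sub>\<infinity>h\<in>{h \<in> int_vecs s. h s \<noteq> 0 \<and> \<not> [h s = 0] (mod int p) \<and>
                  [inner_int s h (z(s := y)) = 0] (mod int p) \<and>
                  [inner_int s h (z(s := zs q)) = 0] (mod int q)}.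
           r_weight \<alpha> \<gamma> h powr (- 2))
     + 2 * (\<Sum>q\<in>{q \<in> primes_in n. p < q}.
         \<Sum>\<^sub>\<infinity>h\<in>{h \<in> int_vecs s. h s \<noteq> 0 \<and> [h s = 0] (mod int q) \<and>
                  [inner_int s h (z(s := y)) = 0] (mod int p) \<and>
                  [inner_int (s - 1) h z = 0] (mod int q)}.
           r_weight \<alpha> \<gamma> h powr (- 2))"

text \<open>
  \<open>cbc_construction \<alpha> \<gamma> \<tau> d n zp z\<close>: with some resolution of ties among minimisers, the
  construction yields the values \<open>zp s p\<close> for each component \<open>s\<close> and prime \<open>p\<close>, and the generating
  vector \<open>z\<close>.
\<close>

definition cbc_construction ::
    "real \<Rightarrow> (nat set \<Rightarrow> real) \<Rightarrow> real \<Rightarrow> nat \<Rightarrow> nat \<Rightarrow> (nat \<Rightarrow> nat \<Rightarrow> int) \<Rightarrow> (nat \<Rightarrow> int) \<Rightarrow> bool" where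
  "cbc_construction \<alpha> \<gamma> \<tau> d n zp z \<longleftrightarrow>
     (\<forall>s\<in>{1..d}.
        (\<forall>p\<in>primes_in n.
           is_arg_min (T_criterion \<alpha> \<gamma> n s z p (zp s)) (\<lambda>y. y \<in> good_set \<alpha> \<gamma> \<tau> s z p) (zp s p)) \<and>
        z s \<in> {0..<int (\<Prod>(primes_in n))} \<and>
        (\<forall>p\<in>primes_in n. [z s = zp s p] (mod int p)))"

end

theory Submission
  imports Defs "HOL-Real_Asymp.Real_Asymp"
begin

text \<open>
  Since \<open>f\<close> equals its Fourier series pointwise, the error of the rule with \<open>p\<close> points is the sum of the
  Fourier coefficients over the nonzero \<open>h\<close> with \<open>p\<close> dividing \<open>h \<bullet> z\<close>.  Summing absolute values over \<open>p\<close> and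
  applying the Cauchy--Schwarz inequality over \<open>h\<close> leaves the double sum over pairs \<open>(p, q)\<close> of
  \<open>\<Sum> r(h)\<^sup>-\<^sup>2\<close> over the \<open>h \<noteq> 0\<close> with \<open>p\<close> and \<open>q\<close> dividing \<open>h \<bullet> z\<close>.  Sorting the \<open>h\<close> by their last nonzero
  component \<open>s\<close>, this is exactly the sum of the minimised criteria over \<open>s\<close> and \<open>p\<close>.  Each minimum is at most
  the average over the good set, which has at least \<open>\<tau> p\<close> elements by Markov's inequality.  In that
  average an off-diagonal term gains a factor \<open>1 / (\<tau> p)\<close> over the bound that the good set for \<open>q\<close>
  guarantees.  The diagonal terms gain nothing, but they are fewer by the number of primes in \<open>(n / 2, n]\<close>,
  which is at least \<open>c n / ln n\<close> by Chebyshev's argument; hence the factor \<open>ln n\<close>.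
\<close>

section \<open>Primes between n / 2 and n\<close>

text \<open>Membership in the good set is what bounds the cross terms: those with q < p lie inside
  the \<open>theta\<close> sum of q, which minimising the criterion would not control by itself.
  While p is treated, the residues for larger primes are unknown. A frequency common to p and a
  larger q is therefore left to the step of q, unless q divides the last component of h; then the
  residue modulo q cannot affect it and it is charged to p. This is why the criterion has two kinds
  of cross sums. The construction favours no single \<open>lam\<close>: the good set takes the
  infimum, and the averaging works for each \<open>lam\<close> separately, so one vector serves all.
  Markov's inequality is applied to sums of r^(-1/lam), where it gives the rate, and Jensen's
  inequality with exponent 2 lam \<ge> 1 leads back to r^(-2). The norm sees only Fourier
  coefficients, so pointwise equality with the series needs a uniqueness theorem: a continuous
  periodic function orthogonal to all characters vanishes. It is proved with powers of a
  trigonometric peak.\<close>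

lemma prod_primes_dvd:
  fixes n :: nat
  assumes "finite A" "\<And>p. p \<in> A \<Longrightarrow> prime p \<and> p dvd n"
  shows "\<Prod>A dvd n"
  using assms
proof (induction A rule: finite_induct)
  case (insert p A)
  have "coprime p (\<Prod>A)"
    using insert by (intro prod_coprime_right) (metis insertCI primes_coprime)
  then show ?case
    using insert by (auto intro: divides_mult)
qed auto

section \<open>Primorials are at most 4^n\<close>

lemma central_binomial_odd_le: "(2 * k + 1) choose k \<le> (4::nat) ^ k"
proof -
  have "2 * ((2 * k + 1) choose k) = (\<Sum>i\<in>{k, k + 1}. (2 * k + 1) choose i)"
    using binomial_symmetric[of k "2 * k + 1"] by simp
  also have "\<dots> \<le> (\<Sum>i\<le>2 * k + 1. (2 * k + 1) choose i)"
    by (intro sum_mono2) auto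
  also have "\<dots> = 2 * 4 ^ k"
    by (simp only: choose_row_sum) (simp add: power_mult)
  finally show ?thesis by simp
qed

text \<open>Erdos's induction. For n = 2 k + 1 the primes in (k + 1, n] divide
  \<open>n choose k\<close>, because they divide n! but neither k! nor (k + 1)!; that coefficient is
  at most 4^k, and the primes up to k + 1 are covered by induction. An even n > 2 is not
  prime.\<close>

lemma primorial_le: "\<Prod>{p. prime p \<and> p \<le> n} \<le> (4::nat) ^ n"
proof (induction n rule: less_induct)
  case (less n)
  consider "n < 2" | "n = 2" | "n > 2" "even n" | "n > 2" "odd n" by linarith
  then show ?case
  proof cases
    case 1
    then have "{p. prime p \<and> p \<le> n} = {}" by (auto dest: prime_ge_2_nat)
    then show ?thesis by (simp del: Collect_empty_eq)
  next
    case 2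
    have "{p::nat. prime p \<and> p \<le> 2} = {2}"
      by (auto simp: prime_ge_2_nat le_antisym)
    then show ?thesis using 2 by simp
  next
    case 3
    have "{p. prime p \<and> p \<le> n} = {p. prime p \<and> p \<le> n - 1}"
    proof -
      have "\<not> prime n" using 3 prime_odd_nat by blast
      then have "p \<le> n \<longleftrightarrow> p \<le> n - 1" if "prime p" for p
        using that by (cases "p = n") auto
      then show ?thesis by blast
    qed
    then have "\<Prod>{p. prime p \<and> p \<le> n} \<le> 4 ^ (n - 1)" using less[of "n - 1"] 3 by simp
    also have "\<dots> \<le> 4 ^ n" by simp
    finally show ?thesis .
  next
    case 4
    then obtain k where n: "n = 2 * k + 1" by (elim oddE)
    with 4 have k: "k \<ge> 1" by simp
    let ?A = "{p. prime p \<and> p \<le> k + 1}" and ?B = "{p. prime p \<and> k + 1 < p \<and> p \<le> n}"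
    have "\<Prod>?B dvd (2 * k + 1) choose k"
    proof (rule prod_primes_dvd)
      fix p assume p: "p \<in> ?B"
      then have "p dvd fact (2 * k + 1)" using n by (subst prime_dvd_fact_iff) auto
      also have "fact (2 * k + 1) = fact k * fact (k + 1) * ((2 * k + 1) choose k)"
        using binomial_fact_lemma[of k "2 * k + 1"] by simp
      finally show "prime p \<and> p dvd (2 * k + 1) choose k"
        using p by (auto simp: prime_dvd_mult_iff prime_dvd_fact_iff simp del: fact_Suc)
    qed auto
    then have "\<Prod>?B \<le> (2 * k + 1) choose k" by (rule dvd_imp_le) simp
    also note central_binomial_odd_le[of k]
    finally have B: "\<Prod>?B \<le> 4 ^ k" .
    have "{p. prime p \<and> p \<le> n} = ?A \<union> ?B" using n by auto
    then have "\<Prod>{p. prime p \<and> p \<le> n} = \<Prod>?A * \<Prod>?B"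
      by (simp only:, intro prod.union_disjoint) auto
    also have "\<dots> \<le> 4 ^ (k + 1) * 4 ^ k"
      using less[of "k + 1"] B n k by (intro mult_mono) auto
    finally show ?thesis using n by (simp add: power_add mult_2)
  qed
qed

section \<open>Prime powers dividing the central binomial coefficient\<close>

lemma multiplicity_eq_card_dvd_powers:
  fixes p n :: nat
  assumes "prime p" "n > 0" "n < p ^ Suc K"
  shows "multiplicity p n = card {k \<in> {1..K}. p ^ k dvd n}"
proof -
  have iff: "p ^ k dvd n \<longleftrightarrow> k \<le> multiplicity p n" for k
    using assms by (intro power_dvd_iff_le_multiplicity) auto
  have "p ^ multiplicity p n \<le> n"
    using assms(2) by (intro dvd_imp_le multiplicity_dvd)
  then have "p ^ multiplicity p n < p ^ Suc K" using assms by simp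
  then have "multiplicity p n \<le> K"
    using assms(1) prime_gt_1_nat power_less_imp_less_exp less_Suc_eq_le by blast
  then have "{k \<in> {1..K}. p ^ k dvd n} = {1..multiplicity p n}" unfolding iff by auto
  then show ?thesis by simp
qed

text \<open>Legendre's formula, cut off at \<open>K\<close>, beyond which all quotients vanish. From
  n to n + 1 the quotient by p^k grows by one exactly when p^k divides n + 1.\<close>

lemma multiplicity_fact:
  fixes p n :: nat
  assumes "prime p" "n < p ^ Suc K"
  shows "multiplicity p (fact n) = (\<Sum>k=1..K. n div p ^ k)"
  using assms(2)
proof (induction n)
  case (Suc n)
  have "multiplicity p (fact (Suc n)) = multiplicity p (Suc n) + multiplicity p (fact n :: nat)"
    using assms(1) by (simp add: prime_elem_multiplicity_mult_distrib del: mult_Suc)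
  also have "multiplicity p (Suc n) = (\<Sum>k=1..K. if p ^ k dvd Suc n then 1 else 0)"
    using multiplicity_eq_card_dvd_powers[OF assms(1) _ Suc.prems]
    by (simp add: sum.If_cases Int_def)
  also have "multiplicity p (fact n :: nat) = (\<Sum>k=1..K. n div p ^ k)" using Suc by simp
  finally show ?case
    by (simp only: sum.distrib[symmetric]) (intro sum.cong refl, simp add: div_Suc dvd_eq_mod_eq_0)
qed simp

lemma multiplicity_central_binomial:
  fixes p m :: nat
  assumes "prime p" "2 * m < p ^ Suc K"
  shows "multiplicity p ((2 * m) choose m) = (\<Sum>k=1..K. 2 * m div p ^ k - 2 * (m div p ^ k))"
proof -
  have "fact (2 * m) = fact m * fact m * ((2 * m) choose m)"
    using binomial_fact_lemma[of m "2 * m"] by simp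
  then have "multiplicity p (fact (2 * m) :: nat) =
      2 * multiplicity p (fact m :: nat) + multiplicity p ((2 * m) choose m)"
    using assms(1) by (simp add: prime_elem_multiplicity_mult_distrib)
  moreover have "m < p ^ Suc K" using assms by linarith
  ultimately have "(\<Sum>k=1..K. 2 * m div p ^ k) =
      2 * (\<Sum>k=1..K. m div p ^ k) + multiplicity p ((2 * m) choose m)"
    using multiplicity_fact[OF assms] multiplicity_fact[OF assms(1)] by simp
  \<comment> \<open>Subtraction of natural numbers truncates; this inequality makes the differences
    in the sum genuine.\<close>
  moreover have "2 * (m div q) \<le> 2 * m div q" for q :: nat
  proof (cases "q = 0")
    case False
    then show ?thesis
      using div_times_less_eq_dividend[of m q] by (simp add: less_eq_div_iff_mult_less_eq)
  qed simp
  ultimately show ?thesis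
    by (simp add: sum_subtractf_nat sum_distrib_left)
qed

text \<open>Every summand in the formula for the multiplicity is 0 or 1, and only exponents k with
  p^k \<le> 2 m contribute, so the multiplicity is at most the largest such k.\<close>

lemma prime_power_central_binomial_le:
  fixes p m :: nat
  assumes "prime p" "m > 0"
  shows "p ^ multiplicity p ((2 * m) choose m) \<le> 2 * m"
proof -
  obtain K where K: "p ^ K \<le> 2 * m" "2 * m < p ^ Suc K"
    using ex_power_ivl1[of p "2 * m"] prime_ge_2_nat[OF assms(1)] assms by auto
  have "2 * m div q - 2 * (m div q) \<le> 1" for q
  proof (cases "q = 0")
    case False
    then have "2 * m < (2 * (m div q) + 2) * q"
      using dividend_less_times_div[of q m] by (simp add: algebra_simps)
    then have "2 * m div q < 2 * (m div q) + 2"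
      by (rule less_mult_imp_div_less)
    then show ?thesis by simp
  qed simp
  then have "multiplicity p ((2 * m) choose m) \<le> (\<Sum>k=1..K. 1)"
    unfolding multiplicity_central_binomial[OF assms(1) K(2)] by (intro sum_mono)
  then have "p ^ multiplicity p ((2 * m) choose m) \<le> p ^ K"
    using prime_ge_1_nat[OF assms(1)] by (intro power_increasing) auto
  then show ?thesis using K by simp
qed

text \<open>Here 2 m / p has integer part 2 and m / p has integer part 1, so the first power
  cancels; higher powers do not occur, as p \<ge> 3 gives p^2 \<ge> 3 p > 2 m.\<close>

lemma multiplicity_central_binomial_middle:
  fixes p m :: nat
  assumes "prime p" "p > 2" "2 * m < 3 * p" "p \<le> m"
  shows "multiplicity p ((2 * m) choose m) = 0"
proof -
  have "3 * p \<le> p * p" using assms by (intro mult_right_mono) auto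
  then have "2 * m < p ^ Suc 1" proof -
    have "2 * m < p * p" using assms(3) \<open>3 * p \<le> p * p\<close> by linarith
    then show ?thesis by simp
  qed
  moreover have "2 * m div p = 2" using assms by (intro div_nat_eqI) auto
  moreover have "m div p = 1" using assms by (intro div_nat_eqI) auto
  ultimately show ?thesis using multiplicity_central_binomial[OF assms(1), of m 1] by simp
qed

text \<open>The prime powers are split by size. Each of those with p \<le> s is at most 2 m. For s <
  p \<le> m the multiplicity is at most 1, since p^2 > 2 m, and it is 0 above 2 m / 3, so the
  primorial bound applies. What is left are the primes in (m, 2 m], which are to be counted.\<close>

lemma central_binomial_le_primes:
  fixes m s :: nat
  assumes "m \<ge> 3" "2 * m < Suc s ^ 2"
  shows "(2 * m) choose m \<le>
           (2 * m) ^ s * 4 ^ (2 * m div 3) * (2 * m) ^ card {p. prime p \<and> m < p \<and> p \<le> 2 * m}"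
proof -
  let ?N = "(2 * m) choose m"
  define v where "v p = p ^ multiplicity p ?N" for p
  define A where "A = {p::nat. prime p \<and> p \<le> 2 * m \<and> p \<le> s}"
  define B where "B = {p::nat. prime p \<and> s < p \<and> p \<le> m}"
  \<comment> \<open>The clause \<open>s < p\<close> keeps \<open>D\<close> disjoint from
    \<open>A\<close> without any comparison of \<open>s\<close> and \<open>m\<close>.\<close>
  define D where "D = {p::nat. prime p \<and> m < p \<and> p \<le> 2 * m \<and> s < p}"
  have fin: "finite A" "finite B" "finite D" unfolding A_def B_def D_def by auto
  have pos: "?N > 0" by simp
  have "prime_factors ?N \<subseteq> A \<union> B \<union> D"
  proof
    fix p assume p: "p \<in> prime_factors ?N"
      have "?N dvd fact (2 * m)"
        using binomial_fact_lemma[of m "2 * m"] by (metis dvd_triv_right le_add1 mult_2)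
    then have "p dvd fact (2 * m)" using p by (auto dest: dvd_trans)
    then have "p \<le> 2 * m" using p in_prime_factors_imp_prime[OF p] by (simp add: prime_dvd_fact_iff)
    then show "p \<in> A \<union> B \<union> D" using p by (auto simp: A_def B_def D_def)
  qed
  moreover have "v p = 1" if "p \<in> (A \<union> B \<union> D) - prime_factors ?N" for p
  proof -
    have "prime p" using that by (auto simp: A_def B_def D_def)
    then have "\<not> p dvd ?N" using that pos by (simp add: in_prime_factors_iff)
    then show ?thesis by (simp add: v_def not_dvd_imp_multiplicity_0)
  qed
  ultimately have "prod v (prime_factors ?N) = prod v (A \<union> B \<union> D)"
    using fin by (intro prod.mono_neutral_left) auto
  moreover have "?N = prod v (prime_factors ?N)"
    unfolding v_def using pos by (rule prime_factorization_nat)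
  ultimately have "?N = prod v (A \<union> B \<union> D)" by metis
  also have "\<dots> = prod v A * prod v B * prod v D"
    using fin by (subst prod.union_disjoint, auto simp: A_def B_def D_def)+
  also have "\<dots> \<le> (2 * m) ^ s * 4 ^ (2 * m div 3) * (2 * m) ^ card {p. prime p \<and> m < p \<and> p \<le> 2 * m}"
  proof (intro mult_mono)
    have v: "v p \<le> 2 * m" if "prime p" for p
      unfolding v_def using that assms(1) by (intro prime_power_central_binomial_le) auto
    have card_le: "prod v X \<le> (2 * m) ^ k" if "card X \<le> k" "\<And>p. p \<in> X \<Longrightarrow> prime p" for X k
    proof -
      have "prod v X \<le> (\<Prod>p\<in>X. 2 * m)" using that v by (intro prod_mono) auto
      also have "\<dots> \<le> (2 * m) ^ k" using that(1) assms(1) by (simp only: prod_constant) (intro power_increasing, auto)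
      finally show ?thesis .
    qed
    have "A \<subseteq> {1..s}"
      by (auto simp: A_def Suc_le_eq prime_gt_0_nat)
    then have "card A \<le> s" using card_mono[of "{1..s}" A] by simp
    then show "prod v A \<le> (2 * m) ^ s"
      by (rule card_le) (simp add: A_def)
    have "card D \<le> card {p. prime p \<and> m < p \<and> p \<le> 2 * m}"
      by (intro card_mono) (auto simp: D_def)
    then show "prod v D \<le> (2 * m) ^ card {p. prime p \<and> m < p \<and> p \<le> 2 * m}"
      by (rule card_le) (simp add: D_def)
    have "v p \<le> (if p \<le> 2 * m div 3 then p else 1)" if "p \<in> B" for p
    proof (cases "p \<le> 2 * m div 3")
      case True
      have p: "prime p" "Suc s \<le> p" using that by (auto simp: B_def)
      have "p ^ multiplicity p ?N \<le> 2 * m" using v[OF p(1)] by (simp add: v_def)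
      also have "\<dots> < p ^ 2" using p assms(2) power_mono[of "Suc s" p 2] by linarith
      finally have "multiplicity p ?N < 2"
        using power_less_imp_less_exp prime_gt_1_nat[OF p(1)] by blast
      then have "v p \<le> p ^ 1" unfolding v_def using prime_ge_1_nat[OF p(1)] by (intro power_increasing) auto
      then show ?thesis using True by simp
    next
      case False
      then have "multiplicity p ?N = 0"
        using that assms(1) by (intro multiplicity_central_binomial_middle) (auto simp: B_def)
      then show ?thesis using False by (simp add: v_def)
    qed
    then have "prod v B \<le> (\<Prod>p\<in>B. if p \<le> 2 * m div 3 then p else 1)"
      by (intro prod_mono) auto
    also have "\<dots> = \<Prod>(B \<inter> {p. p \<le> 2 * m div 3})" using fin by (simp add: prod.If_cases)
    also have "\<dots> \<le> \<Prod>{p. prime p \<and> p \<le> 2 * m div 3}"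
      by (intro dvd_imp_le prod_dvd_prod_subset prod_pos) (auto simp: B_def prime_gt_0_nat)
    also have "\<dots> \<le> 4 ^ (2 * m div 3)" by (rule primorial_le)
    finally show "prod v B \<le> 4 ^ (2 * m div 3)" .
  qed simp_all
  finally show ?thesis .
qed

section \<open>Chebyshev's lower bound for the primes in (m, 2 m]\<close>

lemma ln_le_tangent_64:
  fixes s :: real
  assumes "s \<ge> 64"
  shows "ln s \<le> s / 64 + 6 * ln 2 - 1"
proof -
  have "ln (s / 64) \<le> s / 64 - 1" using assms by (intro ln_le_minus_one) auto
  moreover have "ln (64::real) = 6 * ln 2" using ln_realpow[of 2 6] by simp
  ultimately show ?thesis using assms by (simp add: ln_div)
qed

text \<open>Logarithms of the factorised upper bound are compared with the lower bound 4^m / (2 m).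
  The threshold 2048 makes sqrt (2 m) at least 64, the point of tangency used for the logarithm,
  where the error terms are already dominated.\<close>

lemma card_primes_doubling:
  fixes m :: nat
  assumes "m \<ge> 2048"
  shows "real (2 * m) / 25 \<le> card {p. prime p \<and> m < p \<and> p \<le> 2 * m} * ln (real (2 * m))"
proof -
  define y where "y = real (2 * m)"
  define N where "N = card {p. prime p \<and> m < p \<and> p \<le> 2 * m}"
  define s where "s = nat \<lfloor>sqrt y\<rfloor>"
  have y: "y \<ge> 4096" using assms by (simp add: y_def)
  have sq: "sqrt y \<ge> 64" using y real_le_rsqrt[of 64 y] by simp
  have s: "real s \<le> sqrt y" "sqrt y < real (Suc s)" unfolding s_def using sq by linarith+
  have "y < real (Suc s) ^ 2"
    using s(2) y by (metis real_sqrt_less_iff real_sqrt_abs abs_of_nat)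
  then have "real (2 * m) < real (Suc s ^ 2)" unfolding y_def by simp
  then have "2 * m < Suc s ^ 2" by (rule of_nat_less_imp_less)
  then have "(2 * m) choose m \<le> (2 * m) ^ s * 4 ^ (2 * m div 3) * (2 * m) ^ N"
    unfolding N_def using assms by (intro central_binomial_le_primes) auto
  then have "real ((2 * m) choose m) \<le> real ((2 * m) ^ s * 4 ^ (2 * m div 3) * (2 * m) ^ N)"
    by (rule of_nat_mono)
  also have "\<dots> = y ^ s * 4 ^ (2 * m div 3) * y ^ N" by (simp add: y_def)
  finally have "real ((2 * m) choose m) \<le> y ^ s * 4 ^ (2 * m div 3) * y ^ N" .
  moreover have "4 ^ m / y \<le> real ((2 * m) choose m)"
    unfolding y_def using central_binomial_lower_bound[of m] assms by simp
  ultimately have "4 ^ m / y \<le> y ^ s * 4 ^ (2 * m div 3) * y ^ N" by linarith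
  then have "ln (4 ^ m / y) \<le> ln (y ^ s * 4 ^ (2 * m div 3) * y ^ N)"
    using y by (subst ln_le_cancel_iff) auto
  then have "real m * ln 4 - ln y \<le> real s * ln y + real (2 * m div 3) * ln 4 + real N * ln y"
    using y by (simp add: ln_div ln_mult ln_realpow)
  moreover have "ln (4::real) = 2 * ln 2" using ln_realpow[of 2 2] by simp
  moreover have "real (2 * m div 3) * ln 2 \<le> y / 3 * ln 2"
    by (intro mult_right_mono) (auto simp: y_def)
  moreover have "real s * ln y \<le> sqrt y * ln y"
    using s y by (intro mult_right_mono) auto
  moreover have "real m * (2 * ln 2) = y * ln 2" by (simp add: y_def)
  ultimately have 1: "y / 3 * ln 2 \<le> (sqrt y + 1) * ln y + real N * ln y"
    unfolding distrib_right by (simp only: mult.left_commute[of _ 2])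
  \<comment> \<open>With y = t^2 the main term y / 3 * ln 2 is at least 22/100 y, because ln 2 \<ge>
    2/3. The error (t + 1) ln y is at most 18/100 y for t \<ge> 64. The difference 4/100 is the
    factor 1/25.\<close>
  define t where "t = sqrt y"
  have t: "t \<ge> 64" "y = t * t" using sq y by (auto simp: t_def)
  have "ln y = 2 * ln t" using t by (simp add: ln_mult)
  moreover have "ln t \<le> t / 64 + 6 * ln 2 - 1" using ln_le_tangent_64 t by simp
  moreover have "ln 2 \<le> (7/10::real)" using ln2_le_25_over_36 by simp
  ultimately have "ln y \<le> t / 32 + 64 / 10" by linarith
  then have "(t + 1) * ln y \<le> (t + 1) * (t / 32 + 64 / 10)"
    using t by (intro mult_left_mono) auto
  moreover have "(t + 1) * (t / 32 + 64 / 10) \<le> t * t * (18 / 100)"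
  proof -
    have "t * 64 \<le> t * t" using t by (intro mult_left_mono) auto
    moreover have "(t + 1) * (t / 32 + 64 / 10) = t * t / 32 + t * (64 / 10 + 1 / 32) + 64 / 10"
      by (simp add: field_simps)
    moreover have "u / 32 + t * (64 / 10 + 1 / 32) + 64 / 10 \<le> u * (18 / 100)"
      if "t * 64 \<le> u" for u using that t(1) by simp
    ultimately show ?thesis by simp
  qed
  moreover have "t * t * (22 / 100) \<le> y / 3 * ln 2"
  proof -
    have "t * t * (2 / 3) \<le> t * t * ln 2" using ln2_ge_two_thirds by (intro mult_left_mono) auto
    then show ?thesis using t by simp
  qed
  ultimately have "t * t * (4/100) \<le> real N * ln y"
    using 1[folded t_def] by linarith
  then show ?thesis using t by (simp add: N_def y_def)
qed

section \<open>The number of primes in (n / 2, n] for all n \<ge> 2\<close>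

lemma finite_primes_in [simp]: "finite (primes_in n)"
  by (rule finite_subset[of _ "{..n}"]) (auto simp: primes_in_def)

text \<open>Of two complementary divisors of p one is below s, so primality becomes a finite check
  that evaluation can settle.\<close>

lemma prime_trial_division:
  fixes p s :: nat
  assumes "p > 1" "p < s * s" "\<forall>k\<in>set [2..<s]. \<not> k dvd p"
  shows "prime p"
  unfolding prime_nat_iff
proof (intro conjI allI impI)
  fix m assume m: "m dvd p"
  then obtain k where k: "p = m * k" by (elim dvdE)
  show "m = 1 \<or> m = p"
  proof (rule ccontr)
    assume "\<not> (m = 1 \<or> m = p)"
    then have neq: "m \<noteq> 1" "k \<noteq> 1" using k by auto
    moreover have "m \<noteq> 0" using k assms(1) by (cases "m = 0") auto
    moreover have "k \<noteq> 0" using k assms(1) by (cases "k = 0") auto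
    ultimately have "m \<ge> 2" "k \<ge> 2" by linarith+
    moreover have "\<not> (s \<le> m \<and> s \<le> k)"
      using k assms(2) mult_mono[of s m s k] by auto
    moreover have "m dvd p" "k dvd p" using k by auto
    ultimately have "m \<in> set [2..<s] \<and> m dvd p \<or> k \<in> set [2..<s] \<and> k dvd p"
      by (simp add: not_le)
    then show False using assms(3) by blast
  qed
qed (fact assms(1))

text \<open>Covers the range below the Chebyshev estimate. Without a prime in (n / 2, n], every
  prime p \<le> n satisfies 2 p \<le> n; climbing a chain of primes then forces n past 4096.\<close>

lemma primes_in_nonempty_small:
  assumes "2 \<le> n" "n < 4096"
  shows "primes_in n \<noteq> {}"
proof
  assume "primes_in n = {}"
  then have step: "2 * p \<le> n" if "prime p" "p \<le> n" for p
    using that unfolding primes_in_def by (cases "n < 2 * p") auto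
  \<comment> \<open>each of the following primes is less than twice the previous one\<close>
  have pr: "prime (2::nat)" "prime (3::nat)" "prime (5::nat)" "prime (7::nat)" "prime (13::nat)"
    "prime (23::nat)" "prime (43::nat)" "prime (83::nat)"
    by simp_all
  have pr163: "prime (163::nat)"
    by (rule prime_trial_division[of _ 13], simp, simp, simp add: upt_rec_numeral del: set_upt)
  have pr317: "prime (317::nat)"
    by (rule prime_trial_division[of _ 18], simp, simp, simp add: upt_rec_numeral del: set_upt)
  have pr631: "prime (631::nat)"
    by (rule prime_trial_division[of _ 26], simp, simp, simp add: upt_rec_numeral del: set_upt)
  have pr1259: "prime (1259::nat)"
    by (rule prime_trial_division[of _ 36], simp, simp, simp add: upt_rec_numeral del: set_upt)
  have pr2503: "prime (2503::nat)"
    by (rule prime_trial_division[of _ 51], simp, simp, simp add: upt_rec_numeral del: set_upt)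
  have "4 \<le> n" using step[OF pr(1)] assms(1) by simp
  then have "6 \<le> n" using step[OF pr(2)] by simp
  then have "10 \<le> n" using step[OF pr(3)] by simp
  then have "14 \<le> n" using step[OF pr(4)] by simp
  then have "26 \<le> n" using step[OF pr(5)] by simp
  then have "46 \<le> n" using step[OF pr(6)] by simp
  then have "86 \<le> n" using step[OF pr(7)] by simp
  then have "166 \<le> n" using step[OF pr(8)] by simp
  then have "326 \<le> n" using step[OF pr163] by simp
  then have "634 \<le> n" using step[OF pr317] by simp
  then have "1262 \<le> n" using step[OF pr631] by simp
  then have "2518 \<le> n" using step[OF pr1259] by simp
  then have "5006 \<le> n" using step[OF pr2503] by simp
  then show False using assms(2) by simp
qed

lemma card_primes_in_lower_bound:
  "\<exists>c>0. \<forall>n\<ge>2. c * real n \<le> real (card (primes_in n)) * ln (real n)"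
proof -
  \<comment> \<open>The constant is crude so that one prime suffices below 4096: there n / 10000 is
    less than 2/3 \<le> ln 2 \<le> ln n. For larger n the estimate with 1/25 leaves ample room, also
    for the rounding in \<open>n div 2\<close>.\<close>
  have "real n / 10000 \<le> real (card (primes_in n)) * ln (real n)" if n: "n \<ge> 2" for n
  proof (cases "n < 4096")
    case True
    have "card (primes_in n) \<noteq> 0" using primes_in_nonempty_small[OF n True] by simp
    then have c: "real (card (primes_in n)) \<ge> 1" by linarith
    have l: "ln (real n) \<ge> 2 / 3" using n ln2_ge_two_thirds ln_mono[of 2 "real n"] by linarith
    have "1 * (2 / 3) \<le> real (card (primes_in n)) * ln (real n)"
      using c l by (intro mult_mono) auto
    then show ?thesis using True by linarith
  next
    case False
    define m where "m = n div 2"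
    have m: "m \<ge> 2048" "2 * m \<le> n" "n \<le> 2 * m + 1" using False by (auto simp: m_def)
    have "real (2 * m) / 25 \<le> card {p. prime p \<and> m < p \<and> p \<le> 2 * m} * ln (real (2 * m))"
      using m by (intro card_primes_doubling)
    also have "\<dots> \<le> card (primes_in n) * ln (real n)"
      using m by (intro mult_mono of_nat_mono card_mono) (auto simp: primes_in_def)
    finally show ?thesis using m by linarith
  qed
  then show ?thesis by (intro exI[of _ "1/10000"]) auto
qed

lemma primes_in_nonempty: "n \<ge> 2 \<Longrightarrow> primes_in n \<noteq> {}"
proof
  assume n: "n \<ge> 2" and empty: "primes_in n = {}"
  obtain c :: real where "c > 0" "c * real n \<le> real (card (primes_in n)) * ln (real n)"
    using card_primes_in_lower_bound n by blast
  then show False using n empty by (simp add: mult_le_0_iff)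
qed

section \<open>Sums of powers of the weights\<close>

lemma supp_eq_empty_iff: "supp h = {} \<longleftrightarrow> h = (\<lambda>_. 0)"
  by (auto simp: supp_def)

lemma int_vecs_iff_supp: "h \<in> int_vecs d \<longleftrightarrow> supp h \<subseteq> {1..d}"
  by (auto simp: int_vecs_def supp_def)

lemma supp_in_index_sets: "h \<in> int_vecs d \<Longrightarrow> supp h \<in> index_sets"
  unfolding int_vecs_iff_supp index_sets_def
  using finite_subset[of "supp h" "{1..d}"] by fastforce

lemma positive_weights_subset:
  "positive_weights \<gamma> \<Longrightarrow> u \<subseteq> {1..d} \<Longrightarrow> finite u \<and> \<gamma> u > 0"
  unfolding positive_weights_def index_sets_def
  using finite_subset[of u "{1..d}"] by fastforce

lemma has_sum_zeta:
  assumes "x > 1"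
  shows "((\<lambda>k::int. real_of_int \<bar>k\<bar> powr (- x)) has_sum (2 * zeta x)) (- {0})"
proof -
  let ?f = "\<lambda>k::int. real_of_int \<bar>k\<bar> powr (- x)"
  have "summable (\<lambda>n. real n powr (- x))"
    using assms by (simp add: summable_real_powr_iff)
  then have "summable (\<lambda>n. real (Suc n) powr (- x))"
    by (subst summable_Suc_iff)
  then have "summable (\<lambda>n. norm (real (Suc n) powr (- x)))" by simp
  then have "((\<lambda>n. real (Suc n) powr (- x)) has_sum zeta x) UNIV"
    unfolding zeta_def by (intro norm_summable_imp_has_sum) (simp_all add: summable_sums powr_minus_divide)
  then have *: "((\<lambda>n. ?f (int (Suc n))) has_sum zeta x) UNIV"
      and **: "((\<lambda>n. ?f (- int (Suc n))) has_sum zeta x) UNIV" by (simp_all add: add.commute)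
  have "bij_betw (\<lambda>n. int (Suc n)) UNIV {0<..}"
    by (rule bij_betwI[of _ _ _ "\<lambda>k. nat k - 1"]) simp_all
  from has_sum_reindex_bij_betw[OF this, of ?f "zeta x"] *
  have "(?f has_sum zeta x) {0<..}" by simp
  moreover have "bij_betw (\<lambda>n. - int (Suc n)) UNIV {..<0}"
    by (rule bij_betwI[of _ _ _ "\<lambda>k. nat (- k) - 1"]) simp_all
  from has_sum_reindex_bij_betw[OF this, of ?f "zeta x"] **
  have "(?f has_sum zeta x) {..<0}" by simp
  ultimately have "(?f has_sum (zeta x + zeta x)) ({0<..} \<union> {..<0})"
    by (intro has_sum_Un_disjoint) auto
  moreover have "{0<..} \<union> {..<0} = - {0::int}" by (simp add: set_eq_iff neq_iff disj_commute)
  ultimately show ?thesis by (metis mult_2)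
qed

lemma zeta_nonneg: "x > 1 \<Longrightarrow> zeta x \<ge> 0"
  using has_sum_nonneg[OF has_sum_zeta] by fastforce

lemma r_weight_powr:
  assumes "finite (supp h)" "\<gamma> (supp h) > 0"
  shows "r_weight \<alpha> \<gamma> h powr (- \<beta>) =
           \<gamma> (supp h) powr \<beta> * (\<Prod>j\<in>supp h. real_of_int \<bar>h j\<bar> powr (- (\<alpha> * \<beta>)))"
proof -
  have "r_weight \<alpha> \<gamma> h powr (- \<beta>) =
      inverse (\<gamma> (supp h)) powr (- \<beta>) * (\<Prod>j\<in>supp h. \<bar>real_of_int (h j)\<bar> powr \<alpha>) powr (- \<beta>)"
    unfolding r_weight_def using assms by (intro powr_mult)
  also have "inverse (\<gamma> (supp h)) powr (- \<beta>) = \<gamma> (supp h) powr \<beta>"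
    using assms by (simp add: powr_minus inverse_powr)
  also have "(\<Prod>j\<in>supp h. \<bar>real_of_int (h j)\<bar> powr \<alpha>) powr (- \<beta>) =
      (\<Prod>j\<in>supp h. real_of_int \<bar>h j\<bar> powr (- (\<alpha> * \<beta>)))"
    by (subst prod_powr_distrib) (auto simp: powr_powr)
  finally show ?thesis .
qed

text \<open>Vectors with support exactly \<open>u\<close> are the families of nonzero integers
  indexed by \<open>u\<close>, extended by 0. Over these the sum of products factorises into
  one-dimensional zeta sums, the two signs giving the factor 2.\<close>

lemma has_sum_r_weight_supp:
  assumes "finite u" "\<gamma> u > 0" "\<alpha> * \<beta> > 1"
  shows "((\<lambda>h. r_weight \<alpha> \<gamma> h powr (- \<beta>)) has_sum
           (\<gamma> u powr \<beta> * (2 * zeta (\<alpha> * \<beta>)) ^ card u)) {h. supp h = u}"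
proof -
  let ?f = "\<lambda>k::int. real_of_int \<bar>k\<bar> powr (- (\<alpha> * \<beta>))"
  let ?P = "\<Pi>\<^sub>E j\<in>u. - {0::int}"
  have f: "(?f has_sum (2 * zeta (\<alpha> * \<beta>))) (- {0})" using assms(3) by (rule has_sum_zeta)
  then have "?f summable_on (- {0})" by (rule has_sum_imp_summable)
  then have abs: "(\<lambda>k. norm (?f k)) summable_on (- {0})"
    by simp
  then have "Infinite_Set_Sum.abs_summable_on ?f (- {0})"
    by (rule abs_summable_equivalent[THEN iffD1])
  then have "Infinite_Set_Sum.abs_summable_on (\<lambda>g. \<Prod>j\<in>u. ?f (g j)) ?P"
    using assms(1) by (intro abs_summable_on_prod_PiE) auto
  then have "(\<lambda>g. norm (\<Prod>j\<in>u. ?f (g j))) summable_on ?P"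
    by (rule abs_summable_equivalent[THEN iffD2])
  then have "(\<lambda>g. \<Prod>j\<in>u. ?f (g j)) summable_on ?P"
    by (rule abs_summable_summable)
  moreover have "infsum (\<lambda>g. \<Prod>j\<in>u. ?f (g j)) ?P = (\<Prod>j\<in>u. infsum ?f (- {0}))"
    using assms(1) abs by (intro infsum_prod_PiE_abs) auto
  ultimately have "((\<lambda>g. \<Prod>j\<in>u. ?f (g j)) has_sum ((2 * zeta (\<alpha> * \<beta>)) ^ card u)) ?P"
    using f by (simp add: has_sum_iff)
  then have "((\<lambda>g. \<gamma> u powr \<beta> * (\<Prod>j\<in>u. ?f (g j))) has_sum
      (\<gamma> u powr \<beta> * (2 * zeta (\<alpha> * \<beta>)) ^ card u)) ?P"
    by (rule has_sum_cmult_right)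
  also have "?this \<longleftrightarrow> ?thesis"
  proof (rule has_sum_reindex_bij_witness[where i = "\<lambda>h. restrict h u" and j = "\<lambda>g j. if j \<in> u then g j else 0"])
    fix g assume g: "g \<in> ?P"
    show "restrict (\<lambda>j. if j \<in> u then g j else 0) u = g"
      using g by (auto simp: fun_eq_iff PiE_def extensional_def)
    show s: "(\<lambda>j. if j \<in> u then g j else 0) \<in> {h. supp h = u}"
      using g by (auto simp: supp_def)
    then show "r_weight \<alpha> \<gamma> (\<lambda>j. if j \<in> u then g j else 0) powr (- \<beta>) =
        \<gamma> u powr \<beta> * (\<Prod>j\<in>u. ?f (g j))"
      using assms by (subst r_weight_powr) auto
  qed (auto simp: supp_def fun_eq_iff)
  finally show ?thesis .
qed

lemma has_sum_r_weight_Union: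
  assumes "finite U" "\<And>u. u \<in> U \<Longrightarrow> finite u \<and> \<gamma> u > 0" "\<alpha> * \<beta> > 1"
  shows "((\<lambda>h. r_weight \<alpha> \<gamma> h powr (- \<beta>)) has_sum
           (\<Sum>u\<in>U. \<gamma> u powr \<beta> * (2 * zeta (\<alpha> * \<beta>)) ^ card u)) {h. supp h \<in> U}"
proof -
  have "((\<lambda>h. r_weight \<alpha> \<gamma> h powr (- \<beta>)) has_sum
           (\<Sum>u\<in>U. \<gamma> u powr \<beta> * (2 * zeta (\<alpha> * \<beta>)) ^ card u)) (\<Union>u\<in>U. {h. supp h = u})"
    using assms by (intro sum_has_sum has_sum_r_weight_supp) auto
  also have "(\<Union>u\<in>U. {h. supp h = u}) = {h. supp h \<in> U}" by auto
  finally show ?thesis .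
qed

lemma r_weight_summable:
  assumes "positive_weights \<gamma>" "\<alpha> * \<beta> > 1"
  shows "(\<lambda>h. r_weight \<alpha> \<gamma> h powr (- \<beta>)) summable_on int_vecs d"
proof -
  have "(\<lambda>h. r_weight \<alpha> \<gamma> h powr (- \<beta>)) summable_on {h. supp h \<in> Pow {1..d}}"
    using assms by (intro has_sum_imp_summable[OF has_sum_r_weight_Union])
      (auto simp only: positive_weights_subset Pow_iff finite_Pow_iff finite_atLeastAtMost)
  also have "{h. supp h \<in> Pow {1..d}} = int_vecs d"
    by (simp add: set_eq_iff int_vecs_iff_supp)
  finally show ?thesis .
qed

lemma mu_eq_sum:
  assumes "positive_weights \<gamma>" "0 < lam" "lam < \<alpha>"
  shows "mu d \<alpha> \<gamma> lam =
           (\<Sum>u\<in>Pow {1..d} - {{}}. \<gamma> u powr (1 / lam) * (2 * zeta (\<alpha> / lam)) ^ card u)"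
proof -
  have "int_vecs d - {\<lambda>_. 0} = {h. supp h \<in> Pow {1..d} - {{}}}"
    by (auto simp only: int_vecs_iff_supp supp_eq_empty_iff Pow_iff Diff_iff singleton_iff mem_Collect_eq)
  moreover have "((\<lambda>h. r_weight \<alpha> \<gamma> h powr (- (1 / lam))) has_sum
      (\<Sum>u\<in>Pow {1..d} - {{}}. \<gamma> u powr (1 / lam) * (2 * zeta (\<alpha> * (1 / lam))) ^ card u))
      {h. supp h \<in> Pow {1..d} - {{}}}"
    using assms by (intro has_sum_r_weight_Union)
      (auto simp: positive_weights_subset[of \<gamma> _ d])
  ultimately show ?thesis unfolding mu_def by (simp add: has_sum_iff)
qed

lemma r_weight_pos:
  assumes "positive_weights \<gamma>" "h \<in> int_vecs d"
  shows "r_weight \<alpha> \<gamma> h > 0"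
  using assms supp_in_index_sets[OF assms(2)] unfolding r_weight_def positive_weights_def
  by (intro mult_pos_pos prod_pos) (auto simp: supp_def)

text \<open>Each term is at most the total S, so f^t = f * f^(t-1) \<le> f * S^(t-1), and summation
  gives S^t. This form of Jensen's inequality turns sums of r^(-1/lam) into bounds for sums of
  r^(-2).\<close>

lemma infsum_powr_le:
  fixes f :: "'a \<Rightarrow> real"
  assumes nonneg: "\<And>x. x \<in> A \<Longrightarrow> f x \<ge> 0" and summable: "f summable_on A" and t: "t \<ge> 1"
  shows "(\<lambda>x. f x powr t) summable_on A" "infsum (\<lambda>x. f x powr t) A \<le> infsum f A powr t"
proof -
  define S where "S = infsum f A"
  have S: "S \<ge> 0" unfolding S_def using nonneg by (rule infsum_nonneg)
  have le: "f x powr t \<le> f x * S powr (t - 1)" if "x \<in> A" for x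
  proof -
    have "f x \<le> S"
      unfolding S_def using finite_sum_le_infsum[OF summable, of "{x}"] nonneg that by simp
    then have "f x * f x powr (t - 1) \<le> f x * S powr (t - 1)"
      using nonneg that t by (intro mult_left_mono powr_mono2) auto
    then show ?thesis using nonneg[OF that] by (cases "f x = 0") (auto simp: powr_mult_base)
  qed
  have s: "(\<lambda>x. f x * S powr (t - 1)) summable_on A"
    using summable by (rule summable_on_cmult_left)
  then show s': "(\<lambda>x. f x powr t) summable_on A"
    using le by (rule summable_on_comparison_test) auto
  have "infsum (\<lambda>x. f x powr t) A \<le> infsum (\<lambda>x. f x * S powr (t - 1)) A"
    using s' s le by (rule infsum_mono)
  also have "\<dots> = S * S powr (t - 1)" by (simp add: infsum_cmult_left' S_def)
  also have "\<dots> = S powr t" using S by (cases "S = 0") (auto simp: powr_mult_base)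
  finally show "infsum (\<lambda>x. f x powr t) A \<le> infsum f A powr t" by (simp add: S_def)
qed

lemma r_weight_scale:
  assumes "s \<ge> 1" "h \<in> int_vecs s" "h s \<noteq> 0" "m > 0"
  shows "r_weight \<alpha> \<gamma> (h(s := int m * h s)) = real m powr \<alpha> * r_weight \<alpha> \<gamma> h"
proof -
  have supp: "supp (h(s := int m * h s)) = supp h" using assms by (auto simp: supp_def)
  have fin: "finite (supp h)" using supp_in_index_sets[OF assms(2)] by (simp add: index_sets_def)
  have "s \<in> supp h" using assms by (simp add: supp_def)
  then show ?thesis
    unfolding r_weight_def supp using fin
    by (simp add: prod.remove[of _ s] abs_mult powr_mult)
qed

text \<open>Multiplying the last component by m is a bijection onto these vectors; it keeps the
  support and multiplies r by m^\<alpha>.\<close>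

lemma infsum_r_weight_dvd:
  assumes "s \<ge> 1" "m > 0"
  shows "(\<Sum>\<^sub>\<infinity>h\<in>{h \<in> int_vecs s. h s \<noteq> 0 \<and> int m dvd h s}. r_weight \<alpha> \<gamma> h powr (- \<beta>)) =
     real m powr (- (\<alpha> * \<beta>)) * (\<Sum>\<^sub>\<infinity>h\<in>{h \<in> int_vecs s. h s \<noteq> 0}. r_weight \<alpha> \<gamma> h powr (- \<beta>))"
proof -
  have "(\<Sum>\<^sub>\<infinity>h\<in>{h \<in> int_vecs s. h s \<noteq> 0 \<and> int m dvd h s}. r_weight \<alpha> \<gamma> h powr (- \<beta>)) =
    (\<Sum>\<^sub>\<infinity>h\<in>{h \<in> int_vecs s. h s \<noteq> 0}. real m powr (- (\<alpha> * \<beta>)) * r_weight \<alpha> \<gamma> h powr (- \<beta>))"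
  proof (rule infsum_reindex_bij_witness[where i = "\<lambda>h. h(s := int m * h s)" and j = "\<lambda>h. h(s := h s div int m)"])
    fix h assume h: "h \<in> {h \<in> int_vecs s. h s \<noteq> 0 \<and> int m dvd h s}"
    then have *: "h(s := h s div int m) \<in> int_vecs s" "h s div int m \<noteq> 0"
      using assms by (auto simp: int_vecs_def dvd_div_eq_0_iff)
    show "real m powr (- (\<alpha> * \<beta>)) * r_weight \<alpha> \<gamma> (h(s := h s div int m)) powr (- \<beta>) =
        r_weight \<alpha> \<gamma> h powr (- \<beta>)"
      using r_weight_scale[OF assms(1) *(1) _ assms(2), of \<alpha> \<gamma>] * h assms
      by (simp add: powr_mult powr_powr)
  qed (use assms in \<open>auto simp: int_vecs_def\<close>)
  then show ?thesis by (simp add: infsum_cmult_right')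
qed

section \<open>Fourier series of continuous periodic functions\<close>

definition fchar :: "nat \<Rightarrow> (nat \<Rightarrow> int) \<Rightarrow> (nat \<Rightarrow> real) \<Rightarrow> complex" where
  "fchar d h x = cis (2 * pi * (\<Sum>j=1..d. real_of_int (h j) * x j))"

lemma norm_fchar [simp]: "cmod (fchar d h x) = 1"
  by (simp add: fchar_def)

lemma fchar_add: "fchar d (\<lambda>j. h j + k j) x = fchar d h x * fchar d k x"
  by (simp add: fchar_def cis_mult ring_distribs sum.distrib)

lemma fchar_zero [simp]: "fchar d (\<lambda>_. 0) x = 1"
  by (simp add: fchar_def)

lemma fchar_eq_prod: "fchar d h x = (\<Prod>j=1..d. cis (2 * pi * (real_of_int (h j) * x j)))"
  unfolding fchar_def sum_distrib_left cis_conv_exp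
  by (simp add: sum_distrib_left exp_sum)

lemma fourier_coeff_eq: "fourier_coeff d f h = (\<integral>x. f x * fchar d (\<lambda>j. - h j) x \<partial>unit_cube d)"
  unfolding fourier_coeff_def fchar_def cis_conv_exp
  by (simp add: sum_negf mult_ac)

lemma prob_space_unit_interval: "prob_space (restrict_space lborel {0..1::real})"
  by (rule prob_spaceI) (simp add: emeasure_restrict_space space_restrict_space)

lemma space_unit_cube: "space (unit_cube d) = (\<Pi>\<^sub>E j\<in>{1..d}. {0..1})"
  by (simp add: unit_cube_def space_PiM space_restrict_space)

lemma product_prob_space_unit_cube:
  "product_prob_space (\<lambda>_::nat. restrict_space lborel {0..1::real})"
  by (rule product_prob_spaceI) (rule prob_space_unit_interval)

lemma prob_space_unit_cube: "prob_space (unit_cube d)"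
proof -
  interpret P: product_prob_space "\<lambda>_::nat. restrict_space lborel {0..1::real}" "{1..d}"
    by (rule product_prob_space_unit_cube)
  show ?thesis unfolding unit_cube_def by (rule P.prob_space_axioms)
qed

lemma measurable_coordinate [measurable]:
  assumes "j \<in> {1..d}"
  shows "(\<lambda>x. x j) \<in> borel_measurable (unit_cube d)"
proof -
  have "(\<lambda>x. x j) \<in> measurable (unit_cube d) (restrict_space lborel {0..1})"
    unfolding unit_cube_def using assms by (rule measurable_component_singleton)
  then show ?thesis
    by (metis measurable_restrict_space2_iff measurable_lborel1)
qed

lemma measurable_fchar [measurable]: "fchar d h \<in> borel_measurable (unit_cube d)"
  unfolding fchar_def
  by (intro borel_measurable_continuous_on[of cis] borel_measurable_times borel_measurable_const
      borel_measurable_sum measurable_coordinate continuous_on_cis continuous_on_id)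

lemma integral_cis_unit_interval:
  "(\<integral>x. cis (2 * pi * (real_of_int k * x)) \<partial>restrict_space lborel {0..1}) = of_bool (k = 0)"
proof (cases "k = 0")
  case True
  then show ?thesis using prob_space.prob_space[OF prob_space_unit_interval] by simp
next
  case False
  define w where "w = 2 * pi * \<i> * of_int k"
  have w: "w \<noteq> 0" using False by (simp add: w_def)
  define F where "F x = exp (w * of_real x) / w" for x :: real
  have cis: "cis (2 * pi * (real_of_int k * x)) = exp (w * of_real x)" for x
    by (simp add: cis_conv_exp w_def mult_ac)
  have "(F has_vector_derivative cis (2 * pi * (real_of_int k * x))) (at x within {0..1})" for x
    unfolding F_def cis
    by (rule has_vector_derivative_real_field) (use w in \<open>auto intro!: derivative_eq_intros\<close>)
  then have "(\<integral>x. indicator {0..1} x *\<^sub>R cis (2 * pi * (real_of_int k * x)) \<partial>lborel) = F 1 - F 0"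
    by (intro integral_FTC_atLeastAtMost) (auto intro!: continuous_intros)
  also have "F 1 = F 0"
    unfolding F_def cis[symmetric] using cis_multiple_2pi[of "of_int k"] by (simp add: mult_ac)
  finally show ?thesis using False by (simp add: integral_restrict_space)
qed

lemma has_bochner_integral_fchar:
  "has_bochner_integral (unit_cube d) (fchar d h) (of_bool (\<forall>j\<in>{1..d}. h j = 0))"
proof -
  interpret prob_space "unit_cube d" by (rule prob_space_unit_cube)
  have int: "integrable (unit_cube d) (fchar d h)"
    by (rule integrable_const_bound[of _ 1]) auto
  interpret P: product_prob_space "\<lambda>_::nat. restrict_space lborel {0..1::real}" "{1..d}"
    by (rule product_prob_space_unit_cube)
  have "(\<lambda>x. cis (2 * pi * (real_of_int k * x))) \<in> borel_measurable (restrict_space lborel {0..1::real})" for k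
    by (rule measurable_restrict_space1) (simp add: borel_measurable_continuous_onI continuous_intros)
  then have "integrable (restrict_space lborel {0..1::real}) (\<lambda>x. cis (2 * pi * (real_of_int k * x)))" for k
    by (intro P.M.integrable_const_bound[of _ 1]) auto
  then have "(\<integral>x. fchar d h x \<partial>unit_cube d) = (\<Prod>j=1..d. of_bool (h j = 0))"
    unfolding fchar_eq_prod unit_cube_def
    by (subst P.product_integral_prod) (simp_all add: integral_cis_unit_interval)
  also have "\<dots> = of_bool (\<forall>j\<in>{1..d}. h j = 0)"
    by (induction d) (auto simp: atLeastAtMostSuc_conv)
  finally show ?thesis using int by (simp add: has_bochner_integral_iff)
qed

lemma has_bochner_integral_mult_fchar:
  assumes "integrable (unit_cube d) f"
  shows "has_bochner_integral (unit_cube d) (\<lambda>x. f x * fchar d (\<lambda>j. - h j) x) (fourier_coeff d f h)"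
proof -
  have "integrable (unit_cube d) (\<lambda>x. f x * fchar d (\<lambda>j. - h j) x)"
    using assms
    by (rule Bochner_Integration.integrable_bound)
       (use assms in \<open>auto simp: norm_mult intro!: borel_measurable_times measurable_fchar\<close>)
  then show ?thesis by (simp add: has_bochner_integral_iff fourier_coeff_eq)
qed

section \<open>Uniqueness of Fourier coefficients for continuous periodic functions\<close>

lemma tendsto_fun_componentwise:
  fixes f :: "'b \<Rightarrow> 'a \<Rightarrow> real"
  assumes "\<And>i. ((\<lambda>n. f n i) \<longlongrightarrow> l i) F"
  shows "(f \<longlongrightarrow> l) F"
proof -
  have "limitin (product_topology (\<lambda>_. euclidean) UNIV) f l F"
    using assms by (subst limitin_componentwise) auto
  then show ?thesis by (simp add: euclidean_product_topology)
qed

text \<open>The topology involves all coordinates in \<open>nat\<close>, but elements of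
  \<open>real_vecs d\<close> agree outside {1..d}. A sequence violating the claim for \<delta> = 1 /
  (n + 1) would therefore converge to \<open>a\<close> in every coordinate, hence in the product
  topology.\<close>

lemma continuous_on_real_vecs_near:
  assumes f: "continuous_on (real_vecs d) f" and a: "a \<in> real_vecs d" and "\<eta> > 0"
  obtains \<delta> where "\<delta> > 0"
    "\<And>y. y \<in> real_vecs d \<Longrightarrow> (\<And>j. j \<in> {1..d} \<Longrightarrow> \<bar>y j - a j\<bar> < \<delta>) \<Longrightarrow> dist (f y) (f a) < \<eta>"
proof (rule ccontr)
  note intro = that
  assume contra: "\<not> thesis"
  have "\<exists>y. y \<in> real_vecs d \<and> (\<forall>j\<in>{1..d}. \<bar>y j - a j\<bar> < \<delta>) \<and> \<not> dist (f y) (f a) < \<eta>" if "\<delta> > 0" for \<delta>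
    using intro[of \<delta>] contra that by blast
  then have "\<exists>y. y \<in> real_vecs d \<and> (\<forall>j\<in>{1..d}. \<bar>y j - a j\<bar> < inverse (real (Suc n))) \<and>
      \<not> dist (f y) (f a) < \<eta>" for n
    by simp
  then obtain y where y: "\<And>n. y n \<in> real_vecs d"
      "\<And>n j. j \<in> {1..d} \<Longrightarrow> \<bar>y n j - a j\<bar> < inverse (real (Suc n))"
      "\<And>n. \<not> dist (f (y n)) (f a) < \<eta>"
    by metis
  have "(\<lambda>n. y n j) \<longlonglongrightarrow> a j" for j
  proof (cases "j \<in> {1..d}")
    case True
    have "(\<lambda>n. y n j - a j) \<longlonglongrightarrow> 0"
      by (rule Lim_null_comparison[OF _ LIMSEQ_inverse_real_of_nat])
        (use y(2)[OF True] in \<open>auto intro!: always_eventually less_imp_le\<close>)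
    then show ?thesis by (simp add: LIM_zero_iff)
  next
    case False
    then have "y n j = a j" for n
      using y(1)[of n] a unfolding real_vecs_def by (metis PiE_arb)
    then show ?thesis by simp
  qed
  then have "y \<longlonglongrightarrow> a" by (rule tendsto_fun_componentwise)
  then have "(\<lambda>n. f (y n)) \<longlonglongrightarrow> f a"
    using f a y(1) by (intro continuous_on_tendsto_compose[OF f]) auto
  then have "\<forall>\<^sub>F n in sequentially. dist (f (y n)) (f a) < \<eta>"
    using \<open>\<eta> > 0\<close> by (rule tendstoD)
  then show False using y(3) by simp
qed

lemma one_periodic_shift:
  assumes f: "one_periodic d f" and x: "x \<in> real_vecs d"
  shows "f (\<lambda>i. if i \<in> {1..d} then x i + of_int (m i) else x i) = f x"
proof -
  have one: "f (x(j := x j + of_int k)) = f x" if "x \<in> real_vecs d" "j \<in> {1..d}" for x j and k :: int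
  proof (induction k rule: int_induct[of _ 0])
    case base
    then show ?case by simp
  next
    case (step1 k)
    have "x(j := x j + of_int k) \<in> real_vecs d" using that by (auto simp: real_vecs_def PiE_def extensional_def)
    from f[unfolded one_periodic_def, rule_format, OF this that(2)] step1.IH
    show ?case by (simp only: fun_upd_upd fun_upd_same add.assoc of_int_add of_int_1)
  next
    case (step2 k)
    have "x(j := x j + of_int (k - 1)) \<in> real_vecs d"
      using that by (auto simp: real_vecs_def PiE_def extensional_def)
    from f[unfolded one_periodic_def, rule_format, OF this that(2)] step2.IH
    show ?case by (simp only: fun_upd_upd fun_upd_same add.assoc of_int_diff of_int_1 diff_add_cancel)
  qed
  have "f (\<lambda>i. if i \<in> J then x i + of_int (m i) else x i) = f x" if "finite J" "J \<subseteq> {1..d}" for J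
    using that
  proof (induction J rule: finite_induct)
    case (insert j J)
    let ?y = "\<lambda>i. if i \<in> J then x i + of_int (m i) else x i"
    have "(\<lambda>i. if i \<in> insert j J then x i + of_int (m i) else x i) = ?y(j := ?y j + of_int (m j))"
      using insert.hyps by auto
    moreover have "?y \<in> real_vecs d"
      using x insert.prems by (auto simp: real_vecs_def PiE_def extensional_def)
    ultimately show ?case using one[of ?y j "m j"] insert by simp
  qed simp
  from this[of "{1..d}"] show ?thesis by simp
qed

text \<open>The distance from t to the nearest integer lies in [0, 1/2], and cosine decreases on
  [0, pi].\<close>

lemma cos_gt_imp_near_int:
  assumes "cos (2 * pi * t) > cos (2 * pi * \<delta>)" "0 \<le> \<delta>"
  obtains m :: int where "\<bar>t + of_int m\<bar> < \<delta>"
proof -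
  define \<theta> where "\<theta> = \<bar>t - of_int (round t)\<bar>"
  have "cos (2 * pi * \<bar>r\<bar>) = cos (2 * pi * r)" for r
    using cos_minus[of "2 * pi * r"] by (cases "r \<ge> 0") simp_all
  then have "cos (2 * pi * \<theta>) = cos (2 * pi * (t - of_int (round t)))"
    unfolding \<theta>_def .
  also have "\<dots> = cos (2 * pi * t - 2 * pi * of_int (round t))" by (simp add: algebra_simps)
  also have "\<dots> = cos (2 * pi * t)"
    by (simp only: cos_diff cos_int_2pin sin_int_2pin)
  finally have eq: "cos (2 * pi * \<theta>) = cos (2 * pi * t)" .
  have "\<theta> \<le> 1 / 2" unfolding \<theta>_def using of_int_round_abs_le[of t] by (simp add: abs_minus_commute)
  then have "\<not> \<delta> \<le> \<theta>"
    using cos_monotone_0_pi_le[of "2 * pi * \<delta>" "2 * pi * \<theta>"] assms eq by auto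
  then show thesis using that[of "- round t"] by (simp add: \<theta>_def)
qed

text \<open>A cosine in one coordinate is a combination of two characters, so multiplying by it only
  shifts the frequency by 1 or -1. Orthogonality to all characters therefore survives.\<close>

lemma has_bochner_integral_0_mult_cos:
  assumes w: "\<And>h. h \<in> int_vecs d \<Longrightarrow> has_bochner_integral (unit_cube d) (\<lambda>x. w x * fchar d h x) 0"
      and j: "j \<in> {1..d}" and h: "h \<in> int_vecs d"
    shows "has_bochner_integral (unit_cube d)
             (\<lambda>x. w x * of_real (cos (2 * pi * (x j - b))) * fchar d h x) 0"
proof -
  have shift: "fchar d (h(j := h j + k)) x = cis (2 * pi * (of_int k * x j)) * fchar d h x" for k x
  proof -
    have "(\<Sum>i=1..d. real_of_int ((h(j := h j + k)) i) * x i) =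
        (\<Sum>i=1..d. real_of_int (h i) * x i + (if i = j then of_int k * x j else 0))"
      by (intro sum.cong) (auto simp: algebra_simps)
    also have "\<dots> = (\<Sum>i=1..d. real_of_int (h i) * x i) + of_int k * x j"
      using j by (simp add: sum.distrib)
    finally show ?thesis by (simp add: fchar_def ring_distribs cis_mult add.commute)
  qed
  have cos: "complex_of_real (cos (2 * pi * (t - b))) =
      (cis (- (2 * pi * b)) * cis (2 * pi * (of_int 1 * t)) +
       cis (2 * pi * b) * cis (2 * pi * (of_int (- 1) * t))) / 2" for t
    by (simp add: cis_mult complex_eq_iff right_diff_distrib cos_diff sin_diff)
  have mem: "h(j := h j + k) \<in> int_vecs d" for k
    using h j by (auto simp: int_vecs_def)
  have "has_bochner_integral (unit_cube d) (\<lambda>x.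
      (cis (- (2 * pi * b)) / 2) * (w x * fchar d (h(j := h j + 1)) x) +
      (cis (2 * pi * b) / 2) * (w x * fchar d (h(j := h j + (- 1))) x))
      ((cis (- (2 * pi * b)) / 2) * 0 + (cis (2 * pi * b) / 2) * 0)"
    by (intro has_bochner_integral_add has_bochner_integral_mult_right w mem)
  also have "(\<lambda>x. (cis (- (2 * pi * b)) / 2) * (w x * fchar d (h(j := h j + 1)) x) +
      (cis (2 * pi * b) / 2) * (w x * fchar d (h(j := h j + (- 1))) x)) =
    (\<lambda>x. w x * of_real (cos (2 * pi * (x j - b))) * fchar d h x)"
    unfolding shift cos by (simp add: algebra_simps add_divide_distrib fun_eq_iff)
  finally show ?thesis by simp
qed

definition peak :: "nat \<Rightarrow> (nat \<Rightarrow> real) \<Rightarrow> real \<Rightarrow> (nat \<Rightarrow> real) \<Rightarrow> real" where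
  "peak d a \<epsilon> x = \<epsilon> + (\<Sum>j=1..d. cos (2 * pi * (x j - a j))) / real d"

text \<open>The induction runs over all \<open>h\<close> simultaneously, because each cosine factor
  shifts the frequency.\<close>

lemma has_bochner_integral_0_mult_peak_power:
  assumes "\<And>h. h \<in> int_vecs d \<Longrightarrow> has_bochner_integral (unit_cube d) (\<lambda>x. w x * fchar d h x) 0"
      and "h \<in> int_vecs d"
    shows "has_bochner_integral (unit_cube d) (\<lambda>x. w x * of_real (peak d a \<epsilon> x) ^ N * fchar d h x) 0"
  using assms(2)
proof (induction N arbitrary: h)
  case 0
  then show ?case using assms(1) by simp
next
  case (Suc N)
  let ?w = "\<lambda>x. w x * of_real (peak d a \<epsilon> x) ^ N"
  have "has_bochner_integral (unit_cube d)
      (\<lambda>x. of_real \<epsilon> * (?w x * fchar d h x) +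
        of_real (1 / real d) * (\<Sum>j=1..d. ?w x * of_real (cos (2 * pi * (x j - a j))) * fchar d h x))
      (of_real \<epsilon> * 0 + of_real (1 / real d) * (\<Sum>j=1..d. 0))"
    using Suc by (intro has_bochner_integral_add has_bochner_integral_mult_right
        has_bochner_integral_sum has_bochner_integral_0_mult_cos) auto
  also have "(\<lambda>x. of_real \<epsilon> * (?w x * fchar d h x) +
        of_real (1 / real d) * (\<Sum>j=1..d. ?w x * of_real (cos (2 * pi * (x j - a j))) * fchar d h x)) =
      (\<lambda>x. w x * of_real (peak d a \<epsilon> x) ^ Suc N * fchar d h x)"
  proof
    fix x
    let ?C = "\<Sum>j=1..d. complex_of_real (cos (2 * pi * (x j - a j)))"
    have "(\<Sum>j=1..d. ?w x * of_real (cos (2 * pi * (x j - a j))) * fchar d h x) = ?w x * ?C * fchar d h x"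
      by (simp add: sum_distrib_left sum_distrib_right)
    then have "of_real \<epsilon> * (?w x * fchar d h x) +
        of_real (1 / real d) * (\<Sum>j=1..d. ?w x * of_real (cos (2 * pi * (x j - a j))) * fchar d h x) =
      ?w x * (of_real \<epsilon> + of_real (1 / real d) * ?C) * fchar d h x"
      by (simp only:) (simp only: algebra_simps)
    also have "of_real \<epsilon> + of_real (1 / real d) * ?C = complex_of_real (peak d a \<epsilon> x)"
      by (simp add: peak_def)
    finally show "of_real \<epsilon> * (?w x * fchar d h x) +
        of_real (1 / real d) * (\<Sum>j=1..d. ?w x * of_real (cos (2 * pi * (x j - a j))) * fchar d h x) =
      w x * of_real (peak d a \<epsilon> x) ^ Suc N * fchar d h x"
      by (simp only: power_Suc2 mult.assoc)
  qed
  finally show ?case by simp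
qed

lemma measurable_peak [measurable]: "peak d a \<epsilon> \<in> borel_measurable (unit_cube d)"
  unfolding peak_def
  by (intro borel_measurable_add borel_measurable_const borel_measurable_divide
      borel_measurable_sum borel_measurable_continuous_on[of cos] borel_measurable_times
      borel_measurable_diff measurable_coordinate continuous_on_cos continuous_on_id)

lemma peak_superlevel_measure_pos:
  assumes d: "d \<ge> 1" and a: "a \<in> (\<Pi>\<^sub>E j\<in>{1..d}. {0..1})" and \<epsilon>: "\<epsilon> > 0"
  shows "measure (unit_cube d) {x \<in> space (unit_cube d). peak d a \<epsilon> x > 1 + \<epsilon> / 2} > 0"
proof -
  interpret U: prob_space "unit_cube d" by (rule prob_space_unit_cube)
  interpret P: product_prob_space "\<lambda>_::nat. restrict_space lborel {0..1::real}" "{1..d}"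
    by (rule product_prob_space_unit_cube)
  have "((\<lambda>t. cos (2 * pi * t)) \<longlongrightarrow> cos (2 * pi * 0)) (at 0)"
    by (intro tendsto_intros)
  then have "\<forall>\<^sub>F t in at 0. cos (2 * pi * t) > 1 - \<epsilon> / 4"
    using \<epsilon> by (intro order_tendstoD) auto
  then obtain \<rho> where \<rho>: "\<rho> > 0" "\<And>t. t \<noteq> 0 \<Longrightarrow> \<bar>t\<bar> < \<rho> \<Longrightarrow> cos (2 * pi * t) > 1 - \<epsilon> / 4"
    unfolding eventually_at by (auto simp: dist_real_def)
  define \<sigma> where "\<sigma> = min (\<rho> / 2) (1 / 2)"
  have \<sigma>: "0 < \<sigma>" "\<sigma> \<le> 1 / 2" "\<sigma> < \<rho>" using \<rho>(1) by (auto simp: \<sigma>_def)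
  \<comment> \<open>The point \<open>a\<close> may lie on a face of the cube, so the intervals are
    clipped to [0, 1]; they keep positive length. On the box every cosine is at least 1 -
    \<epsilon>/4, which puts the peak above 1 + \<epsilon>/2.\<close>
  define B where "B j = {max 0 (a j - \<sigma>)..min 1 (a j + \<sigma>)}" for j
  have B_sets: "B j \<in> sets (restrict_space lborel {0..1})" for j
    unfolding B_def by (subst sets_restrict_space_iff) auto
  have "emeasure (restrict_space lborel {0..1}) (B j) > 0" if "j \<in> {1..d}" for j
  proof -
    have "0 \<le> a j" "a j \<le> 1" using a that by (auto simp: PiE_def Pi_def)
    then have "emeasure lborel (B j) > 0"
      unfolding B_def using \<sigma> by (subst emeasure_lborel_Icc) (auto simp: min_def max_def)
    then show ?thesis unfolding B_def by (subst emeasure_restrict_space) auto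
  qed
  then have "emeasure (unit_cube d) (\<Pi>\<^sub>E j\<in>{1..d}. B j) > 0"
    unfolding unit_cube_def using B_sets
    by (subst P.emeasure_PiM) (auto simp: zero_less_iff_neq_zero)
  then have pos: "measure (unit_cube d) (\<Pi>\<^sub>E j\<in>{1..d}. B j) > 0"
    by (simp add: U.emeasure_eq_measure)
  have "measure (unit_cube d) (\<Pi>\<^sub>E j\<in>{1..d}. B j) \<le>
      measure (unit_cube d) {x \<in> space (unit_cube d). peak d a \<epsilon> x > 1 + \<epsilon> / 2}"
  proof (rule U.finite_measure_mono)
    show "(\<Pi>\<^sub>E j\<in>{1..d}. B j) \<subseteq> {x \<in> space (unit_cube d). peak d a \<epsilon> x > 1 + \<epsilon> / 2}"
    proof
      fix x assume x: "x \<in> (\<Pi>\<^sub>E j\<in>{1..d}. B j)"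
      moreover have "(\<Pi>\<^sub>E j\<in>{1..d}. B j) \<subseteq> (\<Pi>\<^sub>E j\<in>{1..d}. {0..1})"
        by (rule PiE_mono) (auto simp: B_def)
      ultimately have "x \<in> space (unit_cube d)"
        unfolding space_unit_cube by blast
      moreover have "cos (2 * pi * (x j - a j)) \<ge> 1 - \<epsilon> / 4" if "j \<in> {1..d}" for j
      proof (cases "x j - a j = 0")
        case True then show ?thesis using \<epsilon> by simp
      next
        case False
        have "x j \<in> B j" using x that by (auto simp: PiE_def Pi_def)
        then have "\<bar>x j - a j\<bar> < \<rho>" using \<sigma> by (auto simp: B_def)
        then show ?thesis using \<rho>(2) False by (simp add: less_imp_le)
      qed
      then have "(\<Sum>j=1..d. 1 - \<epsilon> / 4) \<le> (\<Sum>j=1..d. cos (2 * pi * (x j - a j)))"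
        by (intro sum_mono)
      then have "1 - \<epsilon> / 4 \<le> (\<Sum>j=1..d. cos (2 * pi * (x j - a j))) / real d"
        using d by (simp add: field_simps)
      ultimately show "x \<in> {x \<in> space (unit_cube d). peak d a \<epsilon> x > 1 + \<epsilon> / 2}"
        using \<epsilon> by (simp add: peak_def)
    qed
    show "{x \<in> space (unit_cube d). peak d a \<epsilon> x > 1 + \<epsilon> / 2} \<in> U.events"
      by measurable
  qed
  then show ?thesis using pos by linarith
qed

text \<open>The trigonometric polynomial \<open>peak\<close> exceeds 1 near \<open>a\<close> and is bounded by 1 in absolute value
  away from \<open>a\<close>, so its powers concentrate at \<open>a\<close> while \<open>D\<close> stays orthogonal to them.\<close>

lemma eq_0_if_fourier_coeffs_0:
  assumes d: "d \<ge> 1" and D: "continuous_on (real_vecs d) D" "one_periodic d D"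
      and orth: "\<And>h. h \<in> int_vecs d \<Longrightarrow> has_bochner_integral (unit_cube d) (\<lambda>x. D x * fchar d h x) 0"
      and a: "a \<in> (\<Pi>\<^sub>E j\<in>{1..d}. {0..1})"
    shows "D a = 0"
proof (rule ccontr)
  assume "D a \<noteq> 0"
  interpret U: prob_space "unit_cube d" by (rule prob_space_unit_cube)
  \<comment> \<open>Rotating by the conjugate of \<open>D a\<close> gives a real function that is
    positive at \<open>a\<close>.\<close>
  define u where "u x = Re (cnj (D a) * D x)" for x
  define u0 where "u0 = (cmod (D a))\<^sup>2"
  have u0: "u0 > 0" "u a = u0"
  proof -
    show "u0 > 0" using \<open>D a \<noteq> 0\<close> by (simp add: u0_def)
    show "u a = u0" using cmod_power2[of "D a"] by (simp add: u0_def u_def power2_eq_square)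
  qed
  have a': "a \<in> real_vecs d" using a by (auto simp: real_vecs_def PiE_def)
  obtain \<delta>0 where \<delta>0: "\<delta>0 > 0" "\<And>y. y \<in> real_vecs d \<Longrightarrow>
      (\<And>j. j \<in> {1..d} \<Longrightarrow> \<bar>y j - a j\<bar> < \<delta>0) \<Longrightarrow> dist (D y) (D a) < cmod (D a) / 2"
    using continuous_on_real_vecs_near[OF D(1) a', of "cmod (D a) / 2"] \<open>D a \<noteq> 0\<close> by auto
  \<comment> \<open>The cap 1/4 makes c nonnegative, hence the peak is nonnegative wherever all
    cosines exceed c.\<close>
  define \<delta> where "\<delta> = min \<delta>0 (1 / 4)"
  have \<delta>: "0 < \<delta>" "\<delta> \<le> 1 / 4" "\<delta> \<le> \<delta>0" using \<delta>0(1) by (auto simp: \<delta>_def)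
  define c where "c = cos (2 * pi * \<delta>)"
  have "0 < 2 * pi * \<delta>" "2 * pi * \<delta> \<le> pi / 2" using \<delta> by auto
  then have c: "c < 1" "0 \<le> c"
    using cos_monotone_0_pi[of 0 "2 * pi * \<delta>"] cos_ge_zero[of "2 * pi * \<delta>"] pi_gt_zero
    unfolding c_def by (simp, linarith)
  \<comment> \<open>The cosines determine closeness to \<open>a\<close> only modulo 1 in each
    coordinate; periodicity of \<open>D\<close> lets x be shifted to a point that really is
    close.\<close>
  have near: "u x \<ge> u0 / 2"
    if x: "x \<in> space (unit_cube d)" and cos: "\<And>j. j \<in> {1..d} \<Longrightarrow> cos (2 * pi * (x j - a j)) > c" for x
  proof -
    have "\<exists>m. \<bar>x j - a j + real_of_int m\<bar> < \<delta>" if "j \<in> {1..d}" for j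
      using cos_gt_imp_near_int[of \<delta> "x j - a j"] cos[OF that] \<delta> unfolding c_def by auto
    then obtain m where m: "\<And>j. j \<in> {1..d} \<Longrightarrow> \<bar>x j - a j + real_of_int (m j)\<bar> < \<delta>" by metis
    have x': "x \<in> real_vecs d" using x by (auto simp: space_unit_cube real_vecs_def PiE_def)
    define y where "y = (\<lambda>i. if i \<in> {1..d} then x i + of_int (m i) else x i)"
    have "y \<in> real_vecs d" using x' by (auto simp: y_def real_vecs_def PiE_def extensional_def)
    moreover have "\<bar>y j - a j\<bar> < \<delta>0" if "j \<in> {1..d}" for j
      using m[OF that] \<delta> that by (simp add: y_def algebra_simps)
    ultimately have "dist (D y) (D a) < cmod (D a) / 2" by (rule \<delta>0(2))
    moreover have "D y = D x" unfolding y_def using D(2) x' by (rule one_periodic_shift)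
    ultimately have dist: "cmod (D x - D a) \<le> cmod (D a) / 2" by (simp add: dist_norm)
    have "u0 - u x = Re (cnj (D a) * (D a - D x))"
      unfolding u0(2)[symmetric] u_def by (simp add: algebra_simps)
    also have "\<dots> \<le> cmod (cnj (D a) * (D a - D x))" by (rule complex_Re_le_cmod)
    also have "\<dots> = cmod (D a) * cmod (D x - D a)"
      by (simp add: norm_mult norm_minus_commute)
    also have "\<dots> \<le> cmod (D a) * (cmod (D a) / 2)"
      using dist by (rule mult_left_mono) simp
    finally show ?thesis by (simp add: u0_def power2_eq_square)
  qed
  \<comment> \<open>If one cosine is at most c, the average of all d of them is at most 1 - (1 - c)
    / d = 1 - 2 \<epsilon>, so the peak stays below 1 there in spite of the added
    \<epsilon>.\<close>
  define \<epsilon> where "\<epsilon> = (1 - c) / (2 * real d)"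
  have \<epsilon>: "0 < \<epsilon>" "\<epsilon> \<le> 1"
    using c d by (auto simp: \<epsilon>_def field_simps)
  let ?V = "{x \<in> space (unit_cube d). peak d a \<epsilon> x > 1 + \<epsilon> / 2}"
  let ?t = "peak d a \<epsilon>"
  have far: "\<bar>?t x\<bar> \<le> 1" if j: "j \<in> {1..d}" "cos (2 * pi * (x j - a j)) \<le> c" for x j
  proof -
    have "(\<Sum>i=1..d. cos (2 * pi * (x i - a i))) \<le> (\<Sum>i=1..d. if i = j then c else 1)"
      using j by (intro sum_mono) auto
    also have "\<dots> = real d - (1 - c)"
      using j by (subst sum.remove[of _ j]) (auto simp: of_nat_diff)
    finally have "(\<Sum>i=1..d. cos (2 * pi * (x i - a i))) / real d \<le> (real d - (1 - c)) / real d"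
      by (rule divide_right_mono) simp
    also have "\<dots> = 1 - 2 * \<epsilon>" using d by (simp add: \<epsilon>_def field_simps)
    finally have "?t x \<le> 1" using \<epsilon> by (simp add: peak_def)
    moreover have "(\<Sum>i=1..d. - 1) \<le> (\<Sum>i=1..d. cos (2 * pi * (x i - a i)))"
      by (intro sum_mono) auto
    then have "- 1 \<le> (\<Sum>i=1..d. cos (2 * pi * (x i - a i))) / real d"
      using d by (simp add: field_simps)
    then have "- 1 \<le> ?t x" using \<epsilon> by (simp add: peak_def)
    ultimately show ?thesis by simp
  qed
  have close: "?t x \<ge> 0" if "\<And>j. j \<in> {1..d} \<Longrightarrow> cos (2 * pi * (x j - a j)) > c" for x
  proof -
    have "0 \<le> (\<Sum>i=1..d. cos (2 * pi * (x i - a i)))"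
      using that c by (intro sum_nonneg) (meson less_imp_le order.trans)
    then show ?thesis using \<epsilon> by (simp add: peak_def)
  qed
  have intD: "integrable (unit_cube d) D"
    using orth[of "\<lambda>_. 0"] by (auto simp: int_vecs_def has_bochner_integral_iff)
  then have intu: "integrable (unit_cube d) u" unfolding u_def by auto
  have V: "?V \<in> U.events" by measurable
  \<comment> \<open>The integral of u times the N-th power of the peak is 0. Its integrand is at
    least (u0 / 2) (1 + \<epsilon>/2)^N on \<open>?V\<close> and at least -|u| elsewhere. So a
    quantity growing exponentially in N would be bounded.\<close>
  have bound: "(u0 / 2) * (1 + \<epsilon> / 2) ^ N * measure (unit_cube d) ?V \<le> (\<integral>x. \<bar>u x\<bar> \<partial>unit_cube d)" for N
  proof -
    have "has_bochner_integral (unit_cube d) (\<lambda>x. D x * of_real (?t x) ^ N * fchar d (\<lambda>_. 0) x) 0"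
      using orth by (intro has_bochner_integral_0_mult_peak_power) (auto simp: int_vecs_def)
    then have "has_bochner_integral (unit_cube d) (\<lambda>x. Re (cnj (D a) * (D x * of_real (?t x) ^ N))) (Re (cnj (D a) * 0))"
      by (intro has_bochner_integral_Re has_bochner_integral_mult_right) simp
    also have "(\<lambda>x. Re (cnj (D a) * (D x * of_real (?t x) ^ N))) = (\<lambda>x. u x * ?t x ^ N)"
    proof
      fix x
      have "cnj (D a) * (D x * of_real (?t x) ^ N) = of_real (?t x ^ N) * (cnj (D a) * D x)" by simp
      then show "Re (cnj (D a) * (D x * of_real (?t x) ^ N)) = u x * ?t x ^ N"
        unfolding u_def by (simp only: times_complex.sel Re_complex_of_real Im_complex_of_real) simp
    qed
    finally have zero: "has_bochner_integral (unit_cube d) (\<lambda>x. u x * ?t x ^ N) 0" by simp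
    have "(\<integral>x. (u0 / 2) * (1 + \<epsilon> / 2) ^ N * indicator ?V x - \<bar>u x\<bar> \<partial>unit_cube d) \<le>
        (\<integral>x. u x * ?t x ^ N \<partial>unit_cube d)"
    proof (rule integral_mono)
      show "integrable (unit_cube d) (\<lambda>x. (u0 / 2) * (1 + \<epsilon> / 2) ^ N * indicator ?V x - \<bar>u x\<bar>)"
        using intu V by (intro Bochner_Integration.integrable_diff integrable_mult_right)
          (auto simp: U.emeasure_eq_measure)
      show "integrable (unit_cube d) (\<lambda>x. u x * ?t x ^ N)"
        using zero by (simp add: has_bochner_integral_iff)
      fix x assume x: "x \<in> space (unit_cube d)"
      show "(u0 / 2) * (1 + \<epsilon> / 2) ^ N * indicator ?V x - \<bar>u x\<bar> \<le> u x * ?t x ^ N"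
      proof (cases "\<forall>j\<in>{1..d}. cos (2 * pi * (x j - a j)) > c")
        case True
        then have ux: "u x \<ge> u0 / 2" and tx: "?t x \<ge> 0" using near x close by auto
        have "(u0 / 2) * (1 + \<epsilon> / 2) ^ N * indicator ?V x \<le> u x * ?t x ^ N"
        proof (cases "x \<in> ?V")
          case True
          then have "(u0 / 2) * (1 + \<epsilon> / 2) ^ N \<le> u x * ?t x ^ N"
            using ux u0 \<epsilon> by (intro mult_mono power_mono) auto
          then show ?thesis using True by simp
        next
          case False
          then show ?thesis using ux u0 tx by simp
        qed
        then show ?thesis by linarith
      next
        case False
        then have t: "\<bar>?t x\<bar> \<le> 1" using far by (auto simp: not_less)
        then have "x \<notin> ?V" using \<epsilon> by auto
        moreover have "\<bar>u x * ?t x ^ N\<bar> \<le> \<bar>u x\<bar> * 1"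
          unfolding abs_mult power_abs using t by (intro mult_left_mono power_le_one) auto
        ultimately show ?thesis by auto
      qed
    qed
    also have "(\<integral>x. u x * ?t x ^ N \<partial>unit_cube d) = 0" using zero by (simp add: has_bochner_integral_iff)
    also have "(\<integral>x. (u0 / 2) * (1 + \<epsilon> / 2) ^ N * indicator ?V x - \<bar>u x\<bar> \<partial>unit_cube d) =
        (u0 / 2) * (1 + \<epsilon> / 2) ^ N * measure (unit_cube d) ?V - (\<integral>x. \<bar>u x\<bar> \<partial>unit_cube d)"
      using intu V by (subst Bochner_Integration.integral_diff)
        (auto simp: U.emeasure_eq_measure)
    finally show ?thesis by simp
  qed
  have pos: "(u0 / 2) * measure (unit_cube d) ?V > 0"
    using u0 peak_superlevel_measure_pos[OF d a \<epsilon>(1)] by simp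
  obtain N where "(\<integral>x. \<bar>u x\<bar> \<partial>unit_cube d) / ((u0 / 2) * measure (unit_cube d) ?V) < (1 + \<epsilon> / 2) ^ N"
    using real_arch_pow[of "1 + \<epsilon> / 2"] \<epsilon> by auto
  then show False using bound[of N] pos by (simp add: divide_less_eq mult_ac)
qed

section \<open>Pointwise representation by the Fourier series\<close>

lemma continuous_on_fchar: "continuous_on S (fchar d h)"
  unfolding fchar_def
  by (intro continuous_intros continuous_on_subset[OF continuous_on_product_coordinates]) auto

lemma fchar_periodic:
  assumes "j \<in> {1..d}"
  shows "fchar d h (x(j := x j + 1)) = fchar d h x"
proof -
  have "(\<Sum>i=1..d. real_of_int (h i) * (x(j := x j + 1)) i) =
      (\<Sum>i=1..d. real_of_int (h i) * x i + (if i = j then of_int (h j) else 0))"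
    by (intro sum.cong) (auto simp: algebra_simps)
  also have "\<dots> = (\<Sum>i=1..d. real_of_int (h i) * x i) + of_int (h j)"
    using assms by (simp add: sum.distrib)
  finally show ?thesis
    using cis_multiple_2pi[of "of_int (h j)"] by (simp add: fchar_def ring_distribs cis_mult[symmetric])
qed

text \<open>The series converges uniformly to a continuous periodic g with the same coefficients as
  f. Then f - g is orthogonal to every character and vanishes by uniqueness.\<close>

lemma fourier_series:
  assumes d: "d \<ge> 1" and f: "continuous_on (real_vecs d) f" "one_periodic d f"
    and int: "integrable (unit_cube d) f"
    and summable: "(\<lambda>h. cmod (fourier_coeff d f h)) summable_on int_vecs d"
    and a: "a \<in> (\<Pi>\<^sub>E j\<in>{1..d}. {0..1})"
  shows "((\<lambda>h. fourier_coeff d f h * fchar d h a) has_sum f a) (int_vecs d)"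
proof -
  interpret U: prob_space "unit_cube d" by (rule prob_space_unit_cube)
  define c where "c = fourier_coeff d f"
  define s where "s F x = (\<Sum>h\<in>F. c h * fchar d h x)" for F x
  define g where "g x = (\<Sum>\<^sub>\<infinity>h\<in>int_vecs d. c h * fchar d h x)" for x
  have abs: "(\<lambda>h. norm (c h * fchar d h x)) summable_on int_vecs d" for x
    using summable by (simp add: norm_mult c_def)
  have lim: "uniform_limit UNIV s g (finite_subsets_at_top (int_vecs d))"
    unfolding s_def g_def
    by (rule Weierstrass_m_test_general[OF _ summable]) (simp add: norm_mult c_def)
  have s_cont: "continuous_on UNIV (s F)" for F
    unfolding s_def by (intro continuous_intros continuous_on_fchar)
  have g_cont: "continuous_on UNIV g"
    by (rule uniform_limit_theorem[OF _ lim]) (simp_all add: s_cont)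
  have g_per: "one_periodic d g"
    by (simp add: one_periodic_def g_def fchar_periodic)
  have s_meas: "s F \<in> borel_measurable (unit_cube d)" for F
    unfolding s_def by (intro borel_measurable_sum borel_measurable_times borel_measurable_const measurable_fchar)
  \<comment> \<open>\<open>k\<close> is forced into \<open>F\<close> so that integrating the partial
    sum against the conjugate character of \<open>k\<close> gives exactly
    \<open>c k\<close>.\<close>
  have approx: "\<exists>F. finite F \<and> F \<subseteq> int_vecs d \<and> k \<in> F \<and> (\<forall>x. cmod (g x - s F x) < e)"
    if "e > 0" "k \<in> int_vecs d" for e k
  proof -
    have "\<forall>\<^sub>F F in finite_subsets_at_top (int_vecs d). \<forall>x\<in>UNIV. dist (s F x) (g x) < e"
      using lim that(1) by (simp add: uniform_limit_iff)
    moreover have "\<forall>\<^sub>F F in finite_subsets_at_top (int_vecs d). finite F \<and> {k} \<subseteq> F \<and> F \<subseteq> int_vecs d"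
      unfolding eventually_finite_subsets_at_top using that(2) by (intro exI[of _ "{k}"]) auto
    ultimately have "\<forall>\<^sub>F F in finite_subsets_at_top (int_vecs d).
        finite F \<and> F \<subseteq> int_vecs d \<and> k \<in> F \<and> (\<forall>x. cmod (g x - s F x) < e)"
      by eventually_elim (auto simp: dist_norm norm_minus_commute)
    then show ?thesis
      using eventually_happens'[OF finite_subsets_at_top_neq_bot] by blast
  qed
  have zero: "(\<lambda>_. 0) \<in> int_vecs d" by (simp add: int_vecs_def)
  \<comment> \<open>The series converges along the net of finite subsets, whereas measurability of a
    limit needs a sequence; \<open>approx\<close> supplies one with errors below 1 / (n +
    1).\<close>
  have g_meas: "g \<in> borel_measurable (unit_cube d)"
  proof -
    have "\<exists>F. \<forall>x. cmod (g x - s F x) < inverse (real (Suc n))" for n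
      using approx[OF _ zero, of "inverse (real (Suc n))"] by auto
    then obtain F where F: "\<And>n x. cmod (g x - s (F n) x) < inverse (real (Suc n))" by metis
    have "(\<lambda>n. s (F n) x) \<longlonglongrightarrow> g x" for x
    proof -
      have "(\<lambda>n. s (F n) x - g x) \<longlonglongrightarrow> 0"
        by (rule Lim_null_comparison[OF _ LIMSEQ_inverse_real_of_nat])
          (use F in \<open>auto intro!: always_eventually less_imp_le simp: norm_minus_commute\<close>)
      then show ?thesis by (simp add: LIM_zero_iff)
    qed
    then show ?thesis by (intro borel_measurable_LIMSEQ_metric[OF s_meas])
  qed
  have g_int: "integrable (unit_cube d) g"
  proof (rule U.integrable_const_bound[OF _ g_meas])
    show "AE x in unit_cube d. norm (g x) \<le> (\<Sum>\<^sub>\<infinity>h\<in>int_vecs d. cmod (c h))"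
    proof (rule AE_I2)
      fix x
      show "norm (g x) \<le> (\<Sum>\<^sub>\<infinity>h\<in>int_vecs d. cmod (c h))"
        using norm_infsum_bound[OF abs[of x]] by (simp add: g_def norm_mult)
    qed
  qed
  have g_coeff: "fourier_coeff d g k = c k" if k: "k \<in> int_vecs d" for k
  proof -
    have "cmod (fourier_coeff d g k - c k) \<le> e" if e: "e > 0" for e
    proof -
      obtain F where F: "finite F" "F \<subseteq> int_vecs d" "k \<in> F" "\<And>x. cmod (g x - s F x) < e"
        using approx[OF e k] by blast
      have eq: "(\<forall>j\<in>{1..d}. h j + - k j = 0) \<longleftrightarrow> h = k" if "h \<in> F" for h
      proof -
        have "h i = 0" "k i = 0" if "i \<notin> {1..d}" for i
          using that \<open>h \<in> F\<close> F(2) k by (auto simp: int_vecs_def)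
        then have "h = k" if "\<And>j. j \<in> {1..d} \<Longrightarrow> h j = k j"
          using that by (intro ext) (metis (full_types))
        then show ?thesis by auto
      qed
      have "has_bochner_integral (unit_cube d)
          (\<lambda>x. \<Sum>h\<in>F. c h * fchar d (\<lambda>j. h j + - k j) x) (\<Sum>h\<in>F. c h * of_bool (\<forall>j\<in>{1..d}. h j + - k j = 0))"
        by (intro has_bochner_integral_sum has_bochner_integral_mult_right has_bochner_integral_fchar)
      also have "(\<Sum>h\<in>F. c h * of_bool (\<forall>j\<in>{1..d}. h j + - k j = 0)) = (\<Sum>h\<in>F. if h = k then c k else 0)"
        using eq by (intro sum.cong) auto
      also have "\<dots> = c k" using F by simp
      also have "(\<lambda>x. \<Sum>h\<in>F. c h * fchar d (\<lambda>j. h j + - k j) x) = (\<lambda>x. s F x * fchar d (\<lambda>j. - k j) x)"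
        unfolding fchar_add by (simp add: s_def sum_distrib_right mult.assoc)
      finally have diff: "has_bochner_integral (unit_cube d)
          (\<lambda>x. g x * fchar d (\<lambda>j. - k j) x - s F x * fchar d (\<lambda>j. - k j) x) (fourier_coeff d g k - c k)"
        by (intro has_bochner_integral_diff has_bochner_integral_mult_fchar g_int)
      then have "cmod (fourier_coeff d g k - c k) =
          cmod (\<integral>x. (g x - s F x) * fchar d (\<lambda>j. - k j) x \<partial>unit_cube d)"
        by (simp add: has_bochner_integral_iff left_diff_distrib)
      also have "\<dots> \<le> (\<integral>x. cmod ((g x - s F x) * fchar d (\<lambda>j. - k j) x) \<partial>unit_cube d)"
        by (rule integral_norm_bound)
      also have "\<dots> \<le> (\<integral>x. e \<partial>unit_cube d)"
      proof (rule integral_mono)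
        show "integrable (unit_cube d) (\<lambda>x. cmod ((g x - s F x) * fchar d (\<lambda>j. - k j) x))"
          using diff by (simp add: has_bochner_integral_iff left_diff_distrib)
        show "cmod ((g x - s F x) * fchar d (\<lambda>j. - k j) x) \<le> e" for x
          using F(4)[of x] by (simp add: norm_mult)
      qed simp
      also have "\<dots> = e" by (simp add: U.prob_space)
      finally show ?thesis .
    qed
    then have "cmod (fourier_coeff d g k - c k) \<le> 0" by (rule field_le_epsilon[of _ 0, simplified])
    then show ?thesis by simp
  qed
  have "f a - g a = 0"
  proof (rule eq_0_if_fourier_coeffs_0[OF d _ _ _ a])
    show "continuous_on (real_vecs d) (\<lambda>x. f x - g x)"
      by (intro continuous_on_diff f continuous_on_subset[OF g_cont]) auto
    show "one_periodic d (\<lambda>x. f x - g x)"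
      using f(2) g_per by (auto simp: one_periodic_def)
    fix h assume h: "h \<in> int_vecs d"
    then have h': "(\<lambda>j. - h j) \<in> int_vecs d" by (simp add: int_vecs_def)
    have "has_bochner_integral (unit_cube d)
        (\<lambda>x. f x * fchar d (\<lambda>j. - (- h j)) x - g x * fchar d (\<lambda>j. - (- h j)) x)
        (c (\<lambda>j. - h j) - c (\<lambda>j. - h j))"
      unfolding c_def
      by (intro has_bochner_integral_diff has_bochner_integral_mult_fchar int)
        (use has_bochner_integral_mult_fchar[OF g_int, of "\<lambda>j. - h j"] g_coeff[OF h'] in \<open>simp add: c_def\<close>)
    then show "has_bochner_integral (unit_cube d) (\<lambda>x. (f x - g x) * fchar d h x) 0"
      by (simp add: left_diff_distrib)
  qed
  moreover have "((\<lambda>h. c h * fchar d h a) has_sum g a) (int_vecs d)"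
    unfolding g_def using abs_summable_summable[OF abs] by (rule has_sum_infsum)
  ultimately show ?thesis by (simp add: c_def)
qed

section \<open>The error of lattice rules\<close>

lemma has_sum_finite_sum:
  fixes f :: "'i \<Rightarrow> 'a \<Rightarrow> 'b :: topological_comm_monoid_add"
  assumes "finite I" "\<And>i. i \<in> I \<Longrightarrow> (f i has_sum s i) A"
  shows "((\<lambda>x. \<Sum>i\<in>I. f i x) has_sum (\<Sum>i\<in>I. s i)) A"
  using assms by (induction I rule: finite_induct) (auto intro: has_sum_add)

lemma has_sum_of_bool_iff:
  fixes f :: "'a \<Rightarrow> 'b :: {semiring_1, topological_comm_monoid_add, t2_space}"
  shows "((\<lambda>x. f x * of_bool (P x)) has_sum s) A \<longleftrightarrow> (f has_sum s) {x \<in> A. P x}"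
  by (rule has_sum_cong_neutral) auto

lemma infsum_Cauchy_Schwarz:
  fixes a b :: "'a \<Rightarrow> real"
  assumes "\<And>x. x \<in> A \<Longrightarrow> a x \<ge> 0" "\<And>x. x \<in> A \<Longrightarrow> b x \<ge> 0"
    and a: "(\<lambda>x. (a x)\<^sup>2) summable_on A" and b: "(\<lambda>x. (b x)\<^sup>2) summable_on A"
  shows "(\<lambda>x. a x * b x) summable_on A"
    and "infsum (\<lambda>x. a x * b x) A \<le> sqrt (infsum (\<lambda>x. (a x)\<^sup>2) A) * sqrt (infsum (\<lambda>x. (b x)\<^sup>2) A)"
proof -
  show s: "(\<lambda>x. a x * b x) summable_on A"
  proof (rule summable_on_comparison_test[OF summable_on_add[OF a b]])
    fix x assume "x \<in> A"
    then show "0 \<le> a x * b x" using assms by simp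
    have "0 \<le> (a x - b x)\<^sup>2" by simp
    moreover have "0 \<le> (a x)\<^sup>2 + (b x)\<^sup>2" by simp
    ultimately show "a x * b x \<le> (a x)\<^sup>2 + (b x)\<^sup>2"
      unfolding power2_diff by linarith
  qed
  show "infsum (\<lambda>x. a x * b x) A \<le> sqrt (infsum (\<lambda>x. (a x)\<^sup>2) A) * sqrt (infsum (\<lambda>x. (b x)\<^sup>2) A)"
  proof (rule infsum_le_finite_sums[OF s])
    fix F assume F: "finite F" "F \<subseteq> A"
    have "(\<Sum>x\<in>F. a x * b x) \<le> L2_set a F * L2_set b F"
      using assms F L2_set_mult_ineq[of a b F] by (simp add: abs_of_nonneg subset_iff)
    also have "\<dots> \<le> sqrt (infsum (\<lambda>x. (a x)\<^sup>2) A) * sqrt (infsum (\<lambda>x. (b x)\<^sup>2) A)"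
      unfolding L2_set_def using F a b
      by (intro mult_mono real_sqrt_le_mono finite_sum_le_infsum) (auto intro: sum_nonneg infsum_nonneg)
    finally show "(\<Sum>x\<in>F. a x * b x) \<le> sqrt (infsum (\<lambda>x. (a x)\<^sup>2) A) * sqrt (infsum (\<lambda>x. (b x)\<^sup>2) A)" .
  qed
qed

section \<open>Characters at lattice points and the dual lattice\<close>

lemma character_sum:
  assumes "m > 0"
  shows "(\<Sum>k<m. cis (2 * pi * (real k * real_of_int a / real m))) = of_nat m * of_bool (int m dvd a)"
proof (cases "int m dvd a")
  case True
  then obtain b where b: "a = int m * b" by (elim dvdE)
  have "cis (2 * pi * (real k * real_of_int a / real m)) = 1" for k
    using cis_multiple_2pi[of "real_of_int (int k * b)"] assms by (simp add: b mult_ac)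
  then show ?thesis using True by simp
next
  case False
  define w where "w = cis (2 * pi * (real_of_int a / real m))"
  have w: "cis (2 * pi * (real k * real_of_int a / real m)) = w ^ k" for k
  proof -
    have "2 * pi * (real k * real_of_int a / real m) = real k * (2 * pi * (real_of_int a / real m))"
      by simp
    then show ?thesis by (simp only: w_def Complex.DeMoivre)
  qed
  have "w \<noteq> 1"
  proof
    assume "w = 1"
    then have "cos (2 * pi * (real_of_int a / real m)) = 1" by (simp add: w_def complex_eq_iff)
    then obtain b :: int where "2 * pi * (real_of_int a / real m) = real_of_int b * 2 * pi"
      by (auto simp: cos_one_2pi_int)
    then have "real_of_int a = real_of_int (int m * b)" using assms by (simp add: field_simps)
    then have "a = int m * b" by (simp only: of_int_eq_iff)
    then show False using False by simp
  qed
  moreover have "w ^ m = 1"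
    using w[of m] cis_multiple_2pi[of "real_of_int a"] assms by simp
  ultimately show ?thesis unfolding w using False by (simp add: geometric_sum)
qed

lemma fchar_lattice_point:
  assumes "m > 0"
  shows "fchar d h (\<lambda>j\<in>{1..d}. real_of_int ((int k * z j) mod int m) / real m) =
           cis (2 * pi * (real k * real_of_int (inner_int d h z) / real m))"
proof -
  \<comment> \<open>Reduction modulo m changes the phase by N full turns, which \<open>cis\<close>
    ignores.\<close>
  define N where "N = (\<Sum>j=1..d. h j * ((int k * z j) div int m))"
  have "real_of_int ((int k * z j) mod int m) / real m =
      real k * real_of_int (z j) / real m - real_of_int ((int k * z j) div int m)" for j
    using assms by (subst minus_mult_div_eq_mod[symmetric]) (simp add: field_simps)
  then have "(\<Sum>j=1..d. real_of_int (h j) * (\<lambda>j\<in>{1..d}. real_of_int ((int k * z j) mod int m) / real m) j) =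
      (\<Sum>j=1..d. real_of_int (h j) * (real k * real_of_int (z j) / real m - real_of_int ((int k * z j) div int m)))"
    by (intro sum.cong) auto
  also have "\<dots> = real k * real_of_int (inner_int d h z) / real m - real_of_int N"
    by (simp add: inner_int_def N_def right_diff_distrib sum_subtractf sum_distrib_left
        sum_divide_distrib mult_ac)
  finally have "fchar d h (\<lambda>j\<in>{1..d}. real_of_int ((int k * z j) mod int m) / real m) =
      cis (2 * pi * (real k * real_of_int (inner_int d h z) / real m)) / cis (2 * pi * real_of_int N)"
    by (simp only: fchar_def right_diff_distrib cis_divide)
  then show ?thesis by simp
qed

lemma powr_minus_two: "x > 0 \<Longrightarrow> x powr (- 2) = (inverse x)\<^sup>2" for x :: real
  using powr_realpow[of x 2] by (simp add: powr_minus power_inverse)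

text \<open>Cauchy-Schwarz against 1/r, whose squares are summable because 2 \<alpha> > 1. It
  supplies the absolute convergence that the pointwise Fourier representation requires.\<close>

lemma korobov_fourier_summable:
  assumes "\<alpha> > 1/2" "positive_weights \<gamma>" "f \<in> korobov_space d \<alpha> \<gamma>"
  shows "(\<lambda>h. cmod (fourier_coeff d f h)) summable_on int_vecs d"
proof -
  have r: "r_weight \<alpha> \<gamma> h > 0" if "h \<in> int_vecs d" for h
    using r_weight_pos[OF assms(2) that] .
  have "(\<lambda>h. (r_weight \<alpha> \<gamma> h * cmod (fourier_coeff d f h)) * inverse (r_weight \<alpha> \<gamma> h)) summable_on int_vecs d"
  proof (rule infsum_Cauchy_Schwarz)
    show "(\<lambda>h. (r_weight \<alpha> \<gamma> h * cmod (fourier_coeff d f h))\<^sup>2) summable_on int_vecs d"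
      using assms(3) by (simp add: korobov_space_def power_mult_distrib)
    have "(\<lambda>h. r_weight \<alpha> \<gamma> h powr (- 2)) summable_on int_vecs d"
      using assms by (intro r_weight_summable) auto
    also have "?this \<longleftrightarrow> (\<lambda>h. (inverse (r_weight \<alpha> \<gamma> h))\<^sup>2) summable_on int_vecs d"
      using r by (intro summable_on_cong) (simp add: powr_minus_two)
    finally show \<dots> .
  qed (use r[THEN less_imp_le] in auto)
  also have "?this \<longleftrightarrow> ?thesis"
  proof (rule summable_on_cong)
    fix h assume "h \<in> int_vecs d"
    then have "r_weight \<alpha> \<gamma> h \<noteq> 0" using r[of h] by simp
    then show "r_weight \<alpha> \<gamma> h * cmod (fourier_coeff d f h) * inverse (r_weight \<alpha> \<gamma> h) =
        cmod (fourier_coeff d f h)" by simp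
  qed
  finally show ?thesis .
qed

lemma lattice_rule_error:
  assumes "d \<ge> 1" "\<alpha> > 1/2" "positive_weights \<gamma>" "f \<in> korobov_space d \<alpha> \<gamma>" "m > 0"
  shows "(fourier_coeff d f has_sum (lattice_rule d m z f - integral_cube d f))
           {h \<in> int_vecs d - {\<lambda>_. 0}. int m dvd inner_int d h z}"
proof -
  interpret U: prob_space "unit_cube d" by (rule prob_space_unit_cube)
  let ?c = "fourier_coeff d f"
  define x where "x k = (\<lambda>j\<in>{1..d}. real_of_int ((int k * z j) mod int m) / real m)" for k :: nat
  have f: "continuous_on (real_vecs d) f" "one_periodic d f" "square_integrable d f"
    using assms(4) by (auto simp: korobov_space_def)
  have int: "integrable (unit_cube d) f"
  proof (rule Bochner_Integration.integrable_bound)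
    show "integrable (unit_cube d) (\<lambda>x. 1 + (cmod (f x))\<^sup>2)" "f \<in> borel_measurable (unit_cube d)"
      using f(3) by (auto simp: square_integrable_def)
    have "t \<le> 1 + t\<^sup>2" for t :: real
      using zero_le_power2[of "t - 1 / 2"] by (simp add: power2_eq_square algebra_simps)
    then show "AE x in unit_cube d. norm (f x) \<le> norm (1 + (cmod (f x))\<^sup>2)"
      by (intro AE_I2) (simp add: add_nonneg_nonneg)
  qed
  have x: "x k \<in> (\<Pi>\<^sub>E j\<in>{1..d}. {0..1})" for k
  proof -
    have "real_of_int (a mod int m) \<le> real_of_int (int m)" for a
      using assms(5) by (subst of_int_le_iff) (intro less_imp_le pos_mod_bound, simp)
    then show ?thesis
      unfolding x_def restrict_PiE_iff using assms(5) by (simp add: divide_le_eq_1)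
  qed
  have "((\<lambda>h. ?c h * fchar d h (x k)) has_sum f (x k)) (int_vecs d)" for k
    by (rule fourier_series[OF assms(1) f(1,2) int korobov_fourier_summable[OF assms(2-4)] x])
  then have "((\<lambda>h. \<Sum>k<m. ?c h * fchar d h (x k)) has_sum (\<Sum>k<m. f (x k))) (int_vecs d)"
    by (intro has_sum_finite_sum) auto
  then have "((\<lambda>h. 1 / of_nat m * (\<Sum>k<m. ?c h * fchar d h (x k))) has_sum (1 / of_nat m * (\<Sum>k<m. f (x k)))) (int_vecs d)"
    by (rule has_sum_cmult_right)
  also have "1 / of_nat m * (\<Sum>k<m. f (x k)) = lattice_rule d m z f"
    by (simp add: lattice_rule_def x_def)
  also have "(\<lambda>h. 1 / of_nat m * (\<Sum>k<m. ?c h * fchar d h (x k))) = (\<lambda>h. ?c h * of_bool (int m dvd inner_int d h z))"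
  proof
    fix h
    have "(\<Sum>k<m. ?c h * fchar d h (x k)) = ?c h * (of_nat m * of_bool (int m dvd inner_int d h z))"
      unfolding x_def fchar_lattice_point[OF assms(5)] sum_distrib_left[symmetric] character_sum[OF assms(5)] ..
    then show "1 / of_nat m * (\<Sum>k<m. ?c h * fchar d h (x k)) = ?c h * of_bool (int m dvd inner_int d h z)"
      using assms(5) by simp
  qed
  finally have Q: "(?c has_sum lattice_rule d m z f) {h \<in> int_vecs d. int m dvd inner_int d h z}"
    by (simp only: has_sum_of_bool_iff)
  have "?c (\<lambda>_. 0) = integral_cube d f"
    by (simp add: fourier_coeff_eq integral_cube_def)
  then have "(?c has_sum integral_cube d f) {\<lambda>_. 0}" by (simp add: has_sum_finiteI)
  then have "(?c has_sum (lattice_rule d m z f - integral_cube d f))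
      ({h \<in> int_vecs d. int m dvd inner_int d h z} - {\<lambda>_. 0})"
    using Q by (intro has_sum_Diff) (auto simp: int_vecs_def inner_int_def)
  also have "{h \<in> int_vecs d. int m dvd inner_int d h z} - {\<lambda>_. 0} =
      {h \<in> int_vecs d - {\<lambda>_. 0}. int m dvd inner_int d h z}" by auto
  finally show ?thesis .
qed

section \<open>From the randomised error to sums over pairs of primes\<close>

definition dual_pair_sum where
  "dual_pair_sum d \<alpha> \<gamma> z p q = (\<Sum>\<^sub>\<infinity>h\<in>{h \<in> int_vecs d - {\<lambda>_. 0}.
      int p dvd inner_int d h z \<and> int q dvd inner_int d h z}. r_weight \<alpha> \<gamma> h powr (- 2))"

lemma sum_lattice_rule_error_le:
  assumes d: "d \<ge> 1" and \<alpha>: "\<alpha> > 1/2" and \<gamma>: "positive_weights \<gamma>"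
    and f: "f \<in> korobov_space d \<alpha> \<gamma>" "korobov_norm d \<alpha> \<gamma> f \<le> 1"
    and P: "finite P" "\<And>p. p \<in> P \<Longrightarrow> p > 0"
  shows "(\<Sum>p\<in>P. cmod (lattice_rule d p z f - integral_cube d f)) \<le>
           sqrt (\<Sum>p\<in>P. \<Sum>q\<in>P. dual_pair_sum d \<alpha> \<gamma> z p q)"
proof -
  let ?Z = "int_vecs d - {\<lambda>_. 0}"
  define c where "c h = cmod (fourier_coeff d f h)" for h
  define b where "b p h = (of_bool (int p dvd inner_int d h z) :: real)" for p h
  define B where "B h = (\<Sum>p\<in>P. b p h)" for h
  define W where "W h = r_weight \<alpha> \<gamma> h powr (- 2)" for h
  have B: "0 \<le> B h" "B h \<le> real (card P)" for h
  proof -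
    show "0 \<le> B h" unfolding B_def b_def by (intro sum_nonneg) auto
    have "B h \<le> (\<Sum>p\<in>P. 1)" unfolding B_def b_def by (intro sum_mono) auto
    then show "B h \<le> real (card P)" by simp
  qed
  have r: "r_weight \<alpha> \<gamma> h > 0" if "h \<in> ?Z" for h
    using r_weight_pos[OF \<gamma>] that by auto
  have c_sum: "c summable_on ?Z"
    unfolding c_def by (rule summable_on_subset[OF korobov_fourier_summable[OF \<alpha> \<gamma> f(1)]]) auto
  have W_sum: "W summable_on ?Z"
    unfolding W_def using \<alpha> \<gamma> by (intro summable_on_subset[OF r_weight_summable]) auto
  have err: "cmod (lattice_rule d p z f - integral_cube d f) \<le> infsum (\<lambda>h. c h * b p h) ?Z"
    if "p \<in> P" for p
  proof -
    let ?Zp = "{h \<in> ?Z. int p dvd inner_int d h z}"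
    have "c summable_on ?Zp" by (rule summable_on_subset[OF c_sum]) auto
    then have "cmod (lattice_rule d p z f - integral_cube d f) \<le> infsum c ?Zp"
      using norm_infsum_bound[of "fourier_coeff d f" ?Zp]
        infsumI[OF lattice_rule_error[OF d \<alpha> \<gamma> f(1) P(2)[OF that], of z]]
      unfolding c_def by simp
    also have "infsum c ?Zp = infsum (\<lambda>h. c h * b p h) ?Z"
      unfolding b_def by (intro infsum_cong_neutral) auto
    finally show ?thesis .
  qed
  have rc_sum: "(\<lambda>h. (r_weight \<alpha> \<gamma> h * c h)\<^sup>2) summable_on int_vecs d"
    using f(1) by (simp add: korobov_space_def power_mult_distrib c_def)
  then have rc_sum': "(\<lambda>h. (r_weight \<alpha> \<gamma> h * c h)\<^sup>2) summable_on ?Z"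
    by (rule summable_on_subset) auto
  have cb_sum: "(\<lambda>h. c h * b p h) summable_on ?Z" for p
    by (rule summable_on_comparison_test[OF c_sum]) (auto simp: b_def c_def)
  have "(\<Sum>p\<in>P. cmod (lattice_rule d p z f - integral_cube d f)) \<le> (\<Sum>p\<in>P. infsum (\<lambda>h. c h * b p h) ?Z)"
    using err by (rule sum_mono)
  also have "\<dots> = infsum (\<lambda>h. \<Sum>p\<in>P. c h * b p h) ?Z"
    using P(1) cb_sum by (intro infsumI[symmetric] has_sum_finite_sum has_sum_infsum) auto
  \<comment> \<open>Distributing r and 1/r makes the first Cauchy-Schwarz factor at most the Korobov
    norm. \<open>B h\<close> counts the p that divide the inner product of h and z, and its square
    produces the pairs.\<close>
  also have "\<dots> = infsum (\<lambda>h. (r_weight \<alpha> \<gamma> h * c h) * (B h / r_weight \<alpha> \<gamma> h)) ?Z"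
    using r by (intro infsum_cong) (auto simp: B_def sum_distrib_left[symmetric] dest: less_imp_neq[symmetric])
  also have "\<dots> \<le> sqrt (infsum (\<lambda>h. (r_weight \<alpha> \<gamma> h * c h)\<^sup>2) ?Z) * sqrt (infsum (\<lambda>h. (B h / r_weight \<alpha> \<gamma> h)\<^sup>2) ?Z)"
  proof (rule infsum_Cauchy_Schwarz)
    show "(\<lambda>h. (r_weight \<alpha> \<gamma> h * c h)\<^sup>2) summable_on ?Z"
      by (rule rc_sum')
    show "(\<lambda>h. (B h / r_weight \<alpha> \<gamma> h)\<^sup>2) summable_on ?Z"
    proof (rule summable_on_comparison_test)
      show "(\<lambda>h. (real (card P))\<^sup>2 * W h) summable_on ?Z"
        using W_sum by (rule summable_on_cmult_right)
      fix h assume h: "h \<in> ?Z"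
      have "(B h / r_weight \<alpha> \<gamma> h)\<^sup>2 = (B h)\<^sup>2 * W h"
        using r[OF h] by (simp add: W_def powr_minus_two divide_inverse power_mult_distrib)
      also have "\<dots> \<le> (real (card P))\<^sup>2 * W h"
        using B by (intro mult_right_mono power_mono) (auto simp: W_def)
      finally show "(B h / r_weight \<alpha> \<gamma> h)\<^sup>2 \<le> (real (card P))\<^sup>2 * W h" .
    qed simp
  qed (use r[THEN less_imp_le] B in \<open>auto simp: c_def\<close>)
  also have "\<dots> \<le> 1 * sqrt (infsum (\<lambda>h. (B h / r_weight \<alpha> \<gamma> h)\<^sup>2) ?Z)"
  proof (rule mult_right_mono)
    have "infsum (\<lambda>h. (r_weight \<alpha> \<gamma> h * c h)\<^sup>2) ?Z \<le> infsum (\<lambda>h. (r_weight \<alpha> \<gamma> h * c h)\<^sup>2) (int_vecs d)"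
      by (rule infsum_mono2[OF rc_sum' rc_sum]) auto
    then have "sqrt (infsum (\<lambda>h. (r_weight \<alpha> \<gamma> h * c h)\<^sup>2) ?Z) \<le> korobov_norm d \<alpha> \<gamma> f"
      by (simp add: korobov_norm_def c_def power_mult_distrib)
    then show "sqrt (infsum (\<lambda>h. (r_weight \<alpha> \<gamma> h * c h)\<^sup>2) ?Z) \<le> 1" using f(2) by linarith
  qed (auto intro: infsum_nonneg)
  also have "infsum (\<lambda>h. (B h / r_weight \<alpha> \<gamma> h)\<^sup>2) ?Z = infsum (\<lambda>h. \<Sum>p\<in>P. \<Sum>q\<in>P. W h * (b p h * b q h)) ?Z"
  proof (rule infsum_cong)
    fix h assume h: "h \<in> ?Z"
    have "(B h / r_weight \<alpha> \<gamma> h)\<^sup>2 = W h * (B h * B h)"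
      using r[OF h] by (simp add: W_def powr_minus_two divide_inverse power2_eq_square mult_ac)
    also have "\<dots> = (\<Sum>p\<in>P. \<Sum>q\<in>P. W h * (b p h * b q h))"
      unfolding B_def sum_product by (simp add: sum_distrib_left)
    finally show "(B h / r_weight \<alpha> \<gamma> h)\<^sup>2 = (\<Sum>p\<in>P. \<Sum>q\<in>P. W h * (b p h * b q h))" .
  qed
  also have "\<dots> = (\<Sum>p\<in>P. \<Sum>q\<in>P. dual_pair_sum d \<alpha> \<gamma> z p q)"
  proof (intro infsumI has_sum_finite_sum P)
    fix p q
    have "W summable_on {h \<in> ?Z. int p dvd inner_int d h z \<and> int q dvd inner_int d h z}"
      by (rule summable_on_subset[OF W_sum]) auto
    then have "(W has_sum dual_pair_sum d \<alpha> \<gamma> z p q)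
        {h \<in> ?Z. int p dvd inner_int d h z \<and> int q dvd inner_int d h z}"
      unfolding dual_pair_sum_def W_def[symmetric] by (rule has_sum_infsum)
    then show "((\<lambda>h. W h * (b p h * b q h)) has_sum dual_pair_sum d \<alpha> \<gamma> z p q) ?Z"
      unfolding b_def of_bool_conj[symmetric] by (simp only: has_sum_of_bool_iff)
  qed
  finally show ?thesis by simp
qed

lemma ran_error_le:
  assumes "d \<ge> 1" "\<alpha> > 1/2" "positive_weights \<gamma>" and n: "primes_in n \<noteq> {}" "finite (primes_in n)"
    and K: "(\<Sum>p\<in>primes_in n. \<Sum>q\<in>primes_in n. dual_pair_sum d \<alpha> \<gamma> z p q) \<le> (real (card (primes_in n)) * K)\<^sup>2" "K \<ge> 0"
  shows "ran_error d \<alpha> \<gamma> (randomised_lattice d n z) \<le> ennreal K"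
  unfolding ran_error_def
proof (rule SUP_least)
  fix f assume f: "f \<in> {f \<in> korobov_space d \<alpha> \<gamma>. korobov_norm d \<alpha> \<gamma> f \<le> 1}"
  let ?P = "primes_in n"
  let ?e = "\<lambda>p. cmod (lattice_rule d p z f - integral_cube d f)"
  have card: "card ?P > 0" using n by (simp add: card_gt_0_iff)
  have "(\<Sum>p\<in>?P. ?e p) \<le> sqrt (\<Sum>p\<in>?P. \<Sum>q\<in>?P. dual_pair_sum d \<alpha> \<gamma> z p q)"
    using assms f by (intro sum_lattice_rule_error_le) (auto simp: primes_in_def prime_gt_0_nat)
  also have "\<dots> \<le> real (card ?P) * K"
    using K by (intro real_le_lsqrt) auto
  finally have "(\<Sum>p\<in>?P. ?e p) / real (card ?P) \<le> K"
    using card by (simp add: field_simps)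
  moreover have "(\<integral>\<^sup>+ y. ennreal (cmod (y - integral_cube d f)) \<partial>measure_pmf (randomised_lattice d n z f)) =
      (\<Sum>p\<in>?P. ennreal (?e p)) / real (card ?P)"
    unfolding randomised_lattice_def by (simp add: nn_integral_pmf_of_set n ennreal_of_nat_eq_real_of_nat)
  moreover have "\<dots> = ennreal ((\<Sum>p\<in>?P. ?e p) / real (card ?P))"
    using card by (simp add: sum_ennreal divide_ennreal sum_nonneg)
  ultimately show "(\<integral>\<^sup>+ y. ennreal (cmod (y - integral_cube d f)) \<partial>measure_pmf (randomised_lattice d n z f)) \<le> ennreal K"
    by (simp add: ennreal_leI)
qed

section \<open>The search criterion\<close>

lemma card_linear_congruence_le:
  fixes a b :: int
  assumes "prime p" "\<not> int p dvd b"
  shows "card {y \<in> {0..<int p}. [a + b * y = 0] (mod int p)} \<le> 1"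
proof (rule card_le_Suc0_iff_eq[THEN iffD2, unfolded One_nat_def[symmetric], rotated])
  show "\<forall>x\<in>{y \<in> {0..<int p}. [a + b * y = 0] (mod int p)}.
      \<forall>y\<in>{y \<in> {0..<int p}. [a + b * y = 0] (mod int p)}. x = y"
  proof (intro ballI)
    fix x y assume *: "x \<in> {y \<in> {0..<int p}. [a + b * y = 0] (mod int p)}"
      "y \<in> {y \<in> {0..<int p}. [a + b * y = 0] (mod int p)}"
    then have "int p dvd (a + b * x) - (a + b * y)"
      by (intro dvd_diff) (auto simp: cong_0_iff)
    then have "int p dvd b * (x - y)" by (simp add: algebra_simps)
    then have "int p dvd x - y" using assms by (simp add: prime_dvd_mult_iff)
    then show "x = y" using * by (simp add: mod_eq_dvd_iff flip: mod_pos_pos_trivial)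
      (metis mod_eq_dvd_iff mod_pos_pos_trivial)
  qed
qed (rule finite_subset[of _ "{0..<int p}"], auto)

text \<open>After exchanging the sums, \<open>h\<close> is counted once for every y solving its
  congruence: at most once if p does not divide \<open>b h\<close>, and at most p times
  otherwise.\<close>

lemma sum_over_residues_le:
  fixes g :: "'a \<Rightarrow> real"
  assumes p: "prime p" and g: "g summable_on A" "\<And>h. h \<in> A \<Longrightarrow> g h \<ge> 0"
  shows "(\<Sum>y\<in>{0..<int p}. infsum g {h \<in> A. [a h + b h * y = 0] (mod int p)})
           \<le> infsum g A + real p * infsum g {h \<in> A. int p dvd b h}"
proof -
  let ?Q = "\<lambda>h y. [a h + b h * y = 0] (mod int p)"
  have "((\<lambda>h. \<Sum>y\<in>{0..<int p}. g h * of_bool (?Q h y)) has_sum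
      (\<Sum>y\<in>{0..<int p}. infsum g {h \<in> A. ?Q h y})) A"
    unfolding has_sum_of_bool_iff
    by (intro has_sum_finite_sum) (auto simp: has_sum_of_bool_iff intro!: has_sum_infsum summable_on_subset[OF g(1)])
  moreover have "((\<lambda>h. g h * of_bool (int p dvd b h)) has_sum infsum g {h \<in> A. int p dvd b h}) A"
    by (auto simp: has_sum_of_bool_iff intro!: has_sum_infsum summable_on_subset[OF g(1)])
  then have "((\<lambda>h. g h + real p * (g h * of_bool (int p dvd b h))) has_sum
      (infsum g A + real p * infsum g {h \<in> A. int p dvd b h})) A"
    using g(1) by (intro has_sum_add has_sum_cmult_right has_sum_infsum)
  ultimately show ?thesis
  proof (rule has_sum_mono)
    fix h assume h: "h \<in> A"
    have "(\<Sum>y\<in>{0..<int p}. g h * of_bool (?Q h y)) = g h * real (card {y \<in> {0..<int p}. ?Q h y})"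
      by (simp add: sum_distrib_left[symmetric] of_bool_def sum.If_cases Int_def)
    also have "\<dots> \<le> g h * (1 + real p * of_bool (int p dvd b h))"
    proof (rule mult_left_mono[OF _ g(2)[OF h]])
      show "real (card {y \<in> {0..<int p}. ?Q h y}) \<le> 1 + real p * of_bool (int p dvd b h)"
      proof (cases "int p dvd b h")
        case True
        have "card {y \<in> {0..<int p}. ?Q h y} \<le> card {0..<int p}" by (rule card_mono) auto
        then show ?thesis using True by simp
      next
        case False
        then show ?thesis using card_linear_congruence_le[OF p False, of "a h"] by simp
      qed
    qed
    finally show "(\<Sum>y\<in>{0..<int p}. g h * of_bool (?Q h y)) \<le> g h + real p * (g h * of_bool (int p dvd b h))"
      by (simp add: algebra_simps)
  qed
qed

section \<open>Inner products and the last nonzero component\<close>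

lemma inner_int_update:
  assumes "s \<ge> 1"
  shows "inner_int s h (z(s := y)) = inner_int (s - 1) h z + h s * y"
proof -
  obtain t where s: "s = Suc t" using assms by (cases s) auto
  have "(\<Sum>j=1..t. h j * (z(Suc t := y)) j) = (\<Sum>j=1..t. h j * z j)"
    by (intro sum.cong) auto
  then show ?thesis by (simp add: inner_int_def s)
qed

lemma inner_int_cong:
  assumes "\<And>j. j \<in> {1..s} \<Longrightarrow> [z j = z' j] (mod m)"
  shows "[inner_int s h z = inner_int s h z'] (mod m)"
  unfolding inner_int_def using assms by (intro cong_sum cong_scalar_left)

lemma inner_int_extend:
  assumes "h \<in> int_vecs s" "s \<le> d"
  shows "inner_int d h z = inner_int s h z"
  unfolding inner_int_def
  using assms by (intro sum.mono_neutral_right) (auto simp: int_vecs_def)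

lemma last_nonzero_partition:
  "int_vecs d - {\<lambda>_. 0} = (\<Union>s\<in>{1..d}. {h \<in> int_vecs s. h s \<noteq> 0})"
proof (intro set_eqI iffI)
  fix h assume h: "h \<in> int_vecs d - {\<lambda>_. 0}"
  then have ne: "supp h \<noteq> {}" and sub: "supp h \<subseteq> {1..d}" by (auto simp: supp_eq_empty_iff int_vecs_iff_supp simp del: One_nat_def)
  have fin: "finite (supp h)" using sub by (rule finite_subset) simp
  define s where "s = Max (supp h)"
  have s: "s \<in> supp h" unfolding s_def using fin ne by simp
  have "supp h \<subseteq> {1..s}" using sub Max_ge[OF fin] by (auto simp: s_def)
  then have "h \<in> {h \<in> int_vecs s. h s \<noteq> 0}" using s by (simp add: int_vecs_iff_supp supp_def)
  then show "h \<in> (\<Union>s\<in>{1..d}. {h \<in> int_vecs s. h s \<noteq> 0})" using s sub by blast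
next
  fix h assume "h \<in> (\<Union>s\<in>{1..d}. {h \<in> int_vecs s. h s \<noteq> 0})"
  then show "h \<in> int_vecs d - {\<lambda>_. 0}" by (auto simp: int_vecs_def)
qed

lemma infsum_last_nonzero:
  fixes f :: "(nat \<Rightarrow> int) \<Rightarrow> real"
  assumes "f summable_on int_vecs d"
  shows "infsum f {h \<in> int_vecs d - {\<lambda>_. 0}. Q h} =
           (\<Sum>s=1..d. infsum f {h \<in> int_vecs s. h s \<noteq> 0 \<and> Q h})"
proof -
  have "int_vecs s \<subseteq> int_vecs d" if "s \<in> {1..d}" for s
    using that by (auto simp: int_vecs_def)
  then have "(f has_sum (\<Sum>s=1..d. infsum f {h \<in> int_vecs s. h s \<noteq> 0 \<and> Q h}))
      (\<Union>s\<in>{1..d}. {h \<in> int_vecs s. h s \<noteq> 0 \<and> Q h})"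
  proof (intro sum_has_sum has_sum_infsum summable_on_subset[OF assms])
    fix s t :: nat assume "s \<noteq> t"
    then have "s < t \<or> t < s" by linarith
    then show "{h \<in> int_vecs s. h s \<noteq> 0 \<and> Q h} \<inter> {h \<in> int_vecs t. h t \<noteq> 0 \<and> Q h} = {}"
      by (auto simp: int_vecs_def)
  qed auto
  also have "(\<Union>s\<in>{1..d}. {h \<in> int_vecs s. h s \<noteq> 0 \<and> Q h}) = {h \<in> int_vecs d - {\<lambda>_. 0}. Q h}"
    unfolding last_nonzero_partition by auto
  finally show ?thesis by (rule infsumI)
qed

locale weighted_korobov =
  fixes \<alpha> :: real and \<gamma> :: "nat set \<Rightarrow> real" and \<tau> :: real and n :: nat
  assumes alpha: "\<alpha> > 1/2" and weights: "positive_weights \<gamma>" and tau: "0 < \<tau>" "\<tau> < 1" and n: "n \<ge> 2"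
begin

text \<open>The share of component \<open>s\<close> in \<open>mu\<close>: summed over s = 1, ..., d
  these quantities give \<open>mu d \<alpha> \<gamma> lam\<close>.\<close>

definition M :: "nat \<Rightarrow> real \<Rightarrow> real" where
  "M s lam = (\<Sum>\<^sub>\<infinity>h\<in>{h \<in> int_vecs s. h s \<noteq> 0}. r_weight \<alpha> \<gamma> h powr (- (1 / lam)))"

definition W :: "(nat \<Rightarrow> int) \<Rightarrow> real" where
  "W h = r_weight \<alpha> \<gamma> h powr (- 2)"

definition bound :: "nat \<Rightarrow> nat \<Rightarrow> real \<Rightarrow> real" where
  "bound s p lam = (2 / ((1 - \<tau>) * real p) * M s lam) powr (2 * lam)"

lemma summable_lam:
  assumes "1/2 \<le> lam" "lam < \<alpha>" "A \<subseteq> int_vecs s"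
  shows "(\<lambda>h. r_weight \<alpha> \<gamma> h powr (- (1 / lam))) summable_on A"
  using assms weights by (intro summable_on_subset[OF r_weight_summable]) auto

lemma summable_W: "A \<subseteq> int_vecs s \<Longrightarrow> W summable_on A"
  unfolding W_def using alpha weights by (intro summable_on_subset[OF r_weight_summable]) auto

lemma W_nonneg [simp]: "W h \<ge> 0"
  by (simp add: W_def)

lemma W_eq_powr:
  assumes "1/2 \<le> lam"
  shows "W h = (r_weight \<alpha> \<gamma> h powr (- (1 / lam))) powr (2 * lam)"
  using assms by (simp add: W_def powr_powr)

lemma infsum_W_le:
  assumes "1/2 \<le> lam" "lam < \<alpha>" "A \<subseteq> int_vecs s"
  shows "infsum W A \<le> (\<Sum>\<^sub>\<infinity>h\<in>A. r_weight \<alpha> \<gamma> h powr (- (1 / lam))) powr (2 * lam)"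
  using infsum_powr_le(2)[OF _ summable_lam[OF assms], of "2 * lam"] assms(1)
  by (simp flip: W_eq_powr[OF assms(1)])

lemma infsum_W_mono: "A \<subseteq> B \<Longrightarrow> B \<subseteq> int_vecs s \<Longrightarrow> infsum W A \<le> infsum W B"
  by (intro infsum_mono2 summable_W) auto

lemma M_pos:
  assumes "1/2 \<le> lam" "lam < \<alpha>" "s \<ge> 1"
  shows "M s lam > 0"
proof -
  let ?e = "(\<lambda>j. if j = s then 1 else 0) :: nat \<Rightarrow> int"
  have e: "?e \<in> {h \<in> int_vecs s. h s \<noteq> 0}" using assms(3) by (auto simp: int_vecs_def)
  have "0 < r_weight \<alpha> \<gamma> ?e powr (- (1 / lam))"
    using r_weight_pos[OF weights, of ?e s \<alpha>] e by (simp add: less_imp_neq[symmetric])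
  also have "\<dots> \<le> M s lam"
    using finite_sum_le_infsum[OF summable_lam[OF assms(1,2)], of "{h \<in> int_vecs s. h s \<noteq> 0}" s "{?e}"] e
    by (simp add: M_def)
  finally show ?thesis .
qed

lemma theta_eq: "s \<ge> 1 \<Longrightarrow>
  theta \<alpha> \<gamma> s z p y = infsum W {h \<in> {h \<in> int_vecs s. h s \<noteq> 0}. [inner_int (s - 1) h z + h s * y = 0] (mod int p)}"
  unfolding theta_def W_def by (simp add: inner_int_update conj_assoc)

text \<open>Markov's inequality is applied not to \<open>theta\<close> but to the sum S of
  r^(-1/lam) over the same frequencies; by Jensen, \<open>theta\<close> is at most S^(2 lam). The
  mean of S over the residues is at most 2 M / p, and the threshold t is 1 / (1 - \<tau>) times
  that.\<close>

lemma card_bad_le: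
  assumes lam: "1/2 \<le> lam" "lam < \<alpha>" and s: "s \<ge> 1" and p: "prime p"
  shows "real (card {y \<in> {0..<int p}. theta \<alpha> \<gamma> s z p y > bound s p lam}) \<le> (1 - \<tau>) * real p"
proof -
  define g where "g h = r_weight \<alpha> \<gamma> h powr (- (1 / lam))" for h
  define H where "H = {h \<in> int_vecs s. h s \<noteq> 0}"
  define S where "S y = infsum g {h \<in> H. [inner_int (s - 1) h z + h s * y = 0] (mod int p)}" for y
  define bad where "bad = {y \<in> {0..<int p}. theta \<alpha> \<gamma> s z p y > bound s p lam}"
  define t where "t = 2 / ((1 - \<tau>) * real p) * M s lam"
  have p0: "real p > 0" using prime_gt_0_nat[OF p] by simp
  have M: "M s lam > 0" using M_pos[OF lam s] .
  have t: "t > 0" using M p0 tau by (simp add: t_def)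
  have H: "H \<subseteq> int_vecs s" by (auto simp: H_def)
  have g: "g summable_on A" if "A \<subseteq> H" for A
    unfolding g_def using that H by (intro summable_lam[OF lam, of _ s]) auto
  have S0: "S y \<ge> 0" for y unfolding S_def g_def by (intro infsum_nonneg) simp
  have "t \<le> S y" if "y \<in> bad" for y
  proof (rule ccontr)
    assume "\<not> t \<le> S y"
    then have "S y powr (2 * lam) \<le> t powr (2 * lam)"
      using S0 lam by (intro powr_mono2) auto
    moreover have "theta \<alpha> \<gamma> s z p y \<le> S y powr (2 * lam)"
      unfolding theta_eq[OF s] S_def g_def H_def
      by (rule infsum_W_le[OF lam, of _ s]) auto
    ultimately show False using that by (simp add: bad_def bound_def t_def)
  qed
  then have "real (card bad) * t \<le> (\<Sum>y\<in>bad. S y)"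
    using sum_mono[of bad "\<lambda>_. t" S] by simp
  also have "\<dots> \<le> (\<Sum>y\<in>{0..<int p}. S y)"
    by (rule sum_mono2) (auto simp: bad_def S0)
  also have "\<dots> \<le> infsum g H + real p * infsum g {h \<in> H. int p dvd h s}"
    unfolding S_def by (rule sum_over_residues_le[OF p g]) (auto simp: g_def)
  also have "infsum g {h \<in> H. int p dvd h s} = real p powr (- (\<alpha> * (1 / lam))) * M s lam"
    using infsum_r_weight_dvd[OF s, of p \<alpha> \<gamma> "1 / lam"] p0 by (simp add: H_def g_def[abs_def] M_def conj_assoc)
  also have "infsum g H = M s lam" by (simp add: H_def g_def[abs_def] M_def)
  \<comment> \<open>Frequencies with p dividing the last component solve the congruence for all p
    residues or none, but their total weight carries p^(-\<alpha>/lam) \<le> 1/p. They cost at most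
    a second \<open>M s lam\<close>, hence the factor 2 in the definition of the good set.\<close>
  also have "M s lam + real p * (real p powr (- (\<alpha> * (1 / lam))) * M s lam) \<le> M s lam + 1 * M s lam"
  proof -
    have "real p powr (- (\<alpha> * (1 / lam))) \<le> real p powr (- 1)"
      using lam prime_ge_1_nat[OF p] by (intro powr_mono) (auto simp: field_simps)
    then have "real p * real p powr (- (\<alpha> * (1 / lam))) \<le> 1"
      using p0 by (simp add: powr_minus field_simps)
    then have "(real p * real p powr (- (\<alpha> * (1 / lam)))) * M s lam \<le> 1 * M s lam"
      using M by (intro mult_right_mono) auto
    then show ?thesis by (simp add: mult.assoc)
  qed
  also have "\<dots> = (1 - \<tau>) * real p * t"
    using p0 tau by (simp add: t_def)
  finally show ?thesis using t by (simp add: bad_def)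
qed

lemma good_set_eq:
  "good_set \<alpha> \<gamma> \<tau> s z p = {y \<in> {0..<int p}. theta \<alpha> \<gamma> s z p y \<le> (INF lam\<in>{1/2..<\<alpha>}. bound s p lam)}"
  by (simp add: good_set_def bound_def M_def)

lemma bound_bdd_below: "bdd_below (bound s p ` A)"
  by (rule bdd_belowI[of _ 0]) (auto simp: bound_def)

lemma good_set_theta_le:
  assumes "y \<in> good_set \<alpha> \<gamma> \<tau> s z p" "1/2 \<le> lam" "lam < \<alpha>"
  shows "theta \<alpha> \<gamma> s z p y \<le> bound s p lam"
proof -
  have "(INF lam\<in>{1/2..<\<alpha>}. bound s p lam) \<le> bound s p lam"
    using assms by (intro cINF_lower bound_bdd_below) auto
  then show ?thesis using assms(1) by (auto simp: good_set_eq)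
qed

text \<open>The bad sets for the individual \<open>lam\<close> are nested, so their finite union is one of them.\<close>

lemma card_good_set_ge:
  assumes s: "s \<ge> 1" and p: "prime p"
  shows "\<tau> * real p \<le> real (card (good_set \<alpha> \<gamma> \<tau> s z p))"
proof -
  let ?G = "good_set \<alpha> \<gamma> \<tau> s z p"
  define bad where "bad = {0..<int p} - ?G"
  have fin: "finite bad" by (simp add: bad_def)
  have sub: "?G \<subseteq> {0..<int p}" by (auto simp: good_set_def)
  have "real (card bad) \<le> (1 - \<tau>) * real p"
  proof (cases "bad = {}")
    case True
    then show ?thesis using tau by simp
  next
    case False
    \<comment> \<open>\<open>y0\<close> has the least \<open>theta\<close> among the bad residues,
      so a \<open>lam\<close> whose bound excludes \<open>y0\<close> excludes every bad
      residue.\<close>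
    obtain y0 where y0: "y0 \<in> bad" "\<And>y. y \<in> bad \<Longrightarrow> theta \<alpha> \<gamma> s z p y0 \<le> theta \<alpha> \<gamma> s z p y"
      using ex_is_arg_min_if_finite[OF fin False, of "theta \<alpha> \<gamma> s z p"]
      by (auto simp: is_arg_min_linorder)
    have "(INF lam\<in>{1/2..<\<alpha>}. bound s p lam) < theta \<alpha> \<gamma> s z p y0"
      using y0(1) by (auto simp: bad_def good_set_eq not_le)
    then obtain lam where lam: "lam \<in> {1/2..<\<alpha>}" "bound s p lam < theta \<alpha> \<gamma> s z p y0"
      using alpha by (subst (asm) cINF_less_iff) (auto simp: bound_bdd_below)
    have "bad \<subseteq> {y \<in> {0..<int p}. theta \<alpha> \<gamma> s z p y > bound s p lam}"
      using y0(2) lam(2) by (force simp: bad_def)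
    then have "card bad \<le> card {y \<in> {0..<int p}. theta \<alpha> \<gamma> s z p y > bound s p lam}"
      by (rule card_mono[rotated]) (rule finite_subset[of _ "{0..<int p}"], auto)
    also have "real \<dots> \<le> (1 - \<tau>) * real p"
      using lam(1) s p by (intro card_bad_le) auto
    finally show ?thesis by simp
  qed
  moreover have "card bad = p - card ?G"
    unfolding bad_def using sub by (subst card_Diff_subset) (auto intro: finite_subset)
  moreover have "card ?G \<le> p" using card_mono[OF _ sub] by simp
  ultimately show ?thesis by (simp add: of_nat_diff algebra_simps)
qed

lemma good_set_finite: "finite (good_set \<alpha> \<gamma> \<tau> s z p)"
  by (rule finite_subset[of _ "{0..<int p}"]) (auto simp: good_set_def)

lemma good_set_nonempty:
  assumes "s \<ge> 1" "prime p"
  shows "good_set \<alpha> \<gamma> \<tau> s z p \<noteq> {}"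
  using card_good_set_ge[OF assms, of z] tau prime_gt_0_nat[OF assms(2)]
  by (auto simp: mult_le_0_iff)

lemma sum_good_set_le:
  assumes s: "s \<ge> 1" and p: "prime p" and A: "A \<subseteq> int_vecs s"
  shows "(\<Sum>y\<in>good_set \<alpha> \<gamma> \<tau> s z p. infsum W {h \<in> A. [a h + h s * y = 0] (mod int p)})
           \<le> infsum W A + real p * infsum W {h \<in> A. int p dvd h s}"
proof -
  have "(\<Sum>y\<in>good_set \<alpha> \<gamma> \<tau> s z p. infsum W {h \<in> A. [a h + h s * y = 0] (mod int p)}) \<le>
      (\<Sum>y\<in>{0..<int p}. infsum W {h \<in> A. [a h + h s * y = 0] (mod int p)})"
    by (intro sum_mono2 infsum_nonneg) (auto simp: good_set_def)
  also have "\<dots> \<le> infsum W A + real p * infsum W {h \<in> A. int p dvd h s}"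
    by (rule sum_over_residues_le[OF p summable_W[OF A]]) simp
  finally show ?thesis .
qed

section \<open>Averaging the search criterion over the good set\<close>

definition A_term where
  "A_term s z p zs q y = infsum W {h \<in> int_vecs s. h s \<noteq> 0 \<and> \<not> [h s = 0] (mod int p) \<and>
      [inner_int s h (z(s := y)) = 0] (mod int p) \<and> [inner_int s h (z(s := zs q)) = 0] (mod int q)}"

text \<open>Here q is a prime whose residue is still unchosen. Since q divides \<open>h s\<close>,
  the inner product modulo q reduces to the earlier components.\<close>

definition D_term where
  "D_term s z p q y = infsum W {h \<in> int_vecs s. h s \<noteq> 0 \<and> [h s = 0] (mod int q) \<and>
      [inner_int s h (z(s := y)) = 0] (mod int p) \<and> [inner_int (s - 1) h z = 0] (mod int q)}"

lemma T_criterion_eq: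
  "T_criterion \<alpha> \<gamma> n s z p zs y = theta \<alpha> \<gamma> s z p y +
     2 * (\<Sum>q\<in>{q \<in> primes_in n. q < p}. A_term s z p zs q y) +
     2 * (\<Sum>q\<in>{q \<in> primes_in n. p < q}. D_term s z p q y)"
  by (simp add: T_criterion_def A_term_def D_term_def W_def[abs_def])

text \<open>As p does not divide the last component, every frequency is met by at most one y, so the
  whole sum over y costs no more than \<open>theta\<close> at the residue already chosen for q,
  which is good.\<close>

lemma sum_A_term_le:
  assumes lam: "1/2 \<le> lam" "lam < \<alpha>" and s: "s \<ge> 1" and p: "prime p"
    and zq: "zs q \<in> good_set \<alpha> \<gamma> \<tau> s z q"
  shows "(\<Sum>y\<in>good_set \<alpha> \<gamma> \<tau> s z p. A_term s z p zs q y) \<le> bound s q lam"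
proof -
  define A where "A = {h \<in> int_vecs s. h s \<noteq> 0 \<and> \<not> int p dvd h s \<and>
      [inner_int s h (z(s := zs q)) = 0] (mod int q)}"
  have A: "A \<subseteq> int_vecs s" by (auto simp: A_def)
  have "A_term s z p zs q y = infsum W {h \<in> A. [inner_int (s - 1) h z + h s * y = 0] (mod int p)}" for y
    unfolding A_term_def A_def by (intro arg_cong2[where f = infsum] refl)
      (auto simp: inner_int_update[OF s] cong_0_iff)
  then have "(\<Sum>y\<in>good_set \<alpha> \<gamma> \<tau> s z p. A_term s z p zs q y) \<le> infsum W A + real p * infsum W {h \<in> A. int p dvd h s}"
    using sum_good_set_le[OF s p A, where z = z and a = "\<lambda>h. inner_int (s - 1) h z"] by simp
  also have "{h \<in> A. int p dvd h s} = {}" by (auto simp: A_def)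
  also have "infsum W A + real p * infsum W {} \<le> theta \<alpha> \<gamma> s z q (zs q)"
    unfolding theta_eq[OF s] A_def
    by (simp, intro infsum_W_mono[of _ _ s]) (auto simp: inner_int_update[OF s])
  also have "\<dots> \<le> bound s q lam" using zq lam by (rule good_set_theta_le)
  finally show ?thesis .
qed

text \<open>Once q divides the last component, the condition modulo q holds for all residues alike;
  the frequencies lie in the \<open>theta\<close> sum of any good residue of q, and one exists.
  Those met by several y have a last component divisible by p q, which gives the second
  summand.\<close>

lemma sum_D_term_le:
  assumes lam: "1/2 \<le> lam" "lam < \<alpha>" and s: "s \<ge> 1" and p: "prime p" and q: "prime q" "p \<noteq> q"
  shows "(\<Sum>y\<in>good_set \<alpha> \<gamma> \<tau> s z p. D_term s z p q y) \<le>
           bound s q lam + real p * (real (p * q) powr (- (2 * lam)) * M s lam powr (2 * lam))"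
proof -
  define A where "A = {h \<in> int_vecs s. h s \<noteq> 0 \<and> int q dvd h s \<and>
      [inner_int (s - 1) h z = 0] (mod int q)}"
  have A: "A \<subseteq> int_vecs s" by (auto simp: A_def)
  have "D_term s z p q y = infsum W {h \<in> A. [inner_int (s - 1) h z + h s * y = 0] (mod int p)}" for y
    unfolding D_term_def A_def by (intro arg_cong2[where f = infsum] refl)
      (auto simp: inner_int_update[OF s] cong_0_iff)
  then have "(\<Sum>y\<in>good_set \<alpha> \<gamma> \<tau> s z p. D_term s z p q y) \<le> infsum W A + real p * infsum W {h \<in> A. int p dvd h s}"
    using sum_good_set_le[OF s p A, where z = z and a = "\<lambda>h. inner_int (s - 1) h z"] by simp
  also have "infsum W A \<le> bound s q lam"
  proof -
    obtain y where y: "y \<in> good_set \<alpha> \<gamma> \<tau> s z q" using good_set_nonempty[OF s q(1), of z] by blast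
    have "infsum W A \<le> theta \<alpha> \<gamma> s z q y"
      unfolding theta_eq[OF s] A_def
      by (intro infsum_W_mono[of _ _ s]) (auto simp: cong_0_iff)
    also have "\<dots> \<le> bound s q lam" using y lam by (rule good_set_theta_le)
    finally show ?thesis .
  qed
  also have "infsum W {h \<in> A. int p dvd h s} \<le> infsum W {h \<in> int_vecs s. h s \<noteq> 0 \<and> int (p * q) dvd h s}"
  proof (rule infsum_W_mono[of _ _ s])
    have "coprime (int p) (int q)" using p q by (simp add: primes_coprime)
    then show "{h \<in> A. int p dvd h s} \<subseteq> {h \<in> int_vecs s. h s \<noteq> 0 \<and> int (p * q) dvd h s}"
      by (auto simp: A_def divides_mult)
  qed auto
  also have "\<dots> = real (p * q) powr (- (\<alpha> * 2)) * infsum W {h \<in> int_vecs s. h s \<noteq> 0}"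
    unfolding W_def using prime_gt_0_nat[OF p] prime_gt_0_nat[OF q(1)] by (intro infsum_r_weight_dvd s) auto
  also have "\<dots> \<le> real (p * q) powr (- (2 * lam)) * M s lam powr (2 * lam)"
  proof (rule mult_mono)
    have "1 \<le> p * q" using prime_gt_0_nat[OF p] prime_gt_0_nat[OF q(1)] by simp
    then have "1 \<le> real (p * q)" by linarith
    then show "real (p * q) powr (- (\<alpha> * 2)) \<le> real (p * q) powr (- (2 * lam))"
      using lam by (intro powr_mono) auto
    show "infsum W {h \<in> int_vecs s. h s \<noteq> 0} \<le> M s lam powr (2 * lam)"
      unfolding M_def by (rule infsum_W_le[OF lam, of _ s]) auto
  qed (auto intro: infsum_nonneg)
  finally show ?thesis by (simp add: mult_left_mono)
qed

lemma bound_primes_in_le: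
  assumes lam: "1/2 \<le> lam" "lam < \<alpha>" and s: "s \<ge> 1" and p: "p \<in> primes_in n"
  shows "bound s p lam \<le> (4 / ((1 - \<tau>) * real n)) powr (2 * lam) * M s lam powr (2 * lam)"
proof -
  have p': "real n \<le> 2 * real p" "real p > 0" using p n by (auto simp: primes_in_def)
  have "2 / ((1 - \<tau>) * real p) \<le> 4 / ((1 - \<tau>) * real n)"
  proof -
    have "1 / real p \<le> 2 / real n" using p' n by (simp add: field_simps)
    then have "2 / (1 - \<tau>) * (1 / real p) \<le> 2 / (1 - \<tau>) * (2 / real n)"
      using tau by (intro mult_left_mono) auto
    then show ?thesis by simp
  qed
  then have "2 / ((1 - \<tau>) * real p) * M s lam \<le> 4 / ((1 - \<tau>) * real n) * M s lam"
    using M_pos[OF lam s] by (intro mult_right_mono) auto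
  then have "bound s p lam \<le> (4 / ((1 - \<tau>) * real n) * M s lam) powr (2 * lam)"
    unfolding bound_def using M_pos[OF lam s] lam tau p' by (intro powr_mono2) auto
  also have "\<dots> = (4 / ((1 - \<tau>) * real n)) powr (2 * lam) * M s lam powr (2 * lam)"
    using M_pos[OF lam s] tau n by (intro powr_mult)
  finally show ?thesis .
qed

text \<open>The 1 stands for the diagonal term. In the next fraction the 4 combines the weight 2 of
  the cross terms with 1/p \<le> 2/n. The last summand collects the frequencies whose last component
  is divisible by p q \<ge> n^2 / 4.\<close>

definition T_const :: "real \<Rightarrow> real" where
  "T_const lam = (4 / ((1 - \<tau>) * real n)) powr (2 * lam) * (1 + 4 * real (card (primes_in n)) / (\<tau> * real n))
     + 2 * real (card (primes_in n)) / \<tau> * (4 / (real n)\<^sup>2) powr (2 * lam)"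

lemma T_criterion_min_le:
  assumes lam: "1/2 \<le> lam" "lam < \<alpha>" and s: "s \<ge> 1" and p: "p \<in> primes_in n"
    and zs: "\<And>q. q \<in> primes_in n \<Longrightarrow> q < p \<Longrightarrow> zs q \<in> good_set \<alpha> \<gamma> \<tau> s z q"
    and min: "is_arg_min (T_criterion \<alpha> \<gamma> n s z p zs) (\<lambda>y. y \<in> good_set \<alpha> \<gamma> \<tau> s z p) y0"
  shows "T_criterion \<alpha> \<gamma> n s z p zs y0 \<le> T_const lam * M s lam powr (2 * lam)"
proof -
  let ?G = "good_set \<alpha> \<gamma> \<tau> s z p" and ?P = "primes_in n"
  let ?T = "T_criterion \<alpha> \<gamma> n s z p zs"
  define m where "m = M s lam powr (2 * lam)"
  define K where "K = (4 / ((1 - \<tau>) * real n)) powr (2 * lam)"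
  define L where "L = (4 / (real n)\<^sup>2) powr (2 * lam)"
  have prime: "prime q" if "q \<in> ?P" for q using that by (simp add: primes_in_def)
  have big: "real n \<le> 2 * real q" "real q > 0" if "q \<in> ?P" for q using that n by (auto simp: primes_in_def)
  have n0: "real n > 0" using n by simp
  have nonneg: "m \<ge> 0" "K \<ge> 0" "L \<ge> 0" by (simp_all add: m_def K_def L_def)
  have bound: "bound s q lam \<le> K * m" if "q \<in> ?P" for q
    unfolding K_def m_def using lam s that by (rule bound_primes_in_le)
  have card: "real (card ?G) \<ge> \<tau> * real p" "real (card ?G) > 0"
    using card_good_set_ge[OF s prime[OF p], of z] good_set_nonempty[OF s prime[OF p], of z]
    by (simp_all add: card_gt_0_iff good_set_finite)
  have L: "real (p * q) powr (- (2 * lam)) \<le> L" if "q \<in> ?P" for q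
  proof -
    have "(real n)\<^sup>2 \<le> (2 * real p) * (2 * real q)"
      unfolding power2_eq_square using big[OF p] big[OF that] n0 by (intro mult_mono) auto
    then have "inverse (real (p * q)) \<le> 4 / (real n)\<^sup>2"
      using big[OF p] big[OF that] n0 by (simp add: field_simps)
    then have "inverse (real (p * q)) powr (2 * lam) \<le> L"
      unfolding L_def using lam by (intro powr_mono2) auto
    then show ?thesis by (simp only: powr_minus inverse_powr of_nat_0_le_iff)
  qed
  \<comment> \<open>The nonnegative second summand is added so that cross terms with smaller and
    with larger q share one bound and only the number of primes matters.\<close>
  have A: "(\<Sum>y\<in>?G. A_term s z p zs q y) \<le> K * m + real p * (L * m)" if q: "q \<in> ?P" "q < p" for q
  proof -
    have "(\<Sum>y\<in>?G. A_term s z p zs q y) \<le> bound s q lam"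
      by (rule sum_A_term_le[OF lam s prime[OF p]]) (rule zs[OF q])
    moreover have "0 \<le> real p * (L * m)" using nonneg by simp
    ultimately show ?thesis using bound[OF q(1)] by linarith
  qed
  have D: "(\<Sum>y\<in>?G. D_term s z p q y) \<le> K * m + real p * (L * m)" if q: "q \<in> ?P" "p < q" for q
  proof -
    have "(\<Sum>y\<in>?G. D_term s z p q y) \<le>
        bound s q lam + real p * (real (p * q) powr (- (2 * lam)) * M s lam powr (2 * lam))"
      using q by (intro sum_D_term_le[OF lam s prime[OF p] prime[OF q(1)]]) auto
    also have "\<dots> \<le> K * m + real p * (L * m)"
      unfolding m_def[symmetric] using bound[OF q(1)] L[OF q(1)] nonneg
      by (intro add_mono mult_left_mono mult_right_mono) auto
    finally show ?thesis .
  qed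
  have \<theta>: "theta \<alpha> \<gamma> s z p y \<le> K * m" if "y \<in> ?G" for y
    using good_set_theta_le[OF that lam] bound[OF p] by linarith
  have "real (card ?G) * ?T y0 \<le> (\<Sum>y\<in>?G. ?T y)"
    using sum_mono[of ?G "\<lambda>_. ?T y0" ?T] min by (auto simp: is_arg_min_linorder)
  also have "\<dots> = (\<Sum>y\<in>?G. theta \<alpha> \<gamma> s z p y)
      + 2 * (\<Sum>q\<in>{q \<in> ?P. q < p}. \<Sum>y\<in>?G. A_term s z p zs q y)
      + 2 * (\<Sum>q\<in>{q \<in> ?P. p < q}. \<Sum>y\<in>?G. D_term s z p q y)"
    unfolding T_criterion_eq sum.distrib sum_distrib_left[symmetric]
    by (subst (1 2) sum.swap) simp
  also have "\<dots> \<le> (\<Sum>y\<in>?G. K * m)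
      + 2 * (\<Sum>q\<in>{q \<in> ?P. q < p}. K * m + real p * (L * m))
      + 2 * (\<Sum>q\<in>{q \<in> ?P. p < q}. K * m + real p * (L * m))"
    using A D \<theta> by (intro add_mono mult_left_mono sum_mono) auto
  also have "\<dots> = real (card ?G) * (K * m)
      + 2 * real (card {q \<in> ?P. q < p} + card {q \<in> ?P. p < q}) * (K * m + real p * (L * m))"
    by (simp add: algebra_simps)
  also have "\<dots> \<le> real (card ?G) * (K * m) + 2 * real (card ?P) * (K * m + real p * (L * m))"
  proof -
    have fin: "finite ?P" by simp
    have "card {q \<in> ?P. q < p} + card {q \<in> ?P. p < q} = card ({q \<in> ?P. q < p} \<union> {q \<in> ?P. p < q})"
      using fin by (intro card_Un_disjoint[symmetric]) auto
    also have "\<dots> \<le> card ?P" using fin by (intro card_mono) auto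
    finally show ?thesis using nonneg by (intro add_left_mono mult_right_mono) auto
  qed
  finally have "?T y0 \<le> K * m + 2 * real (card ?P) * (K * m + real p * (L * m)) / real (card ?G)"
    using card(2) by (simp add: field_simps)
  also have "\<dots> \<le> K * m + 2 * real (card ?P) * (K * m + real p * (L * m)) / (\<tau> * real p)"
    using card nonneg tau big(2)[OF p]
    by (intro add_left_mono divide_left_mono mult_nonneg_nonneg add_nonneg_nonneg mult_pos_pos) auto
  also have "\<dots> = K * m + 2 * real (card ?P) / \<tau> * (K * m / real p + L * m)"
    using tau big(2)[OF p] by (simp add: field_simps)
  also have "\<dots> \<le> K * m + 2 * real (card ?P) / \<tau> * (K * m * (2 / real n) + L * m)"
  proof -
    have "1 / real p \<le> 2 / real n" using big[OF p] n0 by (simp add: field_simps)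
    then have "K * m * (1 / real p) \<le> K * m * (2 / real n)"
      using nonneg by (intro mult_left_mono) auto
    then show ?thesis using tau by (intro add_left_mono mult_left_mono add_right_mono) auto
  qed
  also have "\<dots> = T_const lam * m"
    unfolding T_const_def K_def[symmetric] L_def[symmetric] using tau n0 by (simp add: field_simps)
  finally show ?thesis by (simp add: m_def)
qed

end

section \<open>Existence of the construction\<close>

lemma inner_int_eqI:
  assumes "\<And>j. j \<in> {1..s} \<Longrightarrow> z j = z' j"
  shows "inner_int s h z = inner_int s h z'"
  unfolding inner_int_def using assms by (intro sum.cong) auto

text \<open>The search reads only earlier components; this locality is what permits the recursion
  over s.\<close>

lemma criterion_cong:
  assumes "s \<ge> 1" "\<And>j. j < s \<Longrightarrow> z j = z' j"
  shows "good_set \<alpha> \<gamma> \<tau> s z p = good_set \<alpha> \<gamma> \<tau> s z' p"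
    and "T_criterion \<alpha> \<gamma> n s z p zs = T_criterion \<alpha> \<gamma> n s z' p zs"
proof -
  have 1: "inner_int s h (z(s := y)) = inner_int s h (z'(s := y))" for h y
    using assms(2) by (intro inner_int_eqI) auto
  have 2: "inner_int (s - 1) h z = inner_int (s - 1) h z'" for h
    using assms by (intro inner_int_eqI) auto
  show "good_set \<alpha> \<gamma> \<tau> s z p = good_set \<alpha> \<gamma> \<tau> s z' p"
    unfolding good_set_def theta_def 1 ..
  show "T_criterion \<alpha> \<gamma> n s z p zs = T_criterion \<alpha> \<gamma> n s z' p zs"
    unfolding T_criterion_def[abs_def] theta_def 1 2 ..
qed

lemma T_criterion_cong:
  assumes "\<And>q. q < p \<Longrightarrow> zs q = zs' q"
  shows "T_criterion \<alpha> \<gamma> n s z p zs = T_criterion \<alpha> \<gamma> n s z p zs'"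
  unfolding T_criterion_def
  by (intro ext arg_cong2[where f = "(+)"] arg_cong2[where f = "(*)"] sum.cong refl) (simp add: assms)

context weighted_korobov
begin

text \<open>\<open>zs\<close> occurs inside the criterion that defines its own values. This is
  legitimate because the criterion at p reads only values at q < p, so well-founded dependent choice
  applies; minimisers exist as the good set is finite and nonempty.\<close>

lemma ex_component:
  assumes s: "s \<ge> 1"
  shows "\<exists>zs. \<forall>p\<in>primes_in n. is_arg_min (T_criterion \<alpha> \<gamma> n s z p zs)
           (\<lambda>y. y \<in> good_set \<alpha> \<gamma> \<tau> s z p) (zs p)"
proof -
  have "\<exists>zs. \<forall>p. p \<in> primes_in n \<longrightarrow> is_arg_min (T_criterion \<alpha> \<gamma> n s z p zs)
           (\<lambda>y. y \<in> good_set \<alpha> \<gamma> \<tau> s z p) (zs p)"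
  proof (rule dependent_wf_choice[OF wf_less_than])
    fix zs zs' :: "nat \<Rightarrow> int" and p r
    assume "\<And>q. (q, p) \<in> less_than \<Longrightarrow> zs q = zs' q"
    then have "T_criterion \<alpha> \<gamma> n s z p zs = T_criterion \<alpha> \<gamma> n s z p zs'"
      by (intro T_criterion_cong) auto
    then show "(p \<in> primes_in n \<longrightarrow> is_arg_min (T_criterion \<alpha> \<gamma> n s z p zs) (\<lambda>y. y \<in> good_set \<alpha> \<gamma> \<tau> s z p) r) =
        (p \<in> primes_in n \<longrightarrow> is_arg_min (T_criterion \<alpha> \<gamma> n s z p zs') (\<lambda>y. y \<in> good_set \<alpha> \<gamma> \<tau> s z p) r)"
      by simp
  next
    fix p and zs :: "nat \<Rightarrow> int"
    show "\<exists>r. p \<in> primes_in n \<longrightarrow> is_arg_min (T_criterion \<alpha> \<gamma> n s z p zs) (\<lambda>y. y \<in> good_set \<alpha> \<gamma> \<tau> s z p) r"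
      using ex_is_arg_min_if_finite[OF good_set_finite good_set_nonempty[OF s]]
      by (cases "p \<in> primes_in n") (auto simp: primes_in_def)
  qed
  then show ?thesis by blast
qed

lemma ex_chinese_remainder:
  assumes "\<And>p. p \<in> primes_in n \<Longrightarrow> zs p \<ge> 0"
  shows "\<exists>x. x \<in> {0..<int (\<Prod>(primes_in n))} \<and> (\<forall>p\<in>primes_in n. [x = zs p] (mod int p))"
proof -
  have "\<exists>x. \<forall>p\<in>primes_in n. [x = nat (zs p)] (mod p)"
    by (rule chinese_remainder_nat) (auto simp: primes_in_def primes_coprime intro: finite_primes_in[unfolded primes_in_def])
  then obtain x where x: "\<And>p. p \<in> primes_in n \<Longrightarrow> [x = nat (zs p)] (mod p)" by blast
  let ?N = "\<Prod>(primes_in n)"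
  have "?N > 0" by (intro prod_pos) (auto simp: primes_in_def prime_gt_0_nat)
  moreover have "[int (x mod ?N) = zs p] (mod int p)" if p: "p \<in> primes_in n" for p
  proof -
    have "p dvd ?N" using p by (intro dvd_prodI) auto
    then have "[x mod ?N = x] (mod p)" by (simp add: cong_def mod_mod_cancel)
    then have "[x mod ?N = nat (zs p)] (mod p)" using x[OF p] by (rule cong_trans)
    then show ?thesis using assms[OF p] by (metis cong_int_iff int_nat_eq)
  qed
  ultimately show ?thesis by (intro exI[of _ "int (x mod ?N)"]) (auto simp del: of_nat_prod simp flip: of_nat_mod)
qed

lemma ex_cbc_construction: "\<exists>zp z. cbc_construction \<alpha> \<gamma> \<tau> d n zp z"
proof -
  \<comment> \<open>The recursion carries pairs: the residues for all primes, and the component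
    assembled from them. The guard leaves the value free outside {1..d}, since dependent choice
    assigns one to every natural number.\<close>
  define Q where "Q F s r \<longleftrightarrow> (s \<in> {1..d} \<longrightarrow>
      (\<forall>p\<in>primes_in n. is_arg_min (T_criterion \<alpha> \<gamma> n s (\<lambda>j. snd (F j)) p (fst r))
         (\<lambda>y. y \<in> good_set \<alpha> \<gamma> \<tau> s (\<lambda>j. snd (F j)) p) (fst r p)) \<and>
      snd r \<in> {0..<int (\<Prod>(primes_in n))} \<and> (\<forall>p\<in>primes_in n. [snd r = fst r p] (mod int p)))"
    for F :: "nat \<Rightarrow> (nat \<Rightarrow> int) \<times> int" and s and r :: "(nat \<Rightarrow> int) \<times> int"
  have "\<exists>F. \<forall>s. Q F s (F s)"
  proof (rule dependent_wf_choice[OF wf_less_than])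
    fix F G :: "nat \<Rightarrow> (nat \<Rightarrow> int) \<times> int" and s and r :: "(nat \<Rightarrow> int) \<times> int"
    assume eq: "\<And>t. (t, s) \<in> less_than \<Longrightarrow> F t = G t"
    show "Q F s r = Q G s r"
    proof (cases "s \<ge> 1")
      case True
      have "snd (F j) = snd (G j)" if "j < s" for j using eq[of j] that by simp
      note criterion_cong[OF True this]
      then show ?thesis unfolding Q_def by simp
    qed (simp add: Q_def)
  next
    fix s and F :: "nat \<Rightarrow> (nat \<Rightarrow> int) \<times> int"
    show "\<exists>r. Q F s r"
    proof (cases "s \<ge> 1")
      case True
      obtain zs where zs: "\<forall>p\<in>primes_in n. is_arg_min (T_criterion \<alpha> \<gamma> n s (\<lambda>j. snd (F j)) p zs)
           (\<lambda>y. y \<in> good_set \<alpha> \<gamma> \<tau> s (\<lambda>j. snd (F j)) p) (zs p)"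
        using ex_component[OF True] by blast
      then have "zs p \<ge> 0" if "p \<in> primes_in n" for p
        using that by (auto simp: is_arg_min_def good_set_def)
      from ex_chinese_remainder[of zs, OF this] obtain x where
        "x \<in> {0..<int (\<Prod>(primes_in n))}" "\<forall>p\<in>primes_in n. [x = zs p] (mod int p)" by blast
      with zs have "Q F s (zs, x)" by (simp add: Q_def)
      then show ?thesis ..
    qed (simp add: Q_def)
  qed
  then obtain F where "\<And>s. Q F s (F s)" by blast
  then have "cbc_construction \<alpha> \<gamma> \<tau> d n (\<lambda>s. fst (F s)) (\<lambda>s. snd (F s))"
    unfolding cbc_construction_def Q_def by blast
  then show ?thesis by blast
qed

section \<open>Summing the minimised criteria over primes and components\<close>

definition E_term where
  "E_term s z p q = infsum W {h \<in> int_vecs s. h s \<noteq> 0 \<and>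
      (int p dvd inner_int s h z \<and> int q dvd inner_int s h z)}"

lemma E_term_commute: "E_term s z p q = E_term s z q p"
  unfolding E_term_def by (simp add: conj_commute)

lemma sum_T_criterion:
  assumes s: "s \<ge> 1" and zs: "\<And>p. p \<in> primes_in n \<Longrightarrow> [z s = zs p] (mod int p)"
  shows "(\<Sum>p\<in>primes_in n. T_criterion \<alpha> \<gamma> n s z p zs (zs p)) =
           (\<Sum>p\<in>primes_in n. \<Sum>q\<in>primes_in n. E_term s z p q)"
proof -
  let ?P = "primes_in n"
  have inner: "int p dvd inner_int s h z \<longleftrightarrow> [inner_int s h (z(s := zs p)) = 0] (mod int p)"
    if "p \<in> ?P" for p h
  proof -
    have "[inner_int s h z = inner_int s h (z(s := zs p))] (mod int p)"
      using zs[OF that] by (intro inner_int_cong) auto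
    then show ?thesis by (simp add: cong_0_iff cong_dvd_iff)
  qed
  have inner': "int p dvd inner_int s h z \<longleftrightarrow> [inner_int (s - 1) h z = 0] (mod int p)"
    if "int p dvd h s" for p h
  proof -
    have "inner_int s h z = inner_int (s - 1) h z + h s * z s"
      using inner_int_update[OF s, of h z "z s"] by simp
    then show ?thesis using that by (simp add: cong_0_iff dvd_add_left_iff)
  qed
  have diag: "E_term s z p p = theta \<alpha> \<gamma> s z p (zs p)" if "p \<in> ?P" for p
    unfolding E_term_def theta_def W_def[abs_def] by (simp add: inner[OF that])
  \<comment> \<open>The common frequencies of p and q are split by whether p divides the last
    component. Below, p is the larger prime: the \<open>A_term\<close> belongs to its own step, the
    \<open>D_term\<close> to the earlier step of q.\<close>
  have off: "E_term s z p q = A_term s z p zs q (zs p) + D_term s z q p (zs q)"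
    if p: "p \<in> ?P" and q: "q \<in> ?P" for p q
  proof -
    let ?A = "{h \<in> int_vecs s. h s \<noteq> 0 \<and> \<not> [h s = 0] (mod int p) \<and>
      [inner_int s h (z(s := zs p)) = 0] (mod int p) \<and> [inner_int s h (z(s := zs q)) = 0] (mod int q)}"
    let ?D = "{h \<in> int_vecs s. h s \<noteq> 0 \<and> [h s = 0] (mod int p) \<and>
      [inner_int s h (z(s := zs q)) = 0] (mod int q) \<and> [inner_int (s - 1) h z = 0] (mod int p)}"
    have "infsum W (?A \<union> ?D) = infsum W ?A + infsum W ?D"
      by (rule infsum_Un_disjoint) (auto intro: summable_W[of _ s])
    moreover have "{h \<in> int_vecs s. h s \<noteq> 0 \<and> (int p dvd inner_int s h z \<and> int q dvd inner_int s h z)} = ?A \<union> ?D"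
    proof (rule set_eqI)
      fix h
      show "h \<in> {h \<in> int_vecs s. h s \<noteq> 0 \<and> (int p dvd inner_int s h z \<and> int q dvd inner_int s h z)} \<longleftrightarrow> h \<in> ?A \<union> ?D"
      proof (cases "int p dvd h s")
        case True
        then show ?thesis using inner'[of p h, OF True] inner[OF q, of h] by (auto simp: cong_0_iff[of "h s"])
      next
        case False
        then show ?thesis using inner[OF p, of h] inner[OF q, of h] by (auto simp: cong_0_iff[of "h s"])
      qed
    qed
    ultimately show ?thesis unfolding E_term_def A_term_def D_term_def by simp
  qed
  have swap: "(\<Sum>p\<in>?P. \<Sum>q\<in>{q \<in> ?P. p < q}. f p q) = (\<Sum>p\<in>?P. \<Sum>q\<in>{q \<in> ?P. q < p}. f q p)"
    for f :: "nat \<Rightarrow> nat \<Rightarrow> real"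
    by (rule sum.swap_restrict) simp_all
  have "(\<Sum>q\<in>?P. E_term s z p q) = E_term s z p p + (\<Sum>q\<in>{q \<in> ?P. q < p}. E_term s z p q) +
      (\<Sum>q\<in>{q \<in> ?P. p < q}. E_term s z p q)" if "p \<in> ?P" for p
  proof -
    have "?P = {p} \<union> ({q \<in> ?P. q < p} \<union> {q \<in> ?P. p < q})" using that by auto
    then have "(\<Sum>q\<in>?P. E_term s z p q) = (\<Sum>q\<in>{p} \<union> ({q \<in> ?P. q < p} \<union> {q \<in> ?P. p < q}). E_term s z p q)"
      by simp
    also have "\<dots> = E_term s z p p + (\<Sum>q\<in>{q \<in> ?P. q < p} \<union> {q \<in> ?P. p < q}. E_term s z p q)"
      by (subst sum.union_disjoint) auto
    also have "(\<Sum>q\<in>{q \<in> ?P. q < p} \<union> {q \<in> ?P. p < q}. E_term s z p q) =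
        (\<Sum>q\<in>{q \<in> ?P. q < p}. E_term s z p q) + (\<Sum>q\<in>{q \<in> ?P. p < q}. E_term s z p q)"
      by (rule sum.union_disjoint) auto
    finally show ?thesis by simp
  qed
  then have "(\<Sum>p\<in>?P. \<Sum>q\<in>?P. E_term s z p q) = (\<Sum>p\<in>?P. E_term s z p p) +
      (\<Sum>p\<in>?P. \<Sum>q\<in>{q \<in> ?P. q < p}. E_term s z p q) + (\<Sum>p\<in>?P. \<Sum>q\<in>{q \<in> ?P. p < q}. E_term s z p q)"
    by (simp add: sum.distrib)
  also have "(\<Sum>p\<in>?P. \<Sum>q\<in>{q \<in> ?P. p < q}. E_term s z p q) = (\<Sum>p\<in>?P. \<Sum>q\<in>{q \<in> ?P. q < p}. E_term s z p q)"
    by (subst swap) (simp add: E_term_commute)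
  also have "(\<Sum>p\<in>?P. \<Sum>q\<in>{q \<in> ?P. q < p}. E_term s z p q) =
      (\<Sum>p\<in>?P. \<Sum>q\<in>{q \<in> ?P. q < p}. A_term s z p zs q (zs p)) +
      (\<Sum>p\<in>?P. \<Sum>q\<in>{q \<in> ?P. q < p}. D_term s z q p (zs q))"
    unfolding sum.distrib[symmetric] by (intro sum.cong refl off) auto
  \<comment> \<open>Relabelling charges each \<open>D_term\<close> to the smaller prime of its pair,
    as in the last sum of the criterion.\<close>
  also have "(\<Sum>p\<in>?P. \<Sum>q\<in>{q \<in> ?P. q < p}. D_term s z q p (zs q)) =
      (\<Sum>p\<in>?P. \<Sum>q\<in>{q \<in> ?P. p < q}. D_term s z p q (zs p))"
    by (rule swap[symmetric])
  finally show ?thesis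
    unfolding T_criterion_eq using diag by (simp add: sum.distrib sum_distrib_left algebra_simps)
qed

lemma mu_eq_sum_M:
  assumes "1/2 \<le> lam" "lam < \<alpha>"
  shows "mu d \<alpha> \<gamma> lam = (\<Sum>s=1..d. M s lam)"
  using infsum_last_nonzero[OF summable_lam[OF assms subset_refl], of d "\<lambda>_. True"]
  by (simp add: mu_def M_def set_diff_eq)

lemma sum_dual_pair_sum_le:
  assumes lam: "1/2 \<le> lam" "lam < \<alpha>" and cbc: "cbc_construction \<alpha> \<gamma> \<tau> d n zp z"
  shows "(\<Sum>p\<in>primes_in n. \<Sum>q\<in>primes_in n. dual_pair_sum d \<alpha> \<gamma> z p q)
           \<le> real (card (primes_in n)) * T_const lam * mu d \<alpha> \<gamma> lam powr (2 * lam)"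
proof -
  let ?P = "primes_in n"
  have T_const: "T_const lam \<ge> 0"
    unfolding T_const_def using tau by (intro add_nonneg_nonneg mult_nonneg_nonneg divide_nonneg_nonneg) auto
  have "dual_pair_sum d \<alpha> \<gamma> z p q = (\<Sum>s=1..d. E_term s z p q)" for p q
  proof -
    have "dual_pair_sum d \<alpha> \<gamma> z p q = (\<Sum>s=1..d. infsum W {h \<in> int_vecs s. h s \<noteq> 0 \<and>
        (int p dvd inner_int d h z \<and> int q dvd inner_int d h z)})"
      unfolding dual_pair_sum_def W_def[symmetric]
      by (rule infsum_last_nonzero[OF summable_W[OF subset_refl]])
    also have "\<dots> = (\<Sum>s=1..d. E_term s z p q)"
    proof (rule sum.cong[OF refl])
      fix s assume "s \<in> {1..d}"
      then have "inner_int d h z = inner_int s h z" if "h \<in> int_vecs s" for h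
        using that by (intro inner_int_extend) auto
      then show "infsum W {h \<in> int_vecs s. h s \<noteq> 0 \<and>
          (int p dvd inner_int d h z \<and> int q dvd inner_int d h z)} = E_term s z p q"
        unfolding E_term_def by (intro arg_cong2[where f = infsum] refl Collect_cong) auto
    qed
    finally show ?thesis .
  qed
  then have "(\<Sum>p\<in>?P. \<Sum>q\<in>?P. dual_pair_sum d \<alpha> \<gamma> z p q) =
      (\<Sum>p\<in>?P. \<Sum>q\<in>?P. \<Sum>s=1..d. E_term s z p q)" by simp
  also have "\<dots> = (\<Sum>s=1..d. \<Sum>p\<in>?P. \<Sum>q\<in>?P. E_term s z p q)"
    by (subst (2) sum.swap, subst sum.swap) (rule refl)
  also have "\<dots> \<le> (\<Sum>s=1..d. real (card ?P) * (T_const lam * M s lam powr (2 * lam)))"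
  proof (rule sum_mono)
    fix s assume s: "s \<in> {1..d}"
    have min: "is_arg_min (T_criterion \<alpha> \<gamma> n s z p (zp s)) (\<lambda>y. y \<in> good_set \<alpha> \<gamma> \<tau> s z p) (zp s p)"
      and z: "[z s = zp s p] (mod int p)" if "p \<in> ?P" for p
      using cbc s that by (auto simp: cbc_construction_def)
    have "(\<Sum>p\<in>?P. \<Sum>q\<in>?P. E_term s z p q) = (\<Sum>p\<in>?P. T_criterion \<alpha> \<gamma> n s z p (zp s) (zp s p))"
      using s z by (intro sum_T_criterion[symmetric]) auto
    also have "\<dots> \<le> (\<Sum>p\<in>?P. T_const lam * M s lam powr (2 * lam))"
      using s min by (intro sum_mono T_criterion_min_le[OF lam]) (auto simp: is_arg_min_def)
    finally show "(\<Sum>p\<in>?P. \<Sum>q\<in>?P. E_term s z p q) \<le> real (card ?P) * (T_const lam * M s lam powr (2 * lam))"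
      by simp
  qed
  also have "\<dots> = real (card ?P) * T_const lam * (\<Sum>s=1..d. M s lam powr (2 * lam))"
    by (simp add: sum_distrib_left mult.assoc)
  also have "\<dots> \<le> real (card ?P) * T_const lam * mu d \<alpha> \<gamma> lam powr (2 * lam)"
  proof (rule mult_left_mono)
    \<comment> \<open>Jensen again: as 2 lam \<ge> 1, passing to the power of the sum loses no
      factor depending on d.\<close>
    have "(\<Sum>s=1..d. M s lam powr (2 * lam)) \<le> (\<Sum>s=1..d. M s lam) powr (2 * lam)"
      using infsum_powr_le(2)[of "{1..d}" "\<lambda>s. M s lam" "2 * lam"] lam M_pos[OF lam, THEN less_imp_le]
      by simp
    then show "(\<Sum>s=1..d. M s lam powr (2 * lam)) \<le> mu d \<alpha> \<gamma> lam powr (2 * lam)"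
      by (simp add: mu_eq_sum_M[OF lam])
  qed (use T_const in simp)
  finally show ?thesis .
qed

end

section \<open>The error bound\<close>

text \<open>\<open>c\<close> is the constant in the lower bound for the number of primes; 1/c stems
  from the diagonal terms. The fractions over \<open>ln 2\<close> stem from the cross terms, for
  which ln n \<ge> ln 2 suffices.\<close>

definition error_const :: "real \<Rightarrow> real \<Rightarrow> real \<Rightarrow> real" where
  "error_const c \<tau> lam = (4 / (1 - \<tau>)) powr (2 * lam) * (1 / c + 4 / (\<tau> * ln 2))
     + 2 * 4 powr (2 * lam) / (\<tau> * ln 2)"

lemma error_const_pos:
  assumes "c > 0" "0 < \<tau>" "\<tau> < 1"
  shows "error_const c \<tau> lam > 0"
  unfolding error_const_def using assms
  by (intro add_pos_pos mult_pos_pos divide_pos_pos) auto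

lemma filterlim_error_const_at_0:
  assumes "c > 0"
  shows "filterlim (\<lambda>\<tau>. error_const c \<tau> lam) at_top (at_right 0)"
proof (rule filterlim_at_top_mono)
  have "4 powr (2 * lam) / ln 2 > (0 :: real)" by simp
  then show "filterlim (\<lambda>\<tau>. 2 * (4 powr (2 * lam) / ln 2) / \<tau>) at_top (at_right 0)"
    by real_asymp
  have "eventually (\<lambda>\<tau>::real. \<tau> \<in> {0<..<1}) (at_right 0)"
    by (rule eventually_at_right_real) simp
  then show "\<forall>\<^sub>F \<tau> in at_right 0. 2 * (4 powr (2 * lam) / ln 2) / \<tau> \<le> error_const c \<tau> lam"
  proof eventually_elim
    case (elim \<tau>)
    then have "0 \<le> (4 / (1 - \<tau>)) powr (2 * lam) * (1 / c + 4 / (\<tau> * ln 2))"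
      using assms by (intro mult_nonneg_nonneg add_nonneg_nonneg) auto
    then show ?case by (simp add: error_const_def mult_ac)
  qed
qed

text \<open>For lam \<ge> 1/2 the exponent is at least 1, so the first power is at least 4 / (1 -
  \<tau>), which already diverges.\<close>

lemma filterlim_error_const_at_1:
  assumes "c > 0" "lam \<ge> 1/2"
  shows "filterlim (\<lambda>\<tau>. error_const c \<tau> lam) at_top (at_left 1)"
proof (rule filterlim_at_top_mono)
  show "filterlim (\<lambda>\<tau>. 4 / (1 - \<tau>) * (1 / c)) at_top (at_left 1)"
    using assms(1) by real_asymp
  have "eventually (\<lambda>\<tau>::real. \<tau> \<in> {0<..<1}) (at_left 1)"
    by (rule eventually_at_left_real) simp
  then show "\<forall>\<^sub>F \<tau> in at_left 1. 4 / (1 - \<tau>) * (1 / c) \<le> error_const c \<tau> lam"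
  proof eventually_elim
    case (elim \<tau>)
    then have "(4 / (1 - \<tau>)) powr 1 \<le> (4 / (1 - \<tau>)) powr (2 * lam)"
      using assms(2) by (intro powr_mono) (auto simp: field_simps)
    then have "4 / (1 - \<tau>) \<le> (4 / (1 - \<tau>)) powr (2 * lam)" using elim by simp
    then have "4 / (1 - \<tau>) * (1 / c) \<le> (4 / (1 - \<tau>)) powr (2 * lam) * (1 / c + 4 / (\<tau> * ln 2))"
      using elim assms(1) by (intro mult_mono) auto
    moreover have "0 \<le> 2 * 4 powr (2 * lam) / (\<tau> * ln 2)" using elim by simp
    ultimately show ?case unfolding error_const_def by linarith
  qed
qed

lemma (in weighted_korobov) T_const_le:
  assumes lam: "lam \<ge> 1/2" and c: "c > 0" "c * real n \<le> real (card (primes_in n)) * ln (real n)"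
  shows "T_const lam \<le> real (card (primes_in n)) * (error_const c \<tau> lam * ln (real n) / real n powr (2 * lam + 1))"
proof -
  define P where "P = real (card (primes_in n))"
  define l where "l = ln (real n)"
  define k where "k = (4 / (1 - \<tau>)) powr (2 * lam)"
  define N where "N = real n powr (- (2 * lam))"
  have n0: "real n > 0" "real n \<ge> 1" using n by auto
  define L :: real where "L = ln 2"
  have l: "l \<ge> L" "L > 0" using n by (auto simp: l_def L_def)
  have pos: "P \<ge> 0" "k \<ge> 0" "N \<ge> 0" by (simp_all add: P_def k_def N_def)
  have "(4 / ((1 - \<tau>) * real n)) powr (2 * lam) = (4 / (1 - \<tau>) * (1 / real n)) powr (2 * lam)" by simp
  also have "\<dots> = k * (1 / real n) powr (2 * lam)"
    unfolding k_def using tau n0 by (intro powr_mult)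
  also have "(1 / real n) powr (2 * lam) = N"
    using n0 by (simp add: N_def powr_minus powr_divide inverse_eq_divide)
  finally have 1: "(4 / ((1 - \<tau>) * real n)) powr (2 * lam) = k * N" .
  have "(4 / (real n)\<^sup>2) powr (2 * lam) = (4 * (1 / real n * (1 / real n))) powr (2 * lam)"
    by (simp add: power2_eq_square)
  also have "\<dots> = 4 powr (2 * lam) * ((1 / real n) powr (2 * lam) * (1 / real n) powr (2 * lam))"
    using n0 by (simp only: powr_mult)
  also have "(1 / real n) powr (2 * lam) = N"
    using n0 by (simp add: N_def powr_minus powr_divide inverse_eq_divide)
  finally have 2: "(4 / (real n)\<^sup>2) powr (2 * lam) = 4 powr (2 * lam) * (N * N)" .
  \<comment> \<open>By 2 lam \<ge> 1 the contribution of the multiples of p q, of order N^2, is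
    reduced to the common order N / n.\<close>
  have "N \<le> real n powr (- 1)"
    unfolding N_def using n0 lam by (intro powr_mono) auto
  then have "N \<le> 1 / real n" using n0 by (simp add: powr_minus inverse_eq_divide)
  then have 3: "N * N \<le> N * (1 / real n)" using pos by (intro mult_left_mono)
  \<comment> \<open>The only use of the prime count: the diagonal term lacks a factor P / n, which
    is supplied here at the price of a logarithm.\<close>
  have 4: "1 \<le> P * l / c * (1 / real n)"
    using c n0 by (simp add: P_def l_def field_simps)
  have 5: "1 \<le> l / L" using l by simp
  have "T_const lam = k * N * 1 + (4 * P / \<tau> * k * (N * (1 / real n))) * 1 + (2 * P / \<tau> * 4 powr (2 * lam) * (N * N)) * 1"
    unfolding T_const_def 1 2 P_def[symmetric] using tau n0 by (simp add: field_simps)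
  also have "\<dots> \<le> k * N * (P * l / c * (1 / real n)) + (4 * P / \<tau> * k * (N * (1 / real n))) * (l / L)
      + (2 * P / \<tau> * 4 powr (2 * lam) * (N * (1 / real n))) * (l / L)"
  proof (intro add_mono)
    show "k * N * 1 \<le> k * N * (P * l / c * (1 / real n))"
      using 4 pos by (intro mult_left_mono) simp_all
    show "4 * P / \<tau> * k * (N * (1 / real n)) * 1 \<le> 4 * P / \<tau> * k * (N * (1 / real n)) * (l / L)"
      using 5 pos tau by (intro mult_left_mono) simp_all
    have "2 * P / \<tau> * 4 powr (2 * lam) * (N * N) \<le> 2 * P / \<tau> * 4 powr (2 * lam) * (N * (1 / real n))"
      by (rule mult_left_mono[OF 3]) (use pos tau in simp)
    then show "2 * P / \<tau> * 4 powr (2 * lam) * (N * N) * 1 \<le>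
        2 * P / \<tau> * 4 powr (2 * lam) * (N * (1 / real n)) * (l / L)"
      by (rule mult_mono) (use 5 pos tau in simp_all)
  qed
  also have "\<dots> = P * (error_const c \<tau> lam * l * (N * (1 / real n)))"
    unfolding error_const_def k_def[symmetric] L_def[symmetric] using tau l(2) c(1) n0
    by (simp add: field_simps)
  also have "N * (1 / real n) = 1 / real n powr (2 * lam + 1)"
    using n0 by (simp add: N_def powr_add powr_minus field_simps)
  finally show ?thesis by (simp add: P_def l_def)
qed

lemma (in weighted_korobov) ran_error_cbc_le:
  assumes lam: "1/2 \<le> lam" "lam < \<alpha>" and d: "d \<ge> 1" and cbc: "cbc_construction \<alpha> \<gamma> \<tau> d n zp z"
    and c: "c > 0" "c * real n \<le> real (card (primes_in n)) * ln (real n)"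
  shows "ran_error d \<alpha> \<gamma> (randomised_lattice d n z)
     \<le> ennreal (sqrt (error_const c \<tau> lam * ln (real n)) / real n powr (lam + 1/2) * mu d \<alpha> \<gamma> lam powr lam)"
proof (rule ran_error_le[OF d alpha weights primes_in_nonempty[OF n] finite_primes_in])
  let ?P = "real (card (primes_in n))"
  let ?K = "sqrt (error_const c \<tau> lam * ln (real n)) / real n powr (lam + 1/2) * mu d \<alpha> \<gamma> lam powr lam"
  have C: "error_const c \<tau> lam > 0" using c tau by (intro error_const_pos)
  have l: "ln (real n) > 0" using n by simp
  have sq: "(x powr a)\<^sup>2 = x powr (2 * a)" for x a :: real
    by (simp add: power2_eq_square flip: powr_add)
  have "?K\<^sup>2 = error_const c \<tau> lam * ln (real n) / real n powr (2 * (lam + 1/2)) * mu d \<alpha> \<gamma> lam powr (2 * lam)"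
    using C l by (simp add: power_mult_distrib power_divide sq)
  also have "2 * (lam + 1/2) = 2 * lam + 1" by simp
  finally have K2: "?K\<^sup>2 = error_const c \<tau> lam * ln (real n) / real n powr (2 * lam + 1) * mu d \<alpha> \<gamma> lam powr (2 * lam)" .
  have "(\<Sum>p\<in>primes_in n. \<Sum>q\<in>primes_in n. dual_pair_sum d \<alpha> \<gamma> z p q)
      \<le> ?P * T_const lam * mu d \<alpha> \<gamma> lam powr (2 * lam)"
    by (rule sum_dual_pair_sum_le[OF lam cbc])
  also have "\<dots> \<le> ?P * (?P * (error_const c \<tau> lam * ln (real n) / real n powr (2 * lam + 1))) * mu d \<alpha> \<gamma> lam powr (2 * lam)"
    by (intro mult_right_mono mult_left_mono T_const_le[OF lam(1) c]) auto
  also have "\<dots> = (?P * ?K)\<^sup>2"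
    unfolding power_mult_distrib[of ?P] K2 by (simp add: power2_eq_square)
  finally show "(\<Sum>p\<in>primes_in n. \<Sum>q\<in>primes_in n. dual_pair_sum d \<alpha> \<gamma> z p q) \<le> (?P * ?K)\<^sup>2" .
  show "?K \<ge> 0" using C l by simp
qed

section \<open>Divergence of \<open>mu\<close> and bounds independent of the dimension\<close>

lemma sum_le_zeta:
  assumes "x > 1"
  shows "(\<Sum>k<K. 1 / real (Suc k) powr x) \<le> zeta x"
proof -
  have "summable (\<lambda>n. real n powr (- x))"
    using assms by (simp add: summable_real_powr_iff)
  then have "summable (\<lambda>k. real (Suc k) powr (- x))"
    by (subst summable_Suc_iff)
  then show ?thesis
    unfolding zeta_def powr_minus_divide by (intro sum_le_suminf) auto
qed

text \<open>The index set {1} alone forces divergence. Its zeta factor is bounded below by a partial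
  sum of fixed length, which is continuous in \<open>lam\<close> up to \<alpha>, where it becomes a
  harmonic number; the length is chosen beforehand to exceed the given bound.\<close>

lemma filterlim_mu:
  assumes d: "d \<ge> 1" and \<alpha>: "\<alpha> > 1/2" and \<gamma>: "positive_weights \<gamma>"
  shows "filterlim (mu d \<alpha> \<gamma>) at_top (at_left \<alpha>)"
  unfolding filterlim_at_top
proof
  fix B :: real
  define g where "g K lam = \<gamma> {1} powr (1 / lam) * (2 * (\<Sum>k<K. 1 / real (Suc k) powr (\<alpha> / lam)))" for K lam
  have \<gamma>1: "\<gamma> {1} > 0" using \<gamma> by (auto simp: positive_weights_def index_sets_def)
  have harm: "(\<Sum>k<K. 1 / real (Suc k)) = harm K" for K
    unfolding harm_def by (simp add: sum.atLeast1_atMost_eq inverse_eq_divide)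
  have "filterlim (\<lambda>K. \<gamma> {1} powr (1 / \<alpha>) * 2 * harm K) at_top sequentially"
    using \<gamma>1 by (intro filterlim_tendsto_pos_mult_at_top[OF tendsto_const _ harm_at_top]) auto
  then have "\<forall>\<^sub>F K in sequentially. B < \<gamma> {1} powr (1 / \<alpha>) * 2 * harm K"
    by (simp add: filterlim_at_top_dense)
  then obtain K where "B < \<gamma> {1} powr (1 / \<alpha>) * 2 * harm K"
    by (auto simp: eventually_at_top_linorder)
  then have K: "B < g K \<alpha>" using \<alpha> by (simp add: g_def harm[simplified])
  have "(g K \<longlongrightarrow> g K \<alpha>) (at_left \<alpha>)"
    unfolding g_def using \<alpha> \<gamma>1 by (intro tendsto_intros) auto
  then have "\<forall>\<^sub>F lam in at_left \<alpha>. B < g K lam"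
    using K by (rule order_tendstoD)
  moreover have "\<forall>\<^sub>F lam in at_left \<alpha>. lam \<in> {0<..<\<alpha>}"
    using \<alpha> by (intro eventually_at_left_real) auto
  ultimately show "\<forall>\<^sub>F lam in at_left \<alpha>. B \<le> mu d \<alpha> \<gamma> lam"
  proof eventually_elim
    case (elim lam)
    then have x: "\<alpha> / lam > 1" and lam: "0 < lam" "lam < \<alpha>" by auto
    let ?F = "\<lambda>u. \<gamma> u powr (1 / lam) * (2 * zeta (\<alpha> / lam)) ^ card u"
    have "g K lam \<le> ?F {1}"
      unfolding g_def using sum_le_zeta[OF x, of K] by (simp add: mult_left_mono)
    also have "\<dots> = sum ?F {{1}}" by simp
    also have "\<dots> \<le> sum ?F (Pow {1..d} - {{}})"
      using d zeta_nonneg[OF x] by (intro sum_mono2) auto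
    also have "\<dots> = mu d \<alpha> \<gamma> lam" using mu_eq_sum[OF \<gamma> lam] by simp
    finally show ?case using elim by simp
  qed
qed

lemma mu_le_infsum:
  assumes \<gamma>: "positive_weights \<gamma>" and lam: "0 < lam" "lam < \<alpha>"
    and summable: "(\<lambda>u. \<gamma> u powr (1 / lam) * (2 * zeta (\<alpha> / lam)) ^ card u) summable_on (index_sets - {{}})"
  shows "mu d \<alpha> \<gamma> lam \<le> (\<Sum>\<^sub>\<infinity>u\<in>index_sets - {{}}. \<gamma> u powr (1 / lam) * (2 * zeta (\<alpha> / lam)) ^ card u)"
proof -
  have "\<alpha> / lam > 1" using lam by simp
  then show ?thesis
    unfolding mu_eq_sum[OF \<gamma> lam]
    by (intro finite_sum_le_infsum[OF summable])
      (auto simp: index_sets_def zeta_nonneg intro: finite_subset[of _ "{1..d}"] simp del: One_nat_def)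
qed

lemma mu_nonneg: "mu d \<alpha> \<gamma> lam \<ge> 0"
  unfolding mu_def by (intro infsum_nonneg) simp

theorem theorem4p3:
  shows "\<exists>C :: real \<Rightarrow> real \<Rightarrow> real.
    (\<forall>\<tau>\<in>{0<..<1}. \<forall>lam\<ge>1/2. C \<tau> lam > 0) \<and>
    (\<forall>lam\<ge>1/2. filterlim (\<lambda>\<tau>. C \<tau> lam) at_top (at_right 0) \<and>
                filterlim (\<lambda>\<tau>. C \<tau> lam) at_top (at_left 1)) \<and>
    (\<forall>(d::nat) (\<alpha>::real) (\<gamma> :: nat set \<Rightarrow> real) (\<tau>::real) (n::nat).
       d \<ge> 1 \<and> \<alpha> > 1/2 \<and> positive_weights \<gamma> \<and> \<tau> \<in> {0<..<1} \<and> n \<ge> 2 \<longrightarrow>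
         (\<exists>zp z. cbc_construction \<alpha> \<gamma> \<tau> d n zp z) \<and>
         (\<forall>zp z. cbc_construction \<alpha> \<gamma> \<tau> d n zp z \<longrightarrow>
            (\<forall>lam\<in>{1/2..<\<alpha>}.
               ran_error d \<alpha> \<gamma> (randomised_lattice d n z)
               \<le> ennreal (sqrt (C \<tau> lam * ln (real n)) / real n powr (lam + 1/2)
                           * mu d \<alpha> \<gamma> lam powr lam)))) \<and>
    (\<forall>(d::nat) (\<alpha>::real) (\<gamma> :: nat set \<Rightarrow> real).
       d \<ge> 1 \<and> \<alpha> > 1/2 \<and> positive_weights \<gamma> \<longrightarrow>
         filterlim (mu d \<alpha> \<gamma>) at_top (at_left \<alpha>)) \<and>
    (\<forall>(\<alpha>::real) (\<gamma> :: nat set \<Rightarrow> real) (\<tau>::real) (n::nat).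
       \<alpha> > 1/2 \<and> positive_weights \<gamma> \<and> \<tau> \<in> {0<..<1} \<and> n \<ge> 2 \<longrightarrow>
         (\<forall>lam\<in>{1/2..<\<alpha>}.
            (\<lambda>u. \<gamma> u powr (1 / lam) * (2 * zeta (\<alpha> / lam)) ^ card u)
              summable_on (index_sets - {{}}) \<longrightarrow>
            (\<exists>B::real. \<forall>d\<ge>1.
               sqrt (C \<tau> lam * ln (real n)) / real n powr (lam + 1/2)
                 * mu d \<alpha> \<gamma> lam powr lam \<le> B)))"
proof -
  \<comment> \<open>\<open>c\<close> is obtained before any parameter is introduced, so
    \<open>error_const c\<close> depends on \<tau> and \<open>lam\<close> only.\<close>
  obtain c :: real where c: "c > 0" "\<And>n. n \<ge> 2 \<Longrightarrow> c * real n \<le> real (card (primes_in n)) * ln (real n)"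
    using card_primes_in_lower_bound by blast
  show ?thesis
  proof (intro exI[of _ "error_const c"] conjI allI ballI impI)
    fix \<tau> lam :: real assume "\<tau> \<in> {0<..<1}"
    then show "error_const c \<tau> lam > 0" using c(1) by (intro error_const_pos) auto
  next
    fix lam :: real assume "lam \<ge> 1/2"
    then show "filterlim (\<lambda>\<tau>. error_const c \<tau> lam) at_top (at_left 1)"
      using c(1) by (intro filterlim_error_const_at_1)
    show "filterlim (\<lambda>\<tau>. error_const c \<tau> lam) at_top (at_right 0)"
      using c(1) by (rule filterlim_error_const_at_0)
  next
    fix d :: nat and \<alpha> \<tau> :: real and \<gamma> :: "nat set \<Rightarrow> real" and n :: nat
    assume *: "d \<ge> 1 \<and> \<alpha> > 1/2 \<and> positive_weights \<gamma> \<and> \<tau> \<in> {0<..<1} \<and> n \<ge> 2"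
    interpret weighted_korobov \<alpha> \<gamma> \<tau> n using * by unfold_locales auto
    show "\<exists>zp z. cbc_construction \<alpha> \<gamma> \<tau> d n zp z" by (rule ex_cbc_construction)
    fix zp z lam
    assume "cbc_construction \<alpha> \<gamma> \<tau> d n zp z" "lam \<in> {1/2..<\<alpha>}"
    then show "ran_error d \<alpha> \<gamma> (randomised_lattice d n z)
       \<le> ennreal (sqrt (error_const c \<tau> lam * ln (real n)) / real n powr (lam + 1/2) * mu d \<alpha> \<gamma> lam powr lam)"
      using * c by (intro ran_error_cbc_le) auto
  next
    fix d :: nat and \<alpha> :: real and \<gamma> :: "nat set \<Rightarrow> real"
    assume "d \<ge> 1 \<and> \<alpha> > 1/2 \<and> positive_weights \<gamma>"
    then show "filterlim (mu d \<alpha> \<gamma>) at_top (at_left \<alpha>)" by (intro filterlim_mu) auto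
  next
    fix \<alpha> \<tau> lam :: real and \<gamma> :: "nat set \<Rightarrow> real" and n :: nat
    assume *: "\<alpha> > 1/2 \<and> positive_weights \<gamma> \<and> \<tau> \<in> {0<..<1} \<and> n \<ge> 2" and lam: "lam \<in> {1/2..<\<alpha>}"
      and summable: "(\<lambda>u. \<gamma> u powr (1 / lam) * (2 * zeta (\<alpha> / lam)) ^ card u) summable_on (index_sets - {{}})"
    let ?S = "\<Sum>\<^sub>\<infinity>u\<in>index_sets - {{}}. \<gamma> u powr (1 / lam) * (2 * zeta (\<alpha> / lam)) ^ card u"
    have "sqrt (error_const c \<tau> lam * ln (real n)) / real n powr (lam + 1/2) * mu d \<alpha> \<gamma> lam powr lam
        \<le> sqrt (error_const c \<tau> lam * ln (real n)) / real n powr (lam + 1/2) * ?S powr lam" for d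
    proof (rule mult_left_mono)
      show "mu d \<alpha> \<gamma> lam powr lam \<le> ?S powr lam"
        using * lam by (intro powr_mono2 mu_nonneg mu_le_infsum[OF _ _ _ summable]) auto
      have "error_const c \<tau> lam > 0" using c(1) * by (intro error_const_pos) auto
      then show "0 \<le> sqrt (error_const c \<tau> lam * ln (real n)) / real n powr (lam + 1/2)"
        using * by (intro divide_nonneg_nonneg) auto
    qed
    then show "\<exists>B. \<forall>d\<ge>1. sqrt (error_const c \<tau> lam * ln (real n)) / real n powr (lam + 1/2) * mu d \<alpha> \<gamma> lam powr lam \<le> B"
      by blast
  qed
qed

end
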